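(* Let $F$ be a field of characteristic $0$, and let $H_1$, $H_2$ be isomorphic quaternion algebras over $F$, with orthogonal involutions $\ddagger_1$ and $\ddagger_2$ respectively. The following two statements are equivalent. (1) Whenever $H$ is a quaternion algebra over a field extension $F'$ of $F$ with orthogonal involution $\ddagger$ such that $(H_1,\ddagger_1)$ and $(H_2,\ddagger_2)$ embed into $(H,\ddagger)$, there exists an element $\gamma \in SL^\ddagger(2,H)$ such that $\gamma\, SL^{\ddagger_1}(2,H_1)\, \gamma^{-1} = SL^{\ddagger_2}(2,H_2)$ and $\gamma\, SL(2,F)\, \gamma^{-1} = SL(2,F)$, where $SL^{\ddagger_1}(2,H_1)$, $SL^{\ddagger_2}(2,H_2)$ and $SL(2,F)$ are regarded as subgroups of $SL^\ddagger(2,H)$ via the embeddings. (2) $(H_1,\ddagger_1) \cong (H_2,\ddagger_2)$ as algebras with involution.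
   Context: An orthogonal involution $\ddagger$ on a quaternion algebra $H$ over a field $F$ is an $F$-linear map $x\mapsto x^\ddagger$ with $(xy)^\ddagger = y^\ddagger x^\ddagger$ and $(x^\ddagger)^\ddagger = x$, different from the standard involution (quaternion conjugation). Set $H^+ = \{x \in H : x^\ddagger = x\}$. Define the group $$SL^\ddagger(2,H) = \left\{\begin{pmatrix} a & b \\ c & d \end{pmatrix} \in \mathrm{Mat}(2,H) : ab^\ddagger \in H^+,\ cd^\ddagger \in H^+,\ ad^\ddagger - bc^\ddagger = 1\right\}$$ under matrix multiplication; it contains $SL(2,F)$. A homomorphism of algebras with involution $f:(A,\ddagger_1)\to(B,\ddagger_2)$ is an $F$-algebra homomorphism with $f(x^{\ddagger_1}) = f(x)^{\ddagger_2}$ for all $x$; embeddings and isomorphisms are injective, respectively bijective, such homomorphisms.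
   Formalization: In (1), the embeddings of (H_1,‡_1) and (H_2,‡_2) into (H,‡) may be chosen together with γ; if γ is demanded for every given pair of embeddings, (2) ⇒ (1) fails, e.g. for rational Hamilton quaternions inside those over Q(√2). *)

theory Defs
  imports "HOL-Algebra.Algebra"
begin

section \<open>Algebras over a field\<close>

text \<open>The locale \<open>algebra\<close> of HOL-Algebra is commutative, so associative unital algebras
  are introduced here.\<close>

locale assoc_algebra = F?: field F + module F A + A?: ring A
  for F (structure) and A (structure) +
  assumes smult_mult_left:
      "\<lbrakk> c \<in> carrier F; x \<in> carrier A; y \<in> carrier A \<rbrakk> \<Longrightarrow>
        (c \<odot>\<^bsub>A\<^esub> x) \<otimes>\<^bsub>A\<^esub> y = c \<odot>\<^bsub>A\<^esub> (x \<otimes>\<^bsub>A\<^esub> y)"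
    and smult_mult_right:
      "\<lbrakk> c \<in> carrier F; x \<in> carrier A; y \<in> carrier A \<rbrakk> \<Longrightarrow>
        x \<otimes>\<^bsub>A\<^esub> (c \<odot>\<^bsub>A\<^esub> y) = c \<odot>\<^bsub>A\<^esub> (x \<otimes>\<^bsub>A\<^esub> y)"

definition field_of_char_0 :: "('f, 'm) ring_scheme \<Rightarrow> bool" where
  "field_of_char_0 F \<longleftrightarrow> field F \<and> (\<forall>n::nat. n > 0 \<longrightarrow> [n] \<cdot>\<^bsub>F\<^esub> \<one>\<^bsub>F\<^esub> \<noteq> \<zero>\<^bsub>F\<^esub>)"

definition alg_hom :: "('f, 'm) ring_scheme \<Rightarrow> ('f, 'a, 'n) module_scheme \<Rightarrow>
    ('f, 'b, 'k) module_scheme \<Rightarrow> ('a \<Rightarrow> 'b) \<Rightarrow> bool" where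
  "alg_hom F A B f \<longleftrightarrow> f \<in> ring_hom A B \<and>
     (\<forall>c\<in>carrier F. \<forall>x\<in>carrier A. f (c \<odot>\<^bsub>A\<^esub> x) = c \<odot>\<^bsub>B\<^esub> f x)"

definition alg_iso :: "('f, 'm) ring_scheme \<Rightarrow> ('f, 'a, 'n) module_scheme \<Rightarrow>
    ('f, 'b, 'k) module_scheme \<Rightarrow> ('a \<Rightarrow> 'b) \<Rightarrow> bool" where
  "alg_iso F A B f \<longleftrightarrow> alg_hom F A B f \<and> bij_betw f (carrier A) (carrier B)"

text \<open>An algebra over an extension field, regarded as an algebra over the base field
  along the inclusion \<open>\<phi>\<close> of the base field.\<close>

definition restrict_scalars :: "('f \<Rightarrow> 'g) \<Rightarrow> ('g, 'a, 'n) module_scheme \<Rightarrow> ('f, 'a) module" where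
  "restrict_scalars \<phi> A =
     \<lparr> carrier = carrier A, monoid.mult = monoid.mult A, one = one A,
       ring.zero = ring.zero A, ring.add = ring.add A,
       smult = (\<lambda>c x. \<phi> c \<odot>\<^bsub>A\<^esub> x) \<rparr>"


section \<open>Quaternion algebras and orthogonal involutions\<close>

definition quat_comb :: "('f, 'h, 'n) module_scheme \<Rightarrow> 'h \<Rightarrow> 'h \<Rightarrow> 'f \<times> 'f \<times> 'f \<times> 'f \<Rightarrow> 'h" where
  "quat_comb H i j = (\<lambda>(t, x, y, z).
     t \<odot>\<^bsub>H\<^esub> \<one>\<^bsub>H\<^esub> \<oplus>\<^bsub>H\<^esub> x \<odot>\<^bsub>H\<^esub> i \<oplus>\<^bsub>H\<^esub> y \<odot>\<^bsub>H\<^esub> j \<oplus>\<^bsub>H\<^esub> z \<odot>\<^bsub>H\<^esub> (i \<otimes>\<^bsub>H\<^esub> j))"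

text \<open>Standard generators: \<open>i\<^sup>2 = a\<close> and \<open>j\<^sup>2 = b\<close> are nonzero scalars, \<open>j i = - i j\<close>, and
  \<open>1, i, j, i j\<close> is a basis.\<close>

definition quat_gens :: "('f, 'm) ring_scheme \<Rightarrow> ('f, 'h, 'n) module_scheme \<Rightarrow> 'h \<Rightarrow> 'h \<Rightarrow> bool" where
  "quat_gens F H i j \<longleftrightarrow> i \<in> carrier H \<and> j \<in> carrier H \<and>
     (\<exists>a \<in> carrier F - {\<zero>\<^bsub>F\<^esub>}. i \<otimes>\<^bsub>H\<^esub> i = a \<odot>\<^bsub>H\<^esub> \<one>\<^bsub>H\<^esub>) \<and>
     (\<exists>b \<in> carrier F - {\<zero>\<^bsub>F\<^esub>}. j \<otimes>\<^bsub>H\<^esub> j = b \<odot>\<^bsub>H\<^esub> \<one>\<^bsub>H\<^esub>) \<and>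
     j \<otimes>\<^bsub>H\<^esub> i = \<ominus>\<^bsub>H\<^esub> (i \<otimes>\<^bsub>H\<^esub> j) \<and>
     bij_betw (quat_comb H i j) (carrier F \<times> carrier F \<times> carrier F \<times> carrier F) (carrier H)"

text \<open>This is the definition for characteristic other than 2.\<close>

definition quaternion_algebra :: "('f, 'm) ring_scheme \<Rightarrow> ('f, 'h, 'n) module_scheme \<Rightarrow> bool" where
  "quaternion_algebra F H \<longleftrightarrow> assoc_algebra F H \<and> (\<exists>i j. quat_gens F H i j)"

text \<open>\<open>c\<close> is quaternion conjugation. Conjugation does not depend on the choice of
  standard generators, so a single choice suffices.\<close>

definition is_standard_involution ::
    "('f, 'm) ring_scheme \<Rightarrow> ('f, 'h, 'n) module_scheme \<Rightarrow> ('h \<Rightarrow> 'h) \<Rightarrow> bool" where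
  "is_standard_involution F H c \<longleftrightarrow> (\<exists>i j. quat_gens F H i j \<and>
     (\<forall>t\<in>carrier F. \<forall>x\<in>carrier F. \<forall>y\<in>carrier F. \<forall>z\<in>carrier F.
        c (quat_comb H i j (t, x, y, z)) =
          quat_comb H i j (t, \<ominus>\<^bsub>F\<^esub> x, \<ominus>\<^bsub>F\<^esub> y, \<ominus>\<^bsub>F\<^esub> z)))"

definition alg_involution ::
    "('f, 'm) ring_scheme \<Rightarrow> ('f, 'h, 'n) module_scheme \<Rightarrow> ('h \<Rightarrow> 'h) \<Rightarrow> bool" where
  "alg_involution F H s \<longleftrightarrow> s \<in> carrier H \<rightarrow> carrier H \<and>
     (\<forall>x\<in>carrier H. \<forall>y\<in>carrier H. s (x \<oplus>\<^bsub>H\<^esub> y) = s x \<oplus>\<^bsub>H\<^esub> s y) \<and>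
     (\<forall>c\<in>carrier F. \<forall>x\<in>carrier H. s (c \<odot>\<^bsub>H\<^esub> x) = c \<odot>\<^bsub>H\<^esub> s x) \<and>
     (\<forall>x\<in>carrier H. \<forall>y\<in>carrier H. s (x \<otimes>\<^bsub>H\<^esub> y) = s y \<otimes>\<^bsub>H\<^esub> s x) \<and>
     (\<forall>x\<in>carrier H. s (s x) = x)"

definition orthogonal_involution ::
    "('f, 'm) ring_scheme \<Rightarrow> ('f, 'h, 'n) module_scheme \<Rightarrow> ('h \<Rightarrow> 'h) \<Rightarrow> bool" where
  "orthogonal_involution F H s \<longleftrightarrow> alg_involution F H s \<and> \<not> is_standard_involution F H s"

definition inv_alg_hom :: "('f, 'm) ring_scheme \<Rightarrow>
    ('f, 'a, 'n) module_scheme \<Rightarrow> ('a \<Rightarrow> 'a) \<Rightarrow> ('f, 'b, 'k) module_scheme \<Rightarrow> ('b \<Rightarrow> 'b) \<Rightarrow>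
    ('a \<Rightarrow> 'b) \<Rightarrow> bool" where
  "inv_alg_hom F A s B t f \<longleftrightarrow> alg_hom F A B f \<and> (\<forall>x\<in>carrier A. f (s x) = t (f x))"

definition inv_alg_embedding :: "('f, 'm) ring_scheme \<Rightarrow>
    ('f, 'a, 'n) module_scheme \<Rightarrow> ('a \<Rightarrow> 'a) \<Rightarrow> ('f, 'b, 'k) module_scheme \<Rightarrow> ('b \<Rightarrow> 'b) \<Rightarrow>
    ('a \<Rightarrow> 'b) \<Rightarrow> bool" where
  "inv_alg_embedding F A s B t f \<longleftrightarrow> inv_alg_hom F A s B t f \<and> inj_on f (carrier A)"

definition inv_alg_iso :: "('f, 'm) ring_scheme \<Rightarrow>
    ('f, 'a, 'n) module_scheme \<Rightarrow> ('a \<Rightarrow> 'a) \<Rightarrow> ('f, 'b, 'k) module_scheme \<Rightarrow> ('b \<Rightarrow> 'b) \<Rightarrow>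
    ('a \<Rightarrow> 'b) \<Rightarrow> bool" where
  "inv_alg_iso F A s B t f \<longleftrightarrow> inv_alg_hom F A s B t f \<and> bij_betw f (carrier A) (carrier B)"


section \<open>The groups of matrices\<close>

text \<open>\<open>Mat2 a b c d\<close> has rows \<open>a, b\<close> and \<open>c, d\<close>.\<close>

datatype 'a mat2 = Mat2 'a 'a 'a 'a

fun mat2_mult :: "('a, 'm) ring_scheme \<Rightarrow> 'a mat2 \<Rightarrow> 'a mat2 \<Rightarrow> 'a mat2" where
  "mat2_mult R (Mat2 a b c d) (Mat2 a' b' c' d') =
     Mat2 (a \<otimes>\<^bsub>R\<^esub> a' \<oplus>\<^bsub>R\<^esub> b \<otimes>\<^bsub>R\<^esub> c') (a \<otimes>\<^bsub>R\<^esub> b' \<oplus>\<^bsub>R\<^esub> b \<otimes>\<^bsub>R\<^esub> d')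
          (c \<otimes>\<^bsub>R\<^esub> a' \<oplus>\<^bsub>R\<^esub> d \<otimes>\<^bsub>R\<^esub> c') (c \<otimes>\<^bsub>R\<^esub> b' \<oplus>\<^bsub>R\<^esub> d \<otimes>\<^bsub>R\<^esub> d')"

definition SL2 :: "('a, 'm) ring_scheme \<Rightarrow> 'a mat2 set" where
  "SL2 F = {Mat2 a b c d | a b c d.
     a \<in> carrier F \<and> b \<in> carrier F \<and> c \<in> carrier F \<and> d \<in> carrier F \<and>
     a \<otimes>\<^bsub>F\<^esub> d \<ominus>\<^bsub>F\<^esub> b \<otimes>\<^bsub>F\<^esub> c = \<one>\<^bsub>F\<^esub>}"

definition fixed_set :: "('a, 'm) ring_scheme \<Rightarrow> ('a \<Rightarrow> 'a) \<Rightarrow> 'a set" where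
  "fixed_set H s = {x \<in> carrier H. s x = x}"

definition SL_inv :: "('a, 'm) ring_scheme \<Rightarrow> ('a \<Rightarrow> 'a) \<Rightarrow> 'a mat2 monoid" where
  "SL_inv H s =
     \<lparr> carrier = {Mat2 a b c d | a b c d.
         a \<in> carrier H \<and> b \<in> carrier H \<and> c \<in> carrier H \<and> d \<in> carrier H \<and>
         a \<otimes>\<^bsub>H\<^esub> s b \<in> fixed_set H s \<and> c \<otimes>\<^bsub>H\<^esub> s d \<in> fixed_set H s \<and>
         a \<otimes>\<^bsub>H\<^esub> s d \<ominus>\<^bsub>H\<^esub> b \<otimes>\<^bsub>H\<^esub> s c = \<one>\<^bsub>H\<^esub>},
       monoid.mult = mat2_mult H,
       one = Mat2 \<one>\<^bsub>H\<^esub> \<zero>\<^bsub>H\<^esub> \<zero>\<^bsub>H\<^esub> \<one>\<^bsub>H\<^esub> \<rparr>"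

definition conj_set :: "('a, 'm) monoid_scheme \<Rightarrow> 'a \<Rightarrow> 'a set \<Rightarrow> 'a set" where
  "conj_set G g S = (\<lambda>x. g \<otimes>\<^bsub>G\<^esub> x \<otimes>\<^bsub>G\<^esub> inv\<^bsub>G\<^esub> g) ` S"


section \<open>Conjugacy of the embedded groups\<close>

text \<open>\<open>H\<close> is an algebra over an extension, with inclusion \<open>\<phi>\<close>, of the base field \<open>F\<close> of
  \<open>H1\<close> and \<open>H2\<close>, and both of these embed into \<open>H\<close> in such a way that some \<open>\<gamma>\<close> conjugates the
  first group to the second and normalises \<open>SL(2, F)\<close>.

  The embeddings are existentially quantified. With \<open>\<gamma>\<close> demanded for every pair of embeddings
  the condition would already fail for \<open>H1 = H2\<close>: let both be the rational Hamilton
  quaternions with the involution negating only \<open>i\<close>, and let \<open>H\<close> be the Hamilton quaternions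
  over \<open>\<rat>(\<surd>2)\<close> with the involution of the same shape. Take for one embedding the inclusion and
  for the other the one sending \<open>i\<close> to \<open>i\<close> and \<open>j\<close> to \<open>(j + k) / \<surd>2\<close>, that is, conjugation by
  \<open>z0 = 1 + \<surd>2 + i\<close>. An element \<open>\<gamma>\<close> of the group normalising \<open>SL(2, F)\<close> is \<open>z g\<close> with \<open>g\<close> in
  \<open>GL(2, F)\<close>, \<open>z\<close> a unit of \<open>H\<close> and \<open>z s(z) = 1 / det g\<close> rational. If \<open>\<gamma>\<close> also conjugates the first
  group to the second then \<open>z\<close> conjugates the image of \<open>H1\<close> to that of \<open>H2\<close>, so \<open>z = f z0 h\<close> with
  \<open>f\<close> in \<open>\<rat>(\<surd>2)\<close> and \<open>h\<close> a rational quaternion. Hence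
  \<open>z s(z) = f\<^sup>2 (4 + 2 \<surd>2) r\<close> with \<open>r = h s(h)\<close> rational, which is impossible
  because \<open>4 + 2 \<surd>2\<close> has norm \<open>8\<close>, not a square in \<open>\<rat>\<close>.\<close>

definition conjugate_in :: "('f, 'm) ring_scheme \<Rightarrow>
    ('f, 'a, 'n) module_scheme \<Rightarrow> ('a \<Rightarrow> 'a) \<Rightarrow> ('f, 'b, 'k) module_scheme \<Rightarrow> ('b \<Rightarrow> 'b) \<Rightarrow>
    ('f \<Rightarrow> 'g) \<Rightarrow> ('g, 'h, 'l) module_scheme \<Rightarrow> ('h \<Rightarrow> 'h) \<Rightarrow> bool" where
  "conjugate_in F H1 s1 H2 s2 \<phi> H s \<longleftrightarrow> (\<exists>e1 e2 \<gamma>.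
     inv_alg_embedding F H1 s1 (restrict_scalars \<phi> H) s e1 \<and>
     inv_alg_embedding F H2 s2 (restrict_scalars \<phi> H) s e2 \<and>
     \<gamma> \<in> carrier (SL_inv H s) \<and>
     conj_set (SL_inv H s) \<gamma> (map_mat2 e1 ` carrier (SL_inv H1 s1)) =
       map_mat2 e2 ` carrier (SL_inv H2 s2) \<and>
     conj_set (SL_inv H s) \<gamma> (map_mat2 (\<lambda>c. \<phi> c \<odot>\<^bsub>H\<^esub> \<one>\<^bsub>H\<^esub>) ` SL2 F) =
       map_mat2 (\<lambda>c. \<phi> c \<odot>\<^bsub>H\<^esub> \<one>\<^bsub>H\<^esub>) ` SL2 F)"

text \<open>The type \<open>'u\<close> can hold the underlying sets of structures at least as large as \<open>A\<close>.
  Quantifying over all extension fields of \<open>F\<close> and all algebras over them is only possible within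
  fixed types; types satisfying this for \<open>A = carrier F\<close> suffice, and since such types are
  otherwise arbitrary, no extension field or algebra is excluded.\<close>

definition large_type :: "'u itself \<Rightarrow> 'a set \<Rightarrow> bool" where
  "large_type U A \<longleftrightarrow> (\<exists>g :: 'a \<Rightarrow> 'u. inj_on g A)"

end

theory Submission
  imports Defs
begin

text \<open>Suppose first that \<open>f\<close> is an isomorphism of \<open>(H1, s1)\<close> onto \<open>(H2, s2)\<close>. If \<open>e1\<close> embeds \<open>H1\<close> into \<open>H\<close>, then
  \<open>e1 \<circ> f\<^sup>-\<^sup>1\<close> embeds \<open>H2\<close> with the same image, so that the two groups coincide as sets of matrices over \<open>H\<close> and
  \<open>\<gamma> = 1\<close> conjugates one to the other.

  For the other direction it is enough to have a single algebra \<open>H\<close> that receives both pairs. A nonstandard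
  involution fixes both members of some pair of standard generators \<open>i, j\<close>
  (\<open>symmetric_generators\<close>); write \<open>i\<^sup>2 = a\<close> and \<open>j\<^sup>2 = b\<close>. Over an extension \<open>E\<close> of \<open>F\<close> that contains
  square roots of \<open>a\<close> and \<open>b\<close> the matrix algebra \<open>Mat(2, E)\<close> with transposition contains a copy of the algebra:
  it has anticommuting symmetric matrices \<open>u, v\<close> of square \<open>1\<close>, and \<open>i \<mapsto> \<surd>a u\<close>, \<open>j \<mapsto> \<surd>b v\<close> preserves the
  relations. Adjoining the four square roots that belong to \<open>H1\<close> and \<open>H2\<close> makes both embed. Such an
  \<open>E\<close> has the cardinality of the infinite field \<open>F\<close>, so copies of \<open>E\<close> and \<open>Mat(2, E)\<close>
  can be found in the given types (\<open>adjoin_square_roots\<close>, \<open>large_split_embedding\<close>).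

  Now let \<open>\<gamma>\<close> conjugate the first group to the second and normalise \<open>SL(2, F)\<close>. Comparing the entries
  of \<open>\<gamma> x = x' \<gamma>\<close> for the two elementary unipotent \<open>x\<close> shows that the entries of \<open>\<gamma>\<close> are \<open>F\<close>-multiples of one
  element \<open>z\<close>, that is, \<open>\<gamma> = z g\<close> with \<open>g\<close> a matrix over \<open>F\<close> (\<open>proportional_entries\<close>). The equations
  that say that \<open>\<gamma>\<close> lies in the group and is invertible become \<open>det g z s(z) = 1 = det g s(z) z\<close>; hence \<open>z\<close> is a unit
  and conjugation by \<open>z\<close> commutes with \<open>s\<close>. Conjugating the unipotent matrix with upper right entry
  \<open>h\<close>, where \<open>h\<close> in \<open>H1\<close> is fixed by \<open>s1\<close>, shows that \<open>z h z\<^sup>-\<^sup>1\<close> lies in \<open>H2\<close>. Apply this to the two symmetric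
  generators of \<open>H1\<close>: their conjugates lie in \<open>H2\<close>, are fixed by \<open>s2\<close> and satisfy the same
  relations. Since \<open>H2\<close> has dimension four, such elements are standard generators
  (\<open>other_generators\<close>), and sending generators to generators is the required isomorphism
  (\<open>presentation_iso\<close>, \<open>conjugate_imp_iso\<close>).

  The right inverse of \<open>\<gamma>\<close> can be written down from the defining equations of the group. That
  it is also a left inverse depends on \<open>Mat(2, H)\<close> being finite dimensional (\<open>mat2_left_inverse\<close>).\<close>

section \<open>One-sided inverses and matrix rings\<close>

definition mat2_ring :: "('a, 'm) ring_scheme \<Rightarrow> 'a mat2 ring" where
  "mat2_ring R =
     \<lparr> carrier = {Mat2 a b c d | a b c d.
         a \<in> carrier R \<and> b \<in> carrier R \<and> c \<in> carrier R \<and> d \<in> carrier R},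
       monoid.mult = mat2_mult R,
       one = Mat2 \<one>\<^bsub>R\<^esub> \<zero>\<^bsub>R\<^esub> \<zero>\<^bsub>R\<^esub> \<one>\<^bsub>R\<^esub>,
       ring.zero = Mat2 \<zero>\<^bsub>R\<^esub> \<zero>\<^bsub>R\<^esub> \<zero>\<^bsub>R\<^esub> \<zero>\<^bsub>R\<^esub>,
       ring.add = (\<lambda>A B. case A of Mat2 a b c d \<Rightarrow> case B of Mat2 a' b' c' d' \<Rightarrow>
         Mat2 (a \<oplus>\<^bsub>R\<^esub> a') (b \<oplus>\<^bsub>R\<^esub> b') (c \<oplus>\<^bsub>R\<^esub> c') (d \<oplus>\<^bsub>R\<^esub> d')) \<rparr>"

lemma mat2_ring_simps [simp]:
  "Mat2 a b c d \<in> carrier (mat2_ring R) \<longleftrightarrow>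
     a \<in> carrier R \<and> b \<in> carrier R \<and> c \<in> carrier R \<and> d \<in> carrier R"
  "Mat2 a b c d \<otimes>\<^bsub>mat2_ring R\<^esub> Mat2 a' b' c' d' =
     Mat2 (a \<otimes>\<^bsub>R\<^esub> a' \<oplus>\<^bsub>R\<^esub> b \<otimes>\<^bsub>R\<^esub> c') (a \<otimes>\<^bsub>R\<^esub> b' \<oplus>\<^bsub>R\<^esub> b \<otimes>\<^bsub>R\<^esub> d')
          (c \<otimes>\<^bsub>R\<^esub> a' \<oplus>\<^bsub>R\<^esub> d \<otimes>\<^bsub>R\<^esub> c') (c \<otimes>\<^bsub>R\<^esub> b' \<oplus>\<^bsub>R\<^esub> d \<otimes>\<^bsub>R\<^esub> d')"
  "Mat2 a b c d \<oplus>\<^bsub>mat2_ring R\<^esub> Mat2 a' b' c' d' =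
     Mat2 (a \<oplus>\<^bsub>R\<^esub> a') (b \<oplus>\<^bsub>R\<^esub> b') (c \<oplus>\<^bsub>R\<^esub> c') (d \<oplus>\<^bsub>R\<^esub> d')"
  "\<one>\<^bsub>mat2_ring R\<^esub> = Mat2 \<one>\<^bsub>R\<^esub> \<zero>\<^bsub>R\<^esub> \<zero>\<^bsub>R\<^esub> \<one>\<^bsub>R\<^esub>"
  "\<zero>\<^bsub>mat2_ring R\<^esub> = Mat2 \<zero>\<^bsub>R\<^esub> \<zero>\<^bsub>R\<^esub> \<zero>\<^bsub>R\<^esub> \<zero>\<^bsub>R\<^esub>"
  by (auto simp: mat2_ring_def)

lemma mat2_ring_induct:
  "(\<And>a b c d. \<lbrakk>a \<in> carrier R; b \<in> carrier R; c \<in> carrier R; d \<in> carrier R\<rbrakk> \<Longrightarrow> P (Mat2 a b c d))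
    \<Longrightarrow> M \<in> carrier (mat2_ring R) \<Longrightarrow> P M"
  by (auto simp: mat2_ring_def)

lemma (in ring) ring_mat2_ring: "ring (mat2_ring R)"
proof (rule ringI)
  show "abelian_group (mat2_ring R)"
  proof (rule abelian_groupI)
    fix M assume "M \<in> carrier (mat2_ring R)"
    then obtain a b c d where M: "M = Mat2 a b c d"
        "a \<in> carrier R" "b \<in> carrier R" "c \<in> carrier R" "d \<in> carrier R"
      by (auto simp: mat2_ring_def)
    show "\<exists>Y\<in>carrier (mat2_ring R). Y \<oplus>\<^bsub>mat2_ring R\<^esub> M = \<zero>\<^bsub>mat2_ring R\<^esub>"
      by (rule bexI[of _ "Mat2 (\<ominus> a) (\<ominus> b) (\<ominus> c) (\<ominus> d)"]) (use M in \<open>auto simp: l_neg\<close>)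
  qed (auto elim!: mat2_ring_induct[rotated] simp: a_ac)
  show "monoid (mat2_ring R)"
    by (rule monoidI) (auto elim!: mat2_ring_induct[rotated] simp: l_distr r_distr m_assoc a_ac)
qed (auto elim!: mat2_ring_induct[rotated] simp: l_distr r_distr a_ac)

text \<open>Left multiplication by \<open>y\<close> is linear over the central field \<open>K\<close> and injective, because
  \<open>x\<close> undoes it. In finite dimension it is then onto, so \<open>y\<close> has a right inverse \<open>w\<close>, and
  \<open>x = x (y w) = w\<close>.\<close>

lemma (in ring) finite_dimension_left_inverse:
  assumes K: "subfield K R" and central: "\<And>k x. k \<in> K \<Longrightarrow> x \<in> carrier R \<Longrightarrow> k \<otimes> x = x \<otimes> k"
    and dim: "dimension n K (carrier R)"
    and xy: "x \<in> carrier R" "y \<in> carrier R" "x \<otimes> y = \<one>"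
  shows "y \<otimes> x = \<one>"
proof -
  have KR: "K \<subseteq> carrier R" using subfieldE(3)[OF K] .
  obtain Us where Us: "set Us \<subseteq> carrier R" "independent K Us" "length Us = n" "Span K Us = carrier R"
    using exists_base[OF K dim] by blast
  have comb: "combine Ks (map ((\<otimes>) y) Vs) = y \<otimes> combine Ks Vs"
    if "set Ks \<subseteq> K" "set Vs \<subseteq> carrier R" for Ks Vs
    using that
  proof (induct Ks Vs rule: combine.induct)
    case (1 k Ks u Us)
    have c: "k \<in> carrier R" "u \<in> carrier R" "combine Ks Us \<in> carrier R" using 1 KR by auto
    have "k \<otimes> (y \<otimes> u) = y \<otimes> (k \<otimes> u)"
      using c xy central[of k y] 1 by (metis list.set_intros(1) m_assoc subset_code(1))
    thus ?case using 1 c xy by (simp add: r_distr)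
  qed (use xy in auto)
  have "independent K (map ((\<otimes>) y) Us)"
  proof (rule trivial_combine_imp_independent[OF K])
    show "set (map ((\<otimes>) y) Us) \<subseteq> carrier R" using Us xy by auto
    fix Ks assume Ks: "set Ks \<subseteq> K" "combine Ks (map ((\<otimes>) y) Us) = \<zero>"
    have c: "combine Ks Us \<in> carrier R" using Ks KR Us by auto
    have "combine Ks Us = (x \<otimes> y) \<otimes> combine Ks Us" using xy c by simp
    also have "... = x \<otimes> (y \<otimes> combine Ks Us)" using xy(1,2) c by (rule m_assoc)
    also have "... = \<zero>" by (simp only: comb[OF Ks(1) Us(1), symmetric] Ks(2) r_null[OF xy(1)])
    finally show "set (take (length (map ((\<otimes>) y) Us)) Ks) \<subseteq> {\<zero>}"
      using independent_imp_trivial_combine[OF K Us(2) Ks(1)] by simp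
  qed
  hence "Span K (map ((\<otimes>) y) Us) = carrier R"
    using independent_length_eq_dimension[OF K dim, of "map ((\<otimes>) y) Us"] Us xy by auto
  moreover have "set (map ((\<otimes>) y) Us) \<subseteq> carrier R" using Us xy by auto
  ultimately obtain Ks where Ks: "set Ks \<subseteq> K" "\<one> = combine Ks (map ((\<otimes>) y) Us)"
    using Span_mem_iff_length_version[OF K, of "map ((\<otimes>) y) Us" \<one>] by auto
  define w where "w = combine Ks Us"
  have w: "w \<in> carrier R" "y \<otimes> w = \<one>" using comb[OF Ks(1) Us(1)] Ks KR Us by (auto simp: w_def)
  have "x = x \<otimes> (y \<otimes> w)" using w xy by simp
  also have "... = (x \<otimes> y) \<otimes> w" using xy(1,2) w(1) by (rule m_assoc[symmetric])
  also have "... = w" using w xy by simp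
  finally show ?thesis using w by simp
qed

section \<open>Elements that satisfy quaternion relations\<close>

text \<open>The product of coordinate vectors in the basis \<open>1, i, j, i j\<close> when \<open>i\<^sup>2 = a\<close>, \<open>j\<^sup>2 = b\<close> and
  \<open>j i = - i j\<close>.\<close>

definition quat_mult ::
    "('f, 'm) ring_scheme \<Rightarrow> 'f \<Rightarrow> 'f \<Rightarrow> 'f \<times> 'f \<times> 'f \<times> 'f \<Rightarrow> 'f \<times> 'f \<times> 'f \<times> 'f \<Rightarrow> 'f \<times> 'f \<times> 'f \<times> 'f" where
  "quat_mult F a b = (\<lambda>(t, x, y, z) (t', x', y', z').
     (t \<otimes>\<^bsub>F\<^esub> t' \<oplus>\<^bsub>F\<^esub> a \<otimes>\<^bsub>F\<^esub> (x \<otimes>\<^bsub>F\<^esub> x') \<oplus>\<^bsub>F\<^esub> b \<otimes>\<^bsub>F\<^esub> (y \<otimes>\<^bsub>F\<^esub> y') \<ominus>\<^bsub>F\<^esub> a \<otimes>\<^bsub>F\<^esub> b \<otimes>\<^bsub>F\<^esub> (z \<otimes>\<^bsub>F\<^esub> z'),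
      t \<otimes>\<^bsub>F\<^esub> x' \<oplus>\<^bsub>F\<^esub> x \<otimes>\<^bsub>F\<^esub> t' \<ominus>\<^bsub>F\<^esub> b \<otimes>\<^bsub>F\<^esub> (y \<otimes>\<^bsub>F\<^esub> z') \<oplus>\<^bsub>F\<^esub> b \<otimes>\<^bsub>F\<^esub> (z \<otimes>\<^bsub>F\<^esub> y'),
      t \<otimes>\<^bsub>F\<^esub> y' \<oplus>\<^bsub>F\<^esub> y \<otimes>\<^bsub>F\<^esub> t' \<oplus>\<^bsub>F\<^esub> a \<otimes>\<^bsub>F\<^esub> (x \<otimes>\<^bsub>F\<^esub> z') \<ominus>\<^bsub>F\<^esub> a \<otimes>\<^bsub>F\<^esub> (z \<otimes>\<^bsub>F\<^esub> x'),
      t \<otimes>\<^bsub>F\<^esub> z' \<oplus>\<^bsub>F\<^esub> z \<otimes>\<^bsub>F\<^esub> t' \<oplus>\<^bsub>F\<^esub> x \<otimes>\<^bsub>F\<^esub> y' \<ominus>\<^bsub>F\<^esub> y \<otimes>\<^bsub>F\<^esub> x'))"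

lemma (in module) smult_lcomm:
  "\<lbrakk>a \<in> carrier R; b \<in> carrier R; x \<in> carrier M\<rbrakk> \<Longrightarrow> a \<odot>\<^bsub>M\<^esub> (b \<odot>\<^bsub>M\<^esub> x) = b \<odot>\<^bsub>M\<^esub> (a \<odot>\<^bsub>M\<^esub> x)"
  by (simp add: smult_assoc1[symmetric] m_comm)

lemma (in assoc_algebra) involution_facts:
  assumes "alg_involution F A s"
  shows "\<And>x. x \<in> carrier A \<Longrightarrow> s x \<in> carrier A"
    "\<And>x y. \<lbrakk>x \<in> carrier A; y \<in> carrier A\<rbrakk> \<Longrightarrow> s (x \<oplus>\<^bsub>A\<^esub> y) = s x \<oplus>\<^bsub>A\<^esub> s y"
    "\<And>c x. \<lbrakk>c \<in> carrier F; x \<in> carrier A\<rbrakk> \<Longrightarrow> s (c \<odot>\<^bsub>A\<^esub> x) = c \<odot>\<^bsub>A\<^esub> s x"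
    "\<And>x y. \<lbrakk>x \<in> carrier A; y \<in> carrier A\<rbrakk> \<Longrightarrow> s (x \<otimes>\<^bsub>A\<^esub> y) = s y \<otimes>\<^bsub>A\<^esub> s x"
    "\<And>x. x \<in> carrier A \<Longrightarrow> s (s x) = x"
    "s \<one>\<^bsub>A\<^esub> = \<one>\<^bsub>A\<^esub>" "s \<zero>\<^bsub>A\<^esub> = \<zero>\<^bsub>A\<^esub>" "\<And>x. x \<in> carrier A \<Longrightarrow> s (\<ominus>\<^bsub>A\<^esub> x) = \<ominus>\<^bsub>A\<^esub> s x"
proof -
  show s: "\<And>x. x \<in> carrier A \<Longrightarrow> s x \<in> carrier A"
    "\<And>x y. \<lbrakk>x \<in> carrier A; y \<in> carrier A\<rbrakk> \<Longrightarrow> s (x \<oplus>\<^bsub>A\<^esub> y) = s x \<oplus>\<^bsub>A\<^esub> s y"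
    "\<And>c x. \<lbrakk>c \<in> carrier F; x \<in> carrier A\<rbrakk> \<Longrightarrow> s (c \<odot>\<^bsub>A\<^esub> x) = c \<odot>\<^bsub>A\<^esub> s x"
    "\<And>x y. \<lbrakk>x \<in> carrier A; y \<in> carrier A\<rbrakk> \<Longrightarrow> s (x \<otimes>\<^bsub>A\<^esub> y) = s y \<otimes>\<^bsub>A\<^esub> s x"
    "\<And>x. x \<in> carrier A \<Longrightarrow> s (s x) = x"
    using assms by (auto simp: alg_involution_def)
  have "s \<one>\<^bsub>A\<^esub> = s \<one>\<^bsub>A\<^esub> \<otimes>\<^bsub>A\<^esub> s (s \<one>\<^bsub>A\<^esub>)" by (simp add: s(1,5))
  also have "... = s (s \<one>\<^bsub>A\<^esub> \<otimes>\<^bsub>A\<^esub> \<one>\<^bsub>A\<^esub>)" by (simp add: s(1) s(4)[symmetric] del: A.r_one)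
  finally show "s \<one>\<^bsub>A\<^esub> = \<one>\<^bsub>A\<^esub>" by (simp add: s(1,5))
  show "s \<zero>\<^bsub>A\<^esub> = \<zero>\<^bsub>A\<^esub>" using s(3)[of \<zero> "\<zero>\<^bsub>A\<^esub>"] s(1) by simp
  show "s (\<ominus>\<^bsub>A\<^esub> x) = \<ominus>\<^bsub>A\<^esub> s x" if "x \<in> carrier A" for x
    using s(3)[of "\<ominus> \<one>" x] s(1) that by (simp add: smult_l_minus)
qed

text \<open>Only the relations are assumed here, and neither independence nor generation, so that the same
  multiplication table serves for the image of a pair of generators in any other algebra.\<close>

locale quat_relations = assoc_algebra +
  fixes i j a b
  assumes i_closed [simp]: "i \<in> carrier A" and j_closed [simp]: "j \<in> carrier A"
    and a_closed [simp]: "a \<in> carrier F" and b_closed [simp]: "b \<in> carrier F"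
    and ii: "i \<otimes>\<^bsub>A\<^esub> i = a \<odot>\<^bsub>A\<^esub> \<one>\<^bsub>A\<^esub>" and jj: "j \<otimes>\<^bsub>A\<^esub> j = b \<odot>\<^bsub>A\<^esub> \<one>\<^bsub>A\<^esub>"
    and ji: "j \<otimes>\<^bsub>A\<^esub> i = \<ominus>\<^bsub>A\<^esub> (i \<otimes>\<^bsub>A\<^esub> j)"
begin

abbreviation "coords \<equiv> carrier F \<times> carrier F \<times> carrier F \<times> carrier F"

lemma quat_unit_products:
  "i \<otimes>\<^bsub>A\<^esub> (i \<otimes>\<^bsub>A\<^esub> j) = a \<odot>\<^bsub>A\<^esub> j"
  "i \<otimes>\<^bsub>A\<^esub> j \<otimes>\<^bsub>A\<^esub> i = \<ominus>\<^bsub>A\<^esub> (a \<odot>\<^bsub>A\<^esub> j)"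
  "j \<otimes>\<^bsub>A\<^esub> (i \<otimes>\<^bsub>A\<^esub> j) = \<ominus>\<^bsub>A\<^esub> (b \<odot>\<^bsub>A\<^esub> i)"
  "i \<otimes>\<^bsub>A\<^esub> j \<otimes>\<^bsub>A\<^esub> j = b \<odot>\<^bsub>A\<^esub> i"
  "i \<otimes>\<^bsub>A\<^esub> j \<otimes>\<^bsub>A\<^esub> (i \<otimes>\<^bsub>A\<^esub> j) = \<ominus>\<^bsub>A\<^esub> ((a \<otimes> b) \<odot>\<^bsub>A\<^esub> \<one>\<^bsub>A\<^esub>)"
proof -
  show 1: "i \<otimes>\<^bsub>A\<^esub> (i \<otimes>\<^bsub>A\<^esub> j) = a \<odot>\<^bsub>A\<^esub> j"
    by (simp add: A.m_assoc[symmetric] ii smult_mult_left)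
  show 2: "i \<otimes>\<^bsub>A\<^esub> j \<otimes>\<^bsub>A\<^esub> i = \<ominus>\<^bsub>A\<^esub> (a \<odot>\<^bsub>A\<^esub> j)"
    by (simp add: A.m_assoc ji A.r_minus 1)
  show 3: "j \<otimes>\<^bsub>A\<^esub> (i \<otimes>\<^bsub>A\<^esub> j) = \<ominus>\<^bsub>A\<^esub> (b \<odot>\<^bsub>A\<^esub> i)"
    by (simp add: A.m_assoc[symmetric] ji A.l_minus) (simp add: A.m_assoc jj smult_mult_right)
  show "i \<otimes>\<^bsub>A\<^esub> j \<otimes>\<^bsub>A\<^esub> j = b \<odot>\<^bsub>A\<^esub> i"
    by (simp add: A.m_assoc jj smult_mult_right)
  have "i \<otimes>\<^bsub>A\<^esub> j \<otimes>\<^bsub>A\<^esub> (i \<otimes>\<^bsub>A\<^esub> j) = i \<otimes>\<^bsub>A\<^esub> (j \<otimes>\<^bsub>A\<^esub> (i \<otimes>\<^bsub>A\<^esub> j))" by (simp add: A.m_assoc)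
  also have "... = \<ominus>\<^bsub>A\<^esub> (b \<odot>\<^bsub>A\<^esub> (i \<otimes>\<^bsub>A\<^esub> i))" by (simp add: 3 A.r_minus smult_mult_right)
  also have "... = \<ominus>\<^bsub>A\<^esub> ((a \<otimes> b) \<odot>\<^bsub>A\<^esub> \<one>\<^bsub>A\<^esub>)" by (simp add: ii smult_assoc1[symmetric] F.m_comm)
  finally show "i \<otimes>\<^bsub>A\<^esub> j \<otimes>\<^bsub>A\<^esub> (i \<otimes>\<^bsub>A\<^esub> j) = \<ominus>\<^bsub>A\<^esub> ((a \<otimes> b) \<odot>\<^bsub>A\<^esub> \<one>\<^bsub>A\<^esub>)" .
qed

lemma quat_comb_apply:
  "quat_comb A i j (t, x, y, z) = t \<odot>\<^bsub>A\<^esub> \<one>\<^bsub>A\<^esub> \<oplus>\<^bsub>A\<^esub> x \<odot>\<^bsub>A\<^esub> i \<oplus>\<^bsub>A\<^esub> y \<odot>\<^bsub>A\<^esub> j \<oplus>\<^bsub>A\<^esub> z \<odot>\<^bsub>A\<^esub> (i \<otimes>\<^bsub>A\<^esub> j)"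
  by (simp add: quat_comb_def)

lemma quat_comb_closed [simp]: "v \<in> coords \<Longrightarrow> quat_comb A i j v \<in> carrier A"
  by (cases v) (simp add: quat_comb_apply)

lemma quat_comb_add:
  assumes "t \<in> carrier F" "x \<in> carrier F" "y \<in> carrier F" "z \<in> carrier F"
    "t' \<in> carrier F" "x' \<in> carrier F" "y' \<in> carrier F" "z' \<in> carrier F"
  shows "quat_comb A i j (t, x, y, z) \<oplus>\<^bsub>A\<^esub> quat_comb A i j (t', x', y', z') =
    quat_comb A i j (t \<oplus> t', x \<oplus> x', y \<oplus> y', z \<oplus> z')"
  using assms by (simp add: quat_comb_apply smult_l_distr M.a_ac)

lemma quat_comb_smult:
  assumes "c \<in> carrier F" "t \<in> carrier F" "x \<in> carrier F" "y \<in> carrier F" "z \<in> carrier F"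
  shows "c \<odot>\<^bsub>A\<^esub> quat_comb A i j (t, x, y, z) = quat_comb A i j (c \<otimes> t, c \<otimes> x, c \<otimes> y, c \<otimes> z)"
  using assms by (simp add: quat_comb_apply smult_r_distr smult_assoc1)

lemma quat_comb_mult:
  assumes "t \<in> carrier F" "x \<in> carrier F" "y \<in> carrier F" "z \<in> carrier F"
    "t' \<in> carrier F" "x' \<in> carrier F" "y' \<in> carrier F" "z' \<in> carrier F"
  shows "quat_comb A i j (t, x, y, z) \<otimes>\<^bsub>A\<^esub> quat_comb A i j (t', x', y', z') =
    quat_comb A i j (quat_mult F a b (t, x, y, z) (t', x', y', z'))"
proof -
  define k where "k = i \<otimes>\<^bsub>A\<^esub> j"
  have k: "k \<in> carrier A" by (simp add: k_def)
  have t: "i \<otimes>\<^bsub>A\<^esub> j = k" "j \<otimes>\<^bsub>A\<^esub> i = \<ominus>\<^bsub>A\<^esub> k" "i \<otimes>\<^bsub>A\<^esub> k = a \<odot>\<^bsub>A\<^esub> j" "k \<otimes>\<^bsub>A\<^esub> i = \<ominus>\<^bsub>A\<^esub> (a \<odot>\<^bsub>A\<^esub> j)"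
    "j \<otimes>\<^bsub>A\<^esub> k = \<ominus>\<^bsub>A\<^esub> (b \<odot>\<^bsub>A\<^esub> i)" "k \<otimes>\<^bsub>A\<^esub> j = b \<odot>\<^bsub>A\<^esub> i" "k \<otimes>\<^bsub>A\<^esub> k = \<ominus>\<^bsub>A\<^esub> ((a \<otimes> b) \<odot>\<^bsub>A\<^esub> \<one>\<^bsub>A\<^esub>)"
    using quat_unit_products ji by (simp_all add: k_def)
  show ?thesis
    using assms k
    apply (simp add: quat_comb_apply quat_mult_def t ii jj smult_mult_left smult_mult_right
      A.l_distr A.r_distr smult_r_distr)
    apply (simp add: smult_l_distr F.minus_eq)
    apply (simp add: smult_assoc1 smult_l_minus smult_r_minus)
    apply (simp add: M.a_ac smult_lcomm)
    done
qed

lemma involution_quat_comb: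
  assumes "alg_involution F A s" "s i = i" "s j = j"
    and "t \<in> carrier F" "x \<in> carrier F" "y \<in> carrier F" "z \<in> carrier F"
  shows "s (quat_comb A i j (t, x, y, z)) = quat_comb A i j (t, x, y, \<ominus> z)"
  using assms(2-)
  by (simp add: quat_comb_apply involution_facts[OF assms(1)] ji smult_l_minus smult_r_minus)

end

text \<open>These hypotheses force \<open>1, i, j, i j\<close> to be linearly independent.\<close>

locale quat_units = quat_relations +
  assumes a_nonzero: "a \<noteq> \<zero>" and b_nonzero: "b \<noteq> \<zero>" and two_nonzero: "\<one> \<oplus> \<one> \<noteq> \<zero>"
    and nontrivial: "\<one>\<^bsub>A\<^esub> \<noteq> \<zero>\<^bsub>A\<^esub>"

lemma (in assoc_algebra) smult_eq_zero:
  assumes "c \<in> carrier F" "x \<in> carrier A" "c \<odot>\<^bsub>A\<^esub> x = \<zero>\<^bsub>A\<^esub>" "c \<noteq> \<zero>"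
  shows "x = \<zero>\<^bsub>A\<^esub>"
proof -
  have c: "c \<in> Units F" using assms field_Units by auto
  have "x = (inv c \<otimes> c) \<odot>\<^bsub>A\<^esub> x" using F.Units_l_inv[OF c] smult_one[OF assms(2)] by simp
  also have "... = inv c \<odot>\<^bsub>A\<^esub> (c \<odot>\<^bsub>A\<^esub> x)" using assms(1,2) c by (intro smult_assoc1) auto
  also have "... = \<zero>\<^bsub>A\<^esub>" using c by (simp add: assms(3))
  finally show ?thesis .
qed

context quat_units
begin

lemma double_zero: "x \<in> carrier A \<Longrightarrow> x \<oplus>\<^bsub>A\<^esub> x = \<zero>\<^bsub>A\<^esub> \<Longrightarrow> x = \<zero>\<^bsub>A\<^esub>"
  using smult_eq_zero[of "\<one> \<oplus> \<one>" x] two_nonzero by (simp add: smult_l_distr)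

lemma i_cancel:
  assumes "x \<in> carrier A" "x \<otimes>\<^bsub>A\<^esub> i = \<zero>\<^bsub>A\<^esub>"
  shows "x = \<zero>\<^bsub>A\<^esub>"
proof -
  have "a \<odot>\<^bsub>A\<^esub> x = x \<otimes>\<^bsub>A\<^esub> i \<otimes>\<^bsub>A\<^esub> i"
    using assms(1) by (simp add: A.m_assoc ii smult_mult_right)
  also have "... = \<zero>\<^bsub>A\<^esub>" by (simp add: assms(2))
  finally show ?thesis using smult_eq_zero[of a x] assms(1) a_nonzero by simp
qed

lemma j_cancel:
  assumes "x \<in> carrier A" "x \<otimes>\<^bsub>A\<^esub> j = \<zero>\<^bsub>A\<^esub>"
  shows "x = \<zero>\<^bsub>A\<^esub>"
proof -
  have "b \<odot>\<^bsub>A\<^esub> x = x \<otimes>\<^bsub>A\<^esub> j \<otimes>\<^bsub>A\<^esub> j"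
    using assms(1) by (simp add: A.m_assoc jj smult_mult_right)
  also have "... = \<zero>\<^bsub>A\<^esub>" by (simp add: assms(2))
  finally show ?thesis using smult_eq_zero[of b x] assms(1) b_nonzero by simp
qed

text \<open>Moving \<open>j\<close> past \<open>t + x i\<close> changes the sign of \<open>x i\<close>. Both \<open>t + x i\<close> and \<open>t - x i\<close> therefore vanish.\<close>

lemma comb_i_zero:
  assumes "t \<in> carrier F" "x \<in> carrier F" "t \<odot>\<^bsub>A\<^esub> \<one>\<^bsub>A\<^esub> \<oplus>\<^bsub>A\<^esub> x \<odot>\<^bsub>A\<^esub> i = \<zero>\<^bsub>A\<^esub>"
  shows "t = \<zero> \<and> x = \<zero>"
proof -
  let ?u = "t \<odot>\<^bsub>A\<^esub> \<one>\<^bsub>A\<^esub>" and ?v = "x \<odot>\<^bsub>A\<^esub> i"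
  have c: "?u \<in> carrier A" "?v \<in> carrier A" using assms by auto
  have "\<zero>\<^bsub>A\<^esub> = j \<otimes>\<^bsub>A\<^esub> (?u \<oplus>\<^bsub>A\<^esub> ?v)" using assms by simp
  also have "... = (?u \<oplus>\<^bsub>A\<^esub> \<ominus>\<^bsub>A\<^esub> ?v) \<otimes>\<^bsub>A\<^esub> j"
    using assms(1,2) by (simp add: A.r_distr A.l_distr smult_mult_left smult_mult_right ji A.l_minus smult_r_minus)
  finally have "?u \<oplus>\<^bsub>A\<^esub> \<ominus>\<^bsub>A\<^esub> ?v = \<zero>\<^bsub>A\<^esub>" using j_cancel[of "?u \<oplus>\<^bsub>A\<^esub> \<ominus>\<^bsub>A\<^esub> ?v"] c by simp
  hence "?u = ?v" using c A.r_right_minus_eq[of ?u ?v] by (simp add: M.minus_eq)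
  hence "?v \<oplus>\<^bsub>A\<^esub> ?v = \<zero>\<^bsub>A\<^esub>" using assms by simp
  hence v: "?v = \<zero>\<^bsub>A\<^esub>" using double_zero c by blast
  hence "?u = \<zero>\<^bsub>A\<^esub>" using \<open>?u = ?v\<close> by simp
  moreover have "i \<noteq> \<zero>\<^bsub>A\<^esub>"
    using i_cancel[of "\<one>\<^bsub>A\<^esub>"] nontrivial by auto
  ultimately show ?thesis using v smult_eq_zero assms nontrivial by (meson A.one_closed i_closed)
qed

text \<open>Write the combination as \<open>u + w j\<close> with \<open>u\<close> and \<open>w\<close> in the span of \<open>1, i\<close>. Since \<open>i\<close> commutes with \<open>u\<close> and
  \<open>w\<close> but anticommutes with \<open>j\<close>, both \<open>u + w j\<close> and \<open>u - w j\<close> vanish.\<close>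

lemma quat_comb_zero:
  assumes c: "t \<in> carrier F" "x \<in> carrier F" "y \<in> carrier F" "z \<in> carrier F"
    and 0: "quat_comb A i j (t, x, y, z) = \<zero>\<^bsub>A\<^esub>"
  shows "t = \<zero> \<and> x = \<zero> \<and> y = \<zero> \<and> z = \<zero>"
proof -
  define u where "u = t \<odot>\<^bsub>A\<^esub> \<one>\<^bsub>A\<^esub> \<oplus>\<^bsub>A\<^esub> x \<odot>\<^bsub>A\<^esub> i"
  define w where "w = y \<odot>\<^bsub>A\<^esub> \<one>\<^bsub>A\<^esub> \<oplus>\<^bsub>A\<^esub> z \<odot>\<^bsub>A\<^esub> i"
  have uw: "u \<in> carrier A" "w \<in> carrier A" using c by (auto simp: u_def w_def)
  have q: "u \<oplus>\<^bsub>A\<^esub> w \<otimes>\<^bsub>A\<^esub> j = \<zero>\<^bsub>A\<^esub>"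
    using 0 c by (simp add: u_def w_def quat_comb_apply A.l_distr smult_mult_left M.a_ac)
  have iu: "i \<otimes>\<^bsub>A\<^esub> u = u \<otimes>\<^bsub>A\<^esub> i" and iw: "i \<otimes>\<^bsub>A\<^esub> w = w \<otimes>\<^bsub>A\<^esub> i"
    using c by (simp_all add: u_def w_def A.l_distr A.r_distr smult_mult_left smult_mult_right)
  have "\<zero>\<^bsub>A\<^esub> = i \<otimes>\<^bsub>A\<^esub> (u \<oplus>\<^bsub>A\<^esub> w \<otimes>\<^bsub>A\<^esub> j)" using q by simp
  also have "... = u \<otimes>\<^bsub>A\<^esub> i \<oplus>\<^bsub>A\<^esub> w \<otimes>\<^bsub>A\<^esub> (i \<otimes>\<^bsub>A\<^esub> j)"
    using uw by (simp add: A.r_distr iu A.m_assoc[symmetric] iw)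
  also have "... = (u \<oplus>\<^bsub>A\<^esub> \<ominus>\<^bsub>A\<^esub> (w \<otimes>\<^bsub>A\<^esub> j)) \<otimes>\<^bsub>A\<^esub> i"
    using uw by (simp add: A.l_distr A.l_minus A.m_assoc ji A.r_minus)
  finally have "u \<oplus>\<^bsub>A\<^esub> \<ominus>\<^bsub>A\<^esub> (w \<otimes>\<^bsub>A\<^esub> j) = \<zero>\<^bsub>A\<^esub>" using i_cancel[of "u \<oplus>\<^bsub>A\<^esub> \<ominus>\<^bsub>A\<^esub> (w \<otimes>\<^bsub>A\<^esub> j)"] uw by simp
  hence e: "u = w \<otimes>\<^bsub>A\<^esub> j" using uw A.r_right_minus_eq[of u "w \<otimes>\<^bsub>A\<^esub> j"] by (simp add: M.minus_eq)
  hence "u \<oplus>\<^bsub>A\<^esub> u = \<zero>\<^bsub>A\<^esub>" using q by simp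
  hence "u = \<zero>\<^bsub>A\<^esub>" using double_zero uw by blast
  moreover have "w = \<zero>\<^bsub>A\<^esub>" using j_cancel[of w] uw(2) e[symmetric] calculation by simp
  ultimately show ?thesis using comb_i_zero[of t x] comb_i_zero[of y z] c by (simp add: u_def w_def)
qed

lemma quat_comb_inj: "inj_on (quat_comb A i j) coords"
proof (rule inj_onI, clarsimp)
  fix t x y z t' x' y' z'
  assume c: "t \<in> carrier F" "x \<in> carrier F" "y \<in> carrier F" "z \<in> carrier F"
    "t' \<in> carrier F" "x' \<in> carrier F" "y' \<in> carrier F" "z' \<in> carrier F"
    and e: "quat_comb A i j (t, x, y, z) = quat_comb A i j (t', x', y', z')"
  have "quat_comb A i j (t \<ominus> t', x \<ominus> x', y \<ominus> y', z \<ominus> z') =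
      quat_comb A i j (t, x, y, z) \<oplus>\<^bsub>A\<^esub> (\<ominus> \<one>) \<odot>\<^bsub>A\<^esub> quat_comb A i j (t', x', y', z')"
    using c by (simp add: quat_comb_add quat_comb_smult F.minus_eq F.l_minus)
  also have "... = \<zero>\<^bsub>A\<^esub>" using c e by (simp add: smult_l_minus M.r_neg)
  finally have "t \<ominus> t' = \<zero> \<and> x \<ominus> x' = \<zero> \<and> y \<ominus> y' = \<zero> \<and> z \<ominus> z' = \<zero>"
    using c by (intro quat_comb_zero) auto
  thus "t = t' \<and> x = x' \<and> y = y' \<and> z = z'" using c by simp
qed

end

section \<open>Change of standard generators\<close>

lemma (in assoc_algebra) quat_gensE:
  assumes "quat_gens F A i j" "\<one> \<oplus> \<one> \<noteq> \<zero>"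
  obtains a b where "quat_units F A i j a b"
proof -
  let ?coords = "carrier F \<times> carrier F \<times> carrier F \<times> carrier F"
  obtain a b where ab: "a \<in> carrier F" "a \<noteq> \<zero>" "i \<otimes>\<^bsub>A\<^esub> i = a \<odot>\<^bsub>A\<^esub> \<one>\<^bsub>A\<^esub>"
      "b \<in> carrier F" "b \<noteq> \<zero>" "j \<otimes>\<^bsub>A\<^esub> j = b \<odot>\<^bsub>A\<^esub> \<one>\<^bsub>A\<^esub>"
    and ij: "i \<in> carrier A" "j \<in> carrier A" "j \<otimes>\<^bsub>A\<^esub> i = \<ominus>\<^bsub>A\<^esub> (i \<otimes>\<^bsub>A\<^esub> j)"
    and bij: "inj_on (quat_comb A i j) ?coords"
    using assms(1) by (auto simp: quat_gens_def bij_betw_def)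
  have rel: "quat_relations F A i j a b"
    using ab ij by unfold_locales auto
  have "\<one>\<^bsub>A\<^esub> \<noteq> \<zero>\<^bsub>A\<^esub>"
  proof
    assume "\<one>\<^bsub>A\<^esub> = \<zero>\<^bsub>A\<^esub>"
    hence "quat_comb A i j (\<one>, \<zero>, \<zero>, \<zero>) = quat_comb A i j (\<zero>, \<zero>, \<zero>, \<zero>)"
      by (simp add: quat_comb_def)
    hence "\<one> = \<zero>" using inj_onD[OF bij, of "(\<one>, \<zero>, \<zero>, \<zero>)" "(\<zero>, \<zero>, \<zero>, \<zero>)"] by simp
    thus False by simp
  qed
  hence "quat_units F A i j a b"
    using ab assms(2) by (intro quat_units.intro[OF rel] quat_units_axioms.intro) auto
  thus ?thesis using that by blast
qed

context assoc_algebra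
begin

definition scalars where "scalars = (\<lambda>c. c \<odot>\<^bsub>A\<^esub> \<one>\<^bsub>A\<^esub>) ` carrier F"

lemma scalar_hom: "(\<lambda>c. c \<odot>\<^bsub>A\<^esub> \<one>\<^bsub>A\<^esub>) \<in> ring_hom F A"
  by (rule ring_hom_memI) (auto simp: smult_l_distr smult_mult_left smult_assoc1)

lemma scalars_subfield: "\<one>\<^bsub>A\<^esub> \<noteq> \<zero>\<^bsub>A\<^esub> \<Longrightarrow> subfield scalars A"
  unfolding scalars_def
  using ring_hom_ring.img_is_subfield(2)[of F A "\<lambda>c. c \<odot>\<^bsub>A\<^esub> \<one>\<^bsub>A\<^esub>" "carrier F"]
    ring_hom_ringI2[OF F.ring_axioms A.ring_axioms scalar_hom] F.carrier_is_subfield by auto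

end

context quat_units
begin

text \<open>The dimension theory of rings over a subfield of the same ring becomes available for \<open>A\<close>
  by regarding \<open>F\<close> as the subfield of scalar multiples of the unit.\<close>

lemma Span_basis:
  "A.Span scalars [\<one>\<^bsub>A\<^esub>, i, j, i \<otimes>\<^bsub>A\<^esub> j] = quat_comb A i j ` coords"
proof -
  have "A.Span scalars [\<one>\<^bsub>A\<^esub>, i, j, i \<otimes>\<^bsub>A\<^esub> j] =
      {A.combine Ks [\<one>\<^bsub>A\<^esub>, i, j, i \<otimes>\<^bsub>A\<^esub> j] | Ks. length Ks = 4 \<and> set Ks \<subseteq> scalars}"
    using A.Span_eq_combine_set_length_version[OF scalars_subfield[OF nontrivial], of "[\<one>\<^bsub>A\<^esub>, i, j, i \<otimes>\<^bsub>A\<^esub> j]"]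
    by (simp add: numeral_eq_Suc del: A.Span.simps)
  also have "... = quat_comb A i j ` coords"
  proof (intro equalityI subsetI)
    fix h assume "h \<in> {A.combine Ks [\<one>\<^bsub>A\<^esub>, i, j, i \<otimes>\<^bsub>A\<^esub> j] | Ks. length Ks = 4 \<and> set Ks \<subseteq> scalars}"
    then obtain Ks where Ks: "h = A.combine Ks [\<one>\<^bsub>A\<^esub>, i, j, i \<otimes>\<^bsub>A\<^esub> j]" "length Ks = 4" "set Ks \<subseteq> scalars"
      by blast
    then obtain k0 k1 k2 k3 where "Ks = [k0, k1, k2, k3]"
      by (auto simp: numeral_eq_Suc length_Suc_conv)
    then obtain t x y z where "Ks = [t \<odot>\<^bsub>A\<^esub> \<one>\<^bsub>A\<^esub>, x \<odot>\<^bsub>A\<^esub> \<one>\<^bsub>A\<^esub>, y \<odot>\<^bsub>A\<^esub> \<one>\<^bsub>A\<^esub>, z \<odot>\<^bsub>A\<^esub> \<one>\<^bsub>A\<^esub>]"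
      "t \<in> carrier F" "x \<in> carrier F" "y \<in> carrier F" "z \<in> carrier F"
      using Ks(3) by (auto simp: scalars_def)
    thus "h \<in> quat_comb A i j ` coords"
      unfolding Ks(1) by (intro image_eqI[of _ _ "(t, x, y, z)"])
        (auto simp: quat_comb_apply smult_mult_left M.a_ac)
  next
    fix h assume "h \<in> quat_comb A i j ` coords"
    then obtain t x y z where h: "h = quat_comb A i j (t, x, y, z)"
      "t \<in> carrier F" "x \<in> carrier F" "y \<in> carrier F" "z \<in> carrier F" by auto
    show "h \<in> {A.combine Ks [\<one>\<^bsub>A\<^esub>, i, j, i \<otimes>\<^bsub>A\<^esub> j] | Ks. length Ks = 4 \<and> set Ks \<subseteq> scalars}"
      by (intro CollectI exI[of _ "[t \<odot>\<^bsub>A\<^esub> \<one>\<^bsub>A\<^esub>, x \<odot>\<^bsub>A\<^esub> \<one>\<^bsub>A\<^esub>, y \<odot>\<^bsub>A\<^esub> \<one>\<^bsub>A\<^esub>, z \<odot>\<^bsub>A\<^esub> \<one>\<^bsub>A\<^esub>]"])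
        (use h in \<open>auto simp: quat_comb_apply smult_mult_left scalars_def M.a_ac\<close>)
  qed
  finally show ?thesis .
qed

lemma independent_basis: "A.independent scalars [\<one>\<^bsub>A\<^esub>, i, j, i \<otimes>\<^bsub>A\<^esub> j]"
proof (rule A.trivial_combine_imp_independent[OF scalars_subfield[OF nontrivial]])
  fix Ks assume Ks: "set Ks \<subseteq> scalars" "A.combine Ks [\<one>\<^bsub>A\<^esub>, i, j, i \<otimes>\<^bsub>A\<^esub> j] = \<zero>\<^bsub>A\<^esub>"
  obtain Ks' where Ks': "set (take 4 Ks) \<subseteq> set Ks'" "set Ks' \<subseteq> set (take 4 Ks) \<union> {\<zero>\<^bsub>A\<^esub>}"
    "length Ks' = 4" "A.combine Ks' [\<one>\<^bsub>A\<^esub>, i, j, i \<otimes>\<^bsub>A\<^esub> j] = \<zero>\<^bsub>A\<^esub>"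
    using A.combine_normalize[of Ks "[\<one>\<^bsub>A\<^esub>, i, j, i \<otimes>\<^bsub>A\<^esub> j]" "\<zero>\<^bsub>A\<^esub>"] Ks
      subfieldE(3)[OF scalars_subfield[OF nontrivial]] by (auto simp: numeral_eq_Suc)
  have "\<zero>\<^bsub>A\<^esub> \<in> scalars" by (auto simp: scalars_def intro!: image_eqI[of _ _ \<zero>])
  hence "set Ks' \<subseteq> scalars" using Ks'(2) Ks(1) set_take_subset[of 4 Ks] by blast
  moreover obtain k0 k1 k2 k3 where "Ks' = [k0, k1, k2, k3]"
    using Ks'(3) by (auto simp: numeral_eq_Suc length_Suc_conv)
  ultimately obtain t x y z where K: "Ks' = [t \<odot>\<^bsub>A\<^esub> \<one>\<^bsub>A\<^esub>, x \<odot>\<^bsub>A\<^esub> \<one>\<^bsub>A\<^esub>, y \<odot>\<^bsub>A\<^esub> \<one>\<^bsub>A\<^esub>, z \<odot>\<^bsub>A\<^esub> \<one>\<^bsub>A\<^esub>]"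
      "t \<in> carrier F" "x \<in> carrier F" "y \<in> carrier F" "z \<in> carrier F"
    by (auto simp: scalars_def)
  have "quat_comb A i j (t, x, y, z) = \<zero>\<^bsub>A\<^esub>"
    using Ks'(4) K by (simp add: quat_comb_apply smult_mult_left M.a_ac)
  hence "t = \<zero> \<and> x = \<zero> \<and> y = \<zero> \<and> z = \<zero>" using K by (intro quat_comb_zero) auto
  hence "set Ks' \<subseteq> {\<zero>\<^bsub>A\<^esub>}" using K by simp
  thus "set (take (length [\<one>\<^bsub>A\<^esub>, i, j, i \<otimes>\<^bsub>A\<^esub> j]) Ks) \<subseteq> {\<zero>\<^bsub>A\<^esub>}" using Ks'(1) by (simp add: numeral_eq_Suc)
qed simp

text \<open>The new quadruple \<open>1, x, y, x y\<close> is independent by its relations alone. It has four members, as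
  has the old basis, so it spans as well.\<close>

lemma other_generators:
  assumes "bij_betw (quat_comb A i j) coords (carrier A)" and other: "quat_units F A x y c d"
  shows "bij_betw (quat_comb A x y) coords (carrier A)" "quat_gens F A x y"
proof -
  interpret O: quat_units F A x y c d by (rule other)
  note K = scalars_subfield[OF nontrivial]
  have "A.Span scalars [\<one>\<^bsub>A\<^esub>, i, j, i \<otimes>\<^bsub>A\<^esub> j] = carrier A"
    using Span_basis assms(1) by (simp add: bij_betw_def)
  hence "A.dimension 4 scalars (carrier A)"
    using A.dimensionI[OF K independent_basis] by (simp add: numeral_eq_Suc del: A.Span.simps)
  hence "A.Span scalars [\<one>\<^bsub>A\<^esub>, x, y, x \<otimes>\<^bsub>A\<^esub> y] = carrier A"
    using A.independent_length_eq_dimension[OF K _ O.independent_basis, of 4 "carrier A"]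
    by (simp add: numeral_eq_Suc del: A.Span.simps)
  thus 1: "bij_betw (quat_comb A x y) coords (carrier A)"
    using O.Span_basis O.quat_comb_inj by (simp add: bij_betw_def)
  show "quat_gens F A x y"
    unfolding quat_gens_def using 1 O.ii O.jj O.ji O.a_nonzero O.b_nonzero by auto
qed

end

section \<open>Homomorphisms out of a quaternion algebra\<close>

locale quaternion = quat_units +
  assumes basis: "bij_betw (quat_comb A i j) coords (carrier A)"
begin

lemma quat_comb_cases:
  assumes "h \<in> carrier A"
  obtains t x y z where "t \<in> carrier F" "x \<in> carrier F" "y \<in> carrier F" "z \<in> carrier F"
    "h = quat_comb A i j (t, x, y, z)"
proof -
  have "h \<in> quat_comb A i j ` coords" using assms bij_betw_imp_surj_on[OF basis] by (simp only:)
  then obtain v where v: "v \<in> coords" "h = quat_comb A i j v" by (rule imageE)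
  obtain t x y z where "v = (t, x, y, z)" by (rule prod_cases4)
  show ?thesis by (rule that[of t x y z]) (use v \<open>v = (t, x, y, z)\<close> in auto)
qed

text \<open>Coordinates with respect to \<open>i, j\<close> are read as coordinates with respect to \<open>x, y\<close>. Products
  agree because the multiplication table depends only on \<open>a\<close> and \<open>b\<close>, and the involutions agree because
  both negate exactly the fourth coordinate.\<close>

lemma presentation_hom:
  assumes s: "alg_involution F A s" "s i = i" "s j = j"
    and Q: "quat_relations F B x y a b" and s': "alg_involution F B s'" "s' x = x" "s' y = y"
  shows "\<exists>f. inv_alg_hom F A s B s' f \<and> (\<forall>v\<in>coords. f (quat_comb A i j v) = quat_comb B x y v)"
proof -
  interpret B: quat_relations F B x y a b by (rule Q)
  define f where "f = quat_comb B x y \<circ> inv_into coords (quat_comb A i j)"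
  have f: "f (quat_comb A i j v) = quat_comb B x y v" if "v \<in> coords" for v
    using that quat_comb_inj by (simp add: f_def)
  have f': "f (quat_comb A i j (t, u, v, w)) = quat_comb B x y (t, u, v, w)"
    if "t \<in> carrier F" "u \<in> carrier F" "v \<in> carrier F" "w \<in> carrier F" for t u v w
    using that f by simp
  have "f \<in> ring_hom A B"
  proof (rule ring_hom_memI)
    fix g h assume g: "g \<in> carrier A" and h: "h \<in> carrier A"
    obtain t u v w where g': "t \<in> carrier F" "u \<in> carrier F" "v \<in> carrier F" "w \<in> carrier F"
      "g = quat_comb A i j (t, u, v, w)" using g by (rule quat_comb_cases)
    obtain t' u' v' w' where h': "t' \<in> carrier F" "u' \<in> carrier F" "v' \<in> carrier F" "w' \<in> carrier F"
      "h = quat_comb A i j (t', u', v', w')" using h by (rule quat_comb_cases)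
    have "quat_mult F a b (t, u, v, w) (t', u', v', w') \<in> coords"
      using g' h' by (simp add: quat_mult_def)
    thus "f (g \<otimes>\<^bsub>A\<^esub> h) = f g \<otimes>\<^bsub>B\<^esub> f h"
      using g' h' by (simp add: quat_comb_mult B.quat_comb_mult f f')
    show "f (g \<oplus>\<^bsub>A\<^esub> h) = f g \<oplus>\<^bsub>B\<^esub> f h"
      using g' h' by (simp add: quat_comb_add B.quat_comb_add f')
  next
    fix g assume "g \<in> carrier A"
    then obtain t u v w where g': "t \<in> carrier F" "u \<in> carrier F" "v \<in> carrier F" "w \<in> carrier F"
      "g = quat_comb A i j (t, u, v, w)" by (rule quat_comb_cases)
    thus "f g \<in> carrier B" by (simp add: f')
  next
    have "\<one>\<^bsub>A\<^esub> = quat_comb A i j (\<one>, \<zero>, \<zero>, \<zero>)" by (simp add: quat_comb_apply)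
    thus "f \<one>\<^bsub>A\<^esub> = \<one>\<^bsub>B\<^esub>" by (simp add: f' B.quat_comb_apply)
  qed
  moreover have "f (c \<odot>\<^bsub>A\<^esub> h) = c \<odot>\<^bsub>B\<^esub> f h" if "c \<in> carrier F" "h \<in> carrier A" for c h
  proof -
    from that(2) obtain t u v w where "t \<in> carrier F" "u \<in> carrier F" "v \<in> carrier F" "w \<in> carrier F"
      "h = quat_comb A i j (t, u, v, w)" by (rule quat_comb_cases)
    thus ?thesis using that(1) by (simp add: quat_comb_smult B.quat_comb_smult f')
  qed
  moreover have "f (s h) = s' (f h)" if "h \<in> carrier A" for h
  proof -
    from that obtain t u v w where "t \<in> carrier F" "u \<in> carrier F" "v \<in> carrier F" "w \<in> carrier F"
      "h = quat_comb A i j (t, u, v, w)" by (rule quat_comb_cases)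
    thus ?thesis using involution_quat_comb[OF s] B.involution_quat_comb[OF s'] by (simp add: f')
  qed
  ultimately have "inv_alg_hom F A s B s' f" by (simp add: inv_alg_hom_def alg_hom_def)
  thus ?thesis by (intro exI[of _ f] conjI ballI f)
qed

lemma presentation_embedding:
  assumes s: "alg_involution F A s" "s i = i" "s j = j"
    and Q: "quat_units F B x y a b" and s': "alg_involution F B s'" "s' x = x" "s' y = y"
  shows "\<exists>f. inv_alg_embedding F A s B s' f"
proof -
  interpret B: quat_units F B x y a b by (rule Q)
  obtain f where f: "inv_alg_hom F A s B s' f"
    "\<forall>v\<in>coords. f (quat_comb A i j v) = quat_comb B x y v"
    using presentation_hom[OF s B.quat_relations_axioms s'] by (elim exE conjE) (rule that)
  have "inj_on (f \<circ> quat_comb A i j) coords"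
    using B.quat_comb_inj bspec[OF f(2)] by (subst inj_on_cong[of _ _ "quat_comb B x y"]) (simp_all only: comp_apply)
  hence "inj_on f (quat_comb A i j ` coords)" by (rule inj_on_imageI)
  hence "inj_on f (carrier A)" by (simp only: bij_betw_imp_surj_on[OF basis])
  thus ?thesis unfolding inv_alg_embedding_def using f(1) by (intro exI[of _ f] conjI)
qed

lemma presentation_iso:
  assumes s: "alg_involution F A s" "s i = i" "s j = j"
    and Q: "quaternion F B x y a b" and s': "alg_involution F B s'" "s' x = x" "s' y = y"
  shows "\<exists>f. inv_alg_iso F A s B s' f"
proof -
  interpret B: quaternion F B x y a b by (rule Q)
  obtain f where f: "inv_alg_hom F A s B s' f"
    "\<forall>v\<in>coords. f (quat_comb A i j v) = quat_comb B x y v"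
    using presentation_hom[OF s B.quat_relations_axioms s'] by (elim exE conjE) (rule that)
  have "bij_betw (f \<circ> quat_comb A i j) coords (carrier B)"
    using B.basis bspec[OF f(2)] by (subst bij_betw_cong[of _ _ "quat_comb B x y"]) (simp_all only: comp_apply)
  hence "bij_betw f (carrier A) (carrier B)"
    using bij_betw_comp_iff[OF basis, of f "carrier B"] by simp
  thus ?thesis unfolding inv_alg_iso_def using f(1) by (intro exI[of _ f] conjI)
qed

end

lemma ring_cong:
  assumes "ring R" "carrier S = carrier R" "monoid.mult S = monoid.mult R" "one S = one R"
    "ring.zero S = ring.zero R" "ring.add S = ring.add R"
  shows "ring S"
proof -
  interpret R: ring R by fact
  show ?thesis
  proof (rule ringI)
    show "abelian_group S"
    proof (rule abelian_groupI)
      fix x assume "x \<in> carrier S"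
      thus "\<exists>y\<in>carrier S. y \<oplus>\<^bsub>S\<^esub> x = \<zero>\<^bsub>S\<^esub>"
        by (intro bexI[of _ "\<ominus>\<^bsub>R\<^esub> x"]) (simp_all add: assms(2-) R.l_neg)
    qed (simp_all add: assms(2-) R.a_ac)
    show "monoid S" by (rule monoidI) (simp_all add: assms(2-) R.m_assoc)
  qed (simp_all add: assms(2-) R.l_distr R.r_distr)
qed

lemma assoc_algebra_restrict_scalars:
  assumes "assoc_algebra F' H" "field F" and \<phi>: "\<phi> \<in> ring_hom F F'"
  shows "assoc_algebra F (restrict_scalars \<phi> H)"
proof -
  interpret H: assoc_algebra F' H by fact
  interpret F: field F by fact
  interpret \<phi>: ring_hom_ring F F' \<phi>
    using ring_hom_ringI2[OF F.ring_axioms H.F.ring_axioms \<phi>] .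
  let ?B = "restrict_scalars \<phi> H"
  have R: "ring ?B"
    by (rule ring_cong[OF H.A.ring_axioms]) (simp_all add: restrict_scalars_def)
  show ?thesis
  proof (intro assoc_algebra.intro module.intro)
    show "assoc_algebra_axioms F ?B"
      by unfold_locales (auto simp: restrict_scalars_def H.smult_mult_left H.smult_mult_right)
    show "module_axioms F ?B"
      by unfold_locales (auto simp: restrict_scalars_def H.smult_l_distr H.smult_r_distr H.smult_assoc1)
  qed (use R in \<open>auto simp: ring_def F.field_axioms F.is_cring\<close>)
qed

lemma alg_involution_restrict_scalars:
  assumes "alg_involution F' H s" "\<phi> \<in> ring_hom F F'"
  shows "alg_involution F (restrict_scalars \<phi> H) s"
  using assms ring_hom_closed[OF assms(2)] by (auto simp: alg_involution_def restrict_scalars_def)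

section \<open>Symmetric generators for an orthogonal involution\<close>

context assoc_algebra
begin

text \<open>The symmetric bilinear form whose associated quadratic form is twice the square. On pure
  quaternions its values are scalars; two elements are orthogonal for it if they anticommute.\<close>

definition polar where "polar v w = v \<otimes>\<^bsub>A\<^esub> w \<oplus>\<^bsub>A\<^esub> w \<otimes>\<^bsub>A\<^esub> v"

lemma polar_closed [simp]: "v \<in> carrier A \<Longrightarrow> w \<in> carrier A \<Longrightarrow> polar v w \<in> carrier A"
  by (simp add: polar_def)

lemma polar_commute: "v \<in> carrier A \<Longrightarrow> w \<in> carrier A \<Longrightarrow> polar v w = polar w v"
  by (simp add: polar_def M.a_comm)

lemma polar_add:
  "\<lbrakk>u \<in> carrier A; v \<in> carrier A; w \<in> carrier A\<rbrakk> \<Longrightarrow> polar u (v \<oplus>\<^bsub>A\<^esub> w) = polar u v \<oplus>\<^bsub>A\<^esub> polar u w"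
  by (simp add: polar_def A.l_distr A.r_distr M.a_ac)

lemma polar_smult:
  "\<lbrakk>c \<in> carrier F; v \<in> carrier A; w \<in> carrier A\<rbrakk> \<Longrightarrow> polar v (c \<odot>\<^bsub>A\<^esub> w) = c \<odot>\<^bsub>A\<^esub> polar v w"
  by (simp add: polar_def smult_mult_left smult_mult_right smult_r_distr)

lemma polar_minus:
  "\<lbrakk>v \<in> carrier A; w \<in> carrier A\<rbrakk> \<Longrightarrow> polar v (\<ominus>\<^bsub>A\<^esub> w) = \<ominus>\<^bsub>A\<^esub> polar v w"
  by (simp add: polar_def A.l_minus A.r_minus M.minus_add)

lemma square_add:
  "\<lbrakk>v \<in> carrier A; w \<in> carrier A\<rbrakk> \<Longrightarrow>
    (v \<oplus>\<^bsub>A\<^esub> w) \<otimes>\<^bsub>A\<^esub> (v \<oplus>\<^bsub>A\<^esub> w) = v \<otimes>\<^bsub>A\<^esub> v \<oplus>\<^bsub>A\<^esub> polar v w \<oplus>\<^bsub>A\<^esub> w \<otimes>\<^bsub>A\<^esub> w"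
  by (simp add: polar_def A.l_distr A.r_distr M.a_ac)

lemma polar_involution:
  assumes "alg_involution F A s" "v \<in> carrier A" "w \<in> carrier A"
  shows "s (polar v w) = polar (s v) (s w)"
  using assms(2,3) involution_facts[OF assms(1)] by (simp add: polar_def M.a_comm)

end

context quaternion
begin

definition pure where
  "pure = {quat_comb A i j (\<zero>, x, y, z) | x y z. x \<in> carrier F \<and> y \<in> carrier F \<and> z \<in> carrier F}"

lemma pureI:
  "\<lbrakk>x \<in> carrier F; y \<in> carrier F; z \<in> carrier F\<rbrakk> \<Longrightarrow> quat_comb A i j (\<zero>, x, y, z) \<in> pure"
  unfolding pure_def by blast

lemma pure_closed: "v \<in> pure \<Longrightarrow> v \<in> carrier A"
  by (auto simp: pure_def)

lemma generators_pure: "i \<in> pure" "j \<in> pure"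
proof -
  have "i = quat_comb A i j (\<zero>, \<one>, \<zero>, \<zero>)" "j = quat_comb A i j (\<zero>, \<zero>, \<one>, \<zero>)"
    by (simp_all add: quat_comb_apply)
  thus "i \<in> pure" "j \<in> pure" unfolding pure_def by blast+
qed

lemma pure_add: "v \<in> pure \<Longrightarrow> w \<in> pure \<Longrightarrow> v \<oplus>\<^bsub>A\<^esub> w \<in> pure"
  unfolding pure_def by clarify (simp add: quat_comb_add, blast intro: F.a_closed)

lemma pure_smult: "c \<in> carrier F \<Longrightarrow> v \<in> pure \<Longrightarrow> c \<odot>\<^bsub>A\<^esub> v \<in> pure"
  unfolding pure_def by clarify (simp add: quat_comb_smult, blast intro: F.m_closed)

lemma pure_minus: "v \<in> pure \<Longrightarrow> \<ominus>\<^bsub>A\<^esub> v \<in> pure"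
  using pure_smult[of "\<ominus> \<one>" v] pure_closed[of v] by (simp add: smult_l_minus)

lemma scalar_plus_pureE:
  assumes "h \<in> carrier A"
  obtains t v where "t \<in> carrier F" "v \<in> pure" "h = t \<odot>\<^bsub>A\<^esub> \<one>\<^bsub>A\<^esub> \<oplus>\<^bsub>A\<^esub> v"
proof -
  obtain t x y z where h: "t \<in> carrier F" "x \<in> carrier F" "y \<in> carrier F" "z \<in> carrier F"
    "h = quat_comb A i j (t, x, y, z)" using assms by (rule quat_comb_cases)
  have "h = t \<odot>\<^bsub>A\<^esub> \<one>\<^bsub>A\<^esub> \<oplus>\<^bsub>A\<^esub> quat_comb A i j (\<zero>, x, y, z)"
    using h by (simp add: quat_comb_apply M.a_assoc)
  thus ?thesis using h(1-4) by (intro that[of t "quat_comb A i j (\<zero>, x, y, z)"]) (auto simp: pure_def)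
qed

lemma pure_scalar: 
  assumes "c \<in> carrier F" "c \<odot>\<^bsub>A\<^esub> \<one>\<^bsub>A\<^esub> \<in> pure"
  shows "c = \<zero>"
proof -
  obtain x y z where "x \<in> carrier F" "y \<in> carrier F" "z \<in> carrier F"
    "c \<odot>\<^bsub>A\<^esub> \<one>\<^bsub>A\<^esub> = quat_comb A i j (\<zero>, x, y, z)" using assms(2) by (auto simp: pure_def)
  moreover have "c \<odot>\<^bsub>A\<^esub> \<one>\<^bsub>A\<^esub> = quat_comb A i j (c, \<zero>, \<zero>, \<zero>)" using assms(1) by (simp add: quat_comb_apply)
  ultimately have "quat_comb A i j (c, \<zero>, \<zero>, \<zero>) = quat_comb A i j (\<zero>, x, y, z)" by simp
  hence "(c, \<zero>, \<zero>, \<zero>) = (\<zero>, x, y, z)"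
    by (rule inj_onD[OF quat_comb_inj]) (use assms(1) \<open>x \<in> carrier F\<close> \<open>y \<in> carrier F\<close> \<open>z \<in> carrier F\<close> in auto)
  thus ?thesis by simp
qed

lemma pure_products:
  assumes "x \<in> carrier F" "y \<in> carrier F" "z \<in> carrier F" "x' \<in> carrier F" "y' \<in> carrier F" "z' \<in> carrier F"
  shows "quat_comb A i j (\<zero>, x, y, z) \<otimes>\<^bsub>A\<^esub> quat_comb A i j (\<zero>, x', y', z') =
    quat_comb A i j (a \<otimes> (x \<otimes> x') \<oplus> b \<otimes> (y \<otimes> y') \<ominus> a \<otimes> b \<otimes> (z \<otimes> z'),
      b \<otimes> (z \<otimes> y') \<ominus> b \<otimes> (y \<otimes> z'), a \<otimes> (x \<otimes> z') \<ominus> a \<otimes> (z \<otimes> x'), x \<otimes> y' \<ominus> y \<otimes> x')"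
  using assms by (simp add: quat_comb_mult quat_mult_def F.minus_eq F.a_comm)

lemma pure_polar_coords:
  assumes c: "x \<in> carrier F" "y \<in> carrier F" "z \<in> carrier F" "x' \<in> carrier F" "y' \<in> carrier F" "z' \<in> carrier F"
  shows "polar (quat_comb A i j (\<zero>, x, y, z)) (quat_comb A i j (\<zero>, x', y', z')) =
    (let m = a \<otimes> (x \<otimes> x') \<oplus> b \<otimes> (y \<otimes> y') \<ominus> a \<otimes> b \<otimes> (z \<otimes> z') in (m \<oplus> m) \<odot>\<^bsub>A\<^esub> \<one>\<^bsub>A\<^esub>)"
proof -
  define m where "m = a \<otimes> (x \<otimes> x') \<oplus> b \<otimes> (y \<otimes> y') \<ominus> a \<otimes> b \<otimes> (z \<otimes> z')"
  have m: "m \<in> carrier F" using c by (simp add: m_def)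
  have cancel: "(p \<ominus> q) \<oplus> (q \<ominus> p) = \<zero>" if "p \<in> carrier F" "q \<in> carrier F" for p q
    using that by (simp add: F.minus_eq F.a_ac F.r_neg F.r_neg1 F.r_neg2)
  have "polar (quat_comb A i j (\<zero>, x, y, z)) (quat_comb A i j (\<zero>, x', y', z')) =
      quat_comb A i j (m \<oplus> m, \<zero>, \<zero>, \<zero>)"
    using c m cancel[of "b \<otimes> (z \<otimes> y')" "b \<otimes> (y \<otimes> z')"] cancel[of "a \<otimes> (x \<otimes> z')" "a \<otimes> (z \<otimes> x')"]
      cancel[of "x \<otimes> y'" "y \<otimes> x'"]
    by (simp add: polar_def pure_products quat_comb_add m_def F.m_comm)
  also have "... = (m \<oplus> m) \<odot>\<^bsub>A\<^esub> \<one>\<^bsub>A\<^esub>" using m by (simp add: quat_comb_apply)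
  finally show ?thesis by (simp add: m_def Let_def)
qed

lemma pure_polar:
  assumes "v \<in> pure" "w \<in> pure"
  shows "\<exists>m\<in>carrier F. polar v w = m \<odot>\<^bsub>A\<^esub> \<one>\<^bsub>A\<^esub>"
proof -
  obtain x y z x' y' z' where c: "x \<in> carrier F" "y \<in> carrier F" "z \<in> carrier F"
    "x' \<in> carrier F" "y' \<in> carrier F" "z' \<in> carrier F"
    and v: "v = quat_comb A i j (\<zero>, x, y, z)" and w: "w = quat_comb A i j (\<zero>, x', y', z')"
    using assms by (auto simp: pure_def)
  let ?m = "a \<otimes> (x \<otimes> x') \<oplus> b \<otimes> (y \<otimes> y') \<ominus> a \<otimes> b \<otimes> (z \<otimes> z')"
  show ?thesis unfolding v w pure_polar_coords[OF c] Let_def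
    by (intro bexI[of _ "?m \<oplus> ?m"]) (use c in auto)
qed

lemma pure_square:
  assumes "v \<in> pure"
  shows "\<exists>c\<in>carrier F. v \<otimes>\<^bsub>A\<^esub> v = c \<odot>\<^bsub>A\<^esub> \<one>\<^bsub>A\<^esub>"
proof -
  obtain x y z where c: "x \<in> carrier F" "y \<in> carrier F" "z \<in> carrier F"
    and v: "v = quat_comb A i j (\<zero>, x, y, z)"
    using assms by (auto simp: pure_def)
  define m where "m = a \<otimes> (x \<otimes> x) \<oplus> b \<otimes> (y \<otimes> y) \<ominus> a \<otimes> b \<otimes> (z \<otimes> z)"
  have m: "m \<in> carrier F" using c by (simp add: m_def)
  have "v \<otimes>\<^bsub>A\<^esub> v = quat_comb A i j (m, \<zero>, \<zero>, \<zero>)"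
    using c by (simp add: v pure_products m_def F.m_comm F.minus_eq F.r_neg)
  thus ?thesis using m by (intro bexI[of _ m]) (auto simp: quat_comb_apply)
qed

lemma double_zero_scalar: "c \<in> carrier F \<Longrightarrow> c \<oplus> c = \<zero> \<Longrightarrow> c = \<zero>"
proof -
  assume c: "c \<in> carrier F" "c \<oplus> c = \<zero>"
  have "(\<one> \<oplus> \<one>) \<otimes> c = \<zero>" using c by (simp add: F.l_distr)
  thus "c = \<zero>" using c(1) two_nonzero F.integral by auto
qed

text \<open>In the coordinates of \<open>i, j, i j\<close> the polar form is diagonal with the nonzero entries \<open>2 a\<close>,
  \<open>2 b\<close> and \<open>- 2 a b\<close>.\<close>

lemma pure_nondegenerate:
  assumes "v \<in> pure" "v \<noteq> \<zero>\<^bsub>A\<^esub>"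
  shows "\<exists>w\<in>pure. polar v w \<noteq> \<zero>\<^bsub>A\<^esub>"
proof (rule ccontr)
  assume "\<not> (\<exists>w\<in>pure. polar v w \<noteq> \<zero>\<^bsub>A\<^esub>)"
  hence 0: "polar v w = \<zero>\<^bsub>A\<^esub>" if "w \<in> pure" for w using that by blast
  obtain x y z where c: "x \<in> carrier F" "y \<in> carrier F" "z \<in> carrier F"
    and v: "v = quat_comb A i j (\<zero>, x, y, z)"
    using assms by (auto simp: pure_def)
  have *: "a \<otimes> (x \<otimes> x') \<oplus> b \<otimes> (y \<otimes> y') \<ominus> a \<otimes> b \<otimes> (z \<otimes> z') = \<zero>"
    if c': "x' \<in> carrier F" "y' \<in> carrier F" "z' \<in> carrier F" for x' y' z'
  proof -
    define m where "m = a \<otimes> (x \<otimes> x') \<oplus> b \<otimes> (y \<otimes> y') \<ominus> a \<otimes> b \<otimes> (z \<otimes> z')"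
    have m: "m \<in> carrier F" using c c' by (simp add: m_def)
    have "quat_comb A i j (\<zero>, x', y', z') \<in> pure" using c' by (rule pureI)
    hence "(m \<oplus> m) \<odot>\<^bsub>A\<^esub> \<one>\<^bsub>A\<^esub> = \<zero>\<^bsub>A\<^esub>"
      using 0 pure_polar_coords[OF c c'] by (simp add: v m_def Let_def)
    hence "m \<oplus> m = \<zero>" using smult_eq_zero[of "m \<oplus> m" "\<one>\<^bsub>A\<^esub>"] m nontrivial by auto
    thus ?thesis using double_zero_scalar[OF m] by (simp only: m_def)
  qed
  have "a \<otimes> x = \<zero>" "b \<otimes> y = \<zero>" "a \<otimes> b \<otimes> z = \<zero>"
    using *[of \<one> \<zero> \<zero>] *[of \<zero> \<one> \<zero>] *[of \<zero> \<zero> \<one>] c by (simp_all add: F.minus_eq)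
  hence "x = \<zero>" "y = \<zero>" "z = \<zero>"
    using F.integral[OF _ a_closed c(1)] F.integral[OF _ b_closed c(2)] F.integral[OF _ _ c(3), of "a \<otimes> b"]
      F.integral[OF _ a_closed b_closed] a_nonzero b_nonzero by auto
  thus False using assms(2) v by (simp add: quat_comb_apply)
qed

text \<open>If \<open>u\<close> and \<open>w\<close> both have square zero then the square of their sum is their polar form.\<close>

lemma anisotropic_sum:
  assumes "u \<in> carrier A" "w \<in> carrier A" "polar u w \<noteq> \<zero>\<^bsub>A\<^esub>"
  shows "\<exists>v\<in>{u, w, u \<oplus>\<^bsub>A\<^esub> w}. v \<otimes>\<^bsub>A\<^esub> v \<noteq> \<zero>\<^bsub>A\<^esub>"
  using square_add[of u w] assms by (cases "u \<otimes>\<^bsub>A\<^esub> u = \<zero>\<^bsub>A\<^esub>"; cases "w \<otimes>\<^bsub>A\<^esub> w = \<zero>\<^bsub>A\<^esub>") auto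

lemma square_nonzeroE:
  assumes "v \<in> pure" "v \<otimes>\<^bsub>A\<^esub> v \<noteq> \<zero>\<^bsub>A\<^esub>"
  obtains c where "c \<in> carrier F" "c \<noteq> \<zero>" "v \<otimes>\<^bsub>A\<^esub> v = c \<odot>\<^bsub>A\<^esub> \<one>\<^bsub>A\<^esub>"
  using pure_square[OF assms(1)] assms(2) by (metis A.one_closed smult_l_null)

lemma polar_eq_zero_iff:
  assumes "v \<in> carrier A" "w \<in> carrier A"
  shows "polar v w = \<zero>\<^bsub>A\<^esub> \<longleftrightarrow> w \<otimes>\<^bsub>A\<^esub> v = \<ominus>\<^bsub>A\<^esub> (v \<otimes>\<^bsub>A\<^esub> w)"
  using assms M.minus_equality[of "w \<otimes>\<^bsub>A\<^esub> v" "v \<otimes>\<^bsub>A\<^esub> w"]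
  by (auto simp: polar_def M.a_comm M.r_neg)

lemma orthogonal_exists:
  assumes "x \<in> pure" "x \<noteq> \<zero>\<^bsub>A\<^esub>"
  obtains q where "q \<in> pure" "q \<noteq> \<zero>\<^bsub>A\<^esub>" "polar x q = \<zero>\<^bsub>A\<^esub>"
proof -
  obtain \<alpha> \<beta> \<delta> where c: "\<alpha> \<in> carrier F" "\<beta> \<in> carrier F" "\<delta> \<in> carrier F"
    and x: "x = quat_comb A i j (\<zero>, \<alpha>, \<beta>, \<delta>)"
    using assms unfolding pure_def by blast
  show ?thesis
  proof (cases "\<alpha> = \<zero> \<and> \<beta> = \<zero>")
    case True
    have i: "i = quat_comb A i j (\<zero>, \<one>, \<zero>, \<zero>)" by (simp add: quat_comb_apply)
    have "polar x (quat_comb A i j (\<zero>, \<one>, \<zero>, \<zero>)) = \<zero>\<^bsub>A\<^esub>"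
      unfolding x using True c by (subst pure_polar_coords) (simp_all add: Let_def F.minus_eq)
    hence "polar x i = \<zero>\<^bsub>A\<^esub>" using i by simp
    moreover have "i \<noteq> \<zero>\<^bsub>A\<^esub>" using i_cancel[of "\<one>\<^bsub>A\<^esub>"] nontrivial by auto
    ultimately show ?thesis using generators_pure that by blast
  next
    case False
    let ?q = "quat_comb A i j (\<zero>, b \<otimes> \<beta>, \<ominus> (a \<otimes> \<alpha>), \<zero>)"
    have q: "?q \<in> pure" using c by (intro pureI) auto
    have "polar x ?q = \<zero>\<^bsub>A\<^esub>"
      unfolding x using c
      by (subst pure_polar_coords) (simp_all add: Let_def F.minus_eq F.r_minus F.m_ac F.r_neg)
    moreover have "?q \<noteq> \<zero>\<^bsub>A\<^esub>"
    proof
      assume "?q = \<zero>\<^bsub>A\<^esub>"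
      hence "b \<otimes> \<beta> = \<zero>" "\<ominus> (a \<otimes> \<alpha>) = \<zero>" using quat_comb_zero[of \<zero> "b \<otimes> \<beta>" "\<ominus> (a \<otimes> \<alpha>)" \<zero>] c by auto
      hence "b \<otimes> \<beta> = \<zero>" "a \<otimes> \<alpha> = \<zero>" using c F.minus_minus[of "a \<otimes> \<alpha>"] by auto
      thus False using False F.integral a_nonzero b_nonzero c by (metis a_closed b_closed)
    qed
    ultimately show ?thesis using q that by blast
  qed
qed

text \<open>The polar form stays nondegenerate on the complement of \<open>x\<close>: if \<open>q\<close> in the complement pairs
  nontrivially with \<open>w\<close>, then it pairs nontrivially with the projection of \<open>w\<close> to the complement.
  A nonzero form in characteristic other than two does not vanish identically as a quadratic form.\<close>

lemma orthogonal_anisotropic_exists: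
  assumes x: "x \<in> pure" and c: "c \<in> carrier F" "c \<noteq> \<zero>" "x \<otimes>\<^bsub>A\<^esub> x = c \<odot>\<^bsub>A\<^esub> \<one>\<^bsub>A\<^esub>"
  obtains y where "y \<in> pure" "polar x y = \<zero>\<^bsub>A\<^esub>" "y \<otimes>\<^bsub>A\<^esub> y \<noteq> \<zero>\<^bsub>A\<^esub>"
proof -
  have xA: "x \<in> carrier A" using x pure_closed by blast
  have "x \<noteq> \<zero>\<^bsub>A\<^esub>" using c smult_eq_zero[of c "\<one>\<^bsub>A\<^esub>"] nontrivial by auto
  then obtain q where q: "q \<in> pure" "q \<noteq> \<zero>\<^bsub>A\<^esub>" "polar x q = \<zero>\<^bsub>A\<^esub>" using orthogonal_exists x by blast
  then obtain w where w: "w \<in> pure" "polar q w \<noteq> \<zero>\<^bsub>A\<^esub>" using pure_nondegenerate[OF q(1,2)] by blast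
  obtain m where m: "m \<in> carrier F" "polar x w = m \<odot>\<^bsub>A\<^esub> \<one>\<^bsub>A\<^esub>" using pure_polar x w by blast
  have qA: "q \<in> carrier A" and wA: "w \<in> carrier A" using q w pure_closed by auto
  define d where "d = c \<oplus> c"
  have d: "d \<in> carrier F" "d \<noteq> \<zero>" using c double_zero_scalar[OF c(1)] by (auto simp: d_def)
  \<comment> \<open>Up to the factor \<open>d\<close>, this is the projection of \<open>w\<close> to the complement of \<open>x\<close>.\<close>
  define w' where "w' = d \<odot>\<^bsub>A\<^esub> w \<oplus>\<^bsub>A\<^esub> (\<ominus> m) \<odot>\<^bsub>A\<^esub> x"
  have w': "w' \<in> pure" using w x m d pure_add pure_smult by (simp add: w'_def)
  have w'A: "w' \<in> carrier A" using w' pure_closed by blast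
  have xx: "polar x x = d \<odot>\<^bsub>A\<^esub> \<one>\<^bsub>A\<^esub>" using c xA by (simp add: polar_def d_def smult_l_distr)
  have "polar x w' = d \<odot>\<^bsub>A\<^esub> (m \<odot>\<^bsub>A\<^esub> \<one>\<^bsub>A\<^esub>) \<oplus>\<^bsub>A\<^esub> (\<ominus> m) \<odot>\<^bsub>A\<^esub> (d \<odot>\<^bsub>A\<^esub> \<one>\<^bsub>A\<^esub>)"
    unfolding w'_def using m d xA wA by (simp add: polar_add polar_smult xx)
  hence xw': "polar x w' = \<zero>\<^bsub>A\<^esub>"
    using m(1) d(1) by (simp add: smult_l_minus smult_lcomm[of d m] M.r_neg)
  have "polar q w' = d \<odot>\<^bsub>A\<^esub> polar q w \<oplus>\<^bsub>A\<^esub> (\<ominus> m) \<odot>\<^bsub>A\<^esub> polar q x"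
    unfolding w'_def using m d xA wA qA by (simp add: polar_add polar_smult)
  also have "... = d \<odot>\<^bsub>A\<^esub> polar q w" using q(3) polar_commute xA qA wA m(1) d(1) by simp
  finally have "polar q w' \<noteq> \<zero>\<^bsub>A\<^esub>" using smult_eq_zero[of d "polar q w"] d w(2) qA wA by auto
  then obtain y where y: "y \<in> {q, w', q \<oplus>\<^bsub>A\<^esub> w'}" "y \<otimes>\<^bsub>A\<^esub> y \<noteq> \<zero>\<^bsub>A\<^esub>"
    using anisotropic_sum[OF qA w'A] by blast
  moreover have "y \<in> pure" using y(1) q w' pure_add by auto
  moreover have "polar x y = \<zero>\<^bsub>A\<^esub>" using y(1) q(3) xw' polar_add[OF xA qA w'A] by auto
  ultimately show ?thesis using that by blast
qed

text \<open>The square of \<open>s v\<close> is the same scalar as that of \<open>v\<close>. If \<open>s v = t + w\<close> with \<open>w\<close> pure, then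
  its square has pure part \<open>2 t w\<close>, so \<open>t = 0\<close> or \<open>w = 0\<close>; in the second case \<open>v\<close> is
  itself a scalar, hence zero.\<close>

lemma involution_pure:
  assumes s: "alg_involution F A s" and v: "v \<in> pure"
  shows "s v \<in> pure"
proof -
  note s' = involution_facts[OF s]
  have vA: "v \<in> carrier A" using v pure_closed by blast
  obtain c where c: "c \<in> carrier F" "v \<otimes>\<^bsub>A\<^esub> v = c \<odot>\<^bsub>A\<^esub> \<one>\<^bsub>A\<^esub>" using pure_square v by blast
  obtain t w where t: "t \<in> carrier F" and w: "w \<in> pure" and sv: "s v = t \<odot>\<^bsub>A\<^esub> \<one>\<^bsub>A\<^esub> \<oplus>\<^bsub>A\<^esub> w"
    using scalar_plus_pureE[OF s'(1)[OF vA]] by blast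
  have wA: "w \<in> carrier A" using w pure_closed by blast
  obtain d where d: "d \<in> carrier F" "w \<otimes>\<^bsub>A\<^esub> w = d \<odot>\<^bsub>A\<^esub> \<one>\<^bsub>A\<^esub>" using pure_square w by blast
  let ?p = "t \<odot>\<^bsub>A\<^esub> (w \<oplus>\<^bsub>A\<^esub> w)"
  have "c \<odot>\<^bsub>A\<^esub> \<one>\<^bsub>A\<^esub> = s v \<otimes>\<^bsub>A\<^esub> s v" using s'(4)[of v v] s'(3,6) c vA by simp
  also have "... = (t \<otimes> t) \<odot>\<^bsub>A\<^esub> \<one>\<^bsub>A\<^esub> \<oplus>\<^bsub>A\<^esub> ?p \<oplus>\<^bsub>A\<^esub> d \<odot>\<^bsub>A\<^esub> \<one>\<^bsub>A\<^esub>"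
    unfolding sv using square_add[of "t \<odot>\<^bsub>A\<^esub> \<one>\<^bsub>A\<^esub>" w] t wA d
    by (simp add: polar_def smult_mult_left smult_mult_right smult_assoc1 smult_r_distr)
  also have "... = ?p \<oplus>\<^bsub>A\<^esub> (t \<otimes> t \<oplus> d) \<odot>\<^bsub>A\<^esub> \<one>\<^bsub>A\<^esub>"
    using t d wA by (simp add: smult_l_distr M.a_ac)
  finally have "c \<odot>\<^bsub>A\<^esub> \<one>\<^bsub>A\<^esub> \<oplus>\<^bsub>A\<^esub> (\<ominus> (t \<otimes> t \<oplus> d)) \<odot>\<^bsub>A\<^esub> \<one>\<^bsub>A\<^esub> = ?p"
    using t d wA by (simp add: smult_l_minus M.a_assoc M.r_neg del: F.minus_add)
  hence e: "(c \<ominus> (t \<otimes> t \<oplus> d)) \<odot>\<^bsub>A\<^esub> \<one>\<^bsub>A\<^esub> = ?p"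
    using t d c by (simp add: smult_l_distr F.minus_eq del: F.minus_add)
  have "?p \<in> pure" using pure_add pure_smult w t by simp
  hence "c \<ominus> (t \<otimes> t \<oplus> d) = \<zero>" using e pure_scalar[of "c \<ominus> (t \<otimes> t \<oplus> d)"] c t d by simp
  hence "?p = \<zero>\<^bsub>A\<^esub>" using e[symmetric] by simp
  hence "t = \<zero> \<or> w \<oplus>\<^bsub>A\<^esub> w = \<zero>\<^bsub>A\<^esub>" using smult_eq_zero[of t "w \<oplus>\<^bsub>A\<^esub> w"] t wA by blast
  hence "t = \<zero> \<or> w = \<zero>\<^bsub>A\<^esub>" using double_zero[OF wA] by blast
  thus ?thesis
  proof
    assume "t = \<zero>"
    thus ?thesis using w wA sv by simp
  next
    assume "w = \<zero>\<^bsub>A\<^esub>"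
    hence sv': "s v = t \<odot>\<^bsub>A\<^esub> \<one>\<^bsub>A\<^esub>" using sv t by simp
    hence "v = t \<odot>\<^bsub>A\<^esub> \<one>\<^bsub>A\<^esub>" using s'(5)[OF vA] s'(3)[of t "\<one>\<^bsub>A\<^esub>"] s'(6) t by simp
    thus ?thesis using sv' v by simp
  qed
qed

text \<open>An involution acts on the three-dimensional space of pure quaternions and preserves the polar form. If it
  is not standard, then it does not negate every pure quaternion, and nondegeneracy gives a fixed \<open>x\<close> with
  nonzero square. In the complement of \<open>x\<close> take \<open>y\<close> with nonzero square and split \<open>2 y\<close> into its
  fixed part \<open>y + s y\<close> and its negated part \<open>y - s y\<close>. One of the parts has nonzero square. A fixed part
  serves directly as second generator, and if \<open>q\<close> is negated by \<open>s\<close> and anticommutes with \<open>x\<close> then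
  \<open>s (x q) = - q x = x q\<close>, so \<open>x q\<close> serves instead.\<close>

lemma symmetric_generators:
  assumes s: "alg_involution F A s" and ns: "\<not> is_standard_involution F A s"
  shows "\<exists>x y c d. quaternion F A x y c d \<and> s x = x \<and> s y = y"
proof -
  note s' = involution_facts[OF s]
  have sp: "s v \<in> pure" if "v \<in> pure" for v using involution_pure[OF s that] .
  have gens: "quat_gens F A i j" using other_generators(2)[OF basis] quat_units_axioms .
  have "s i \<noteq> \<ominus>\<^bsub>A\<^esub> i \<or> s j \<noteq> \<ominus>\<^bsub>A\<^esub> j"
  proof (rule ccontr)
    assume "\<not> (s i \<noteq> \<ominus>\<^bsub>A\<^esub> i \<or> s j \<noteq> \<ominus>\<^bsub>A\<^esub> j)"
    hence m: "s i = \<ominus>\<^bsub>A\<^esub> i" "s j = \<ominus>\<^bsub>A\<^esub> j" by auto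
    have "s (i \<otimes>\<^bsub>A\<^esub> j) = \<ominus>\<^bsub>A\<^esub> (i \<otimes>\<^bsub>A\<^esub> j)" by (simp add: s' m A.l_minus A.r_minus ji)
    hence st: "s (quat_comb A i j (t, x, y, z)) = quat_comb A i j (t, \<ominus> x, \<ominus> y, \<ominus> z)"
      if "t \<in> carrier F" "x \<in> carrier F" "y \<in> carrier F" "z \<in> carrier F" for t x y z
      using that by (simp add: quat_comb_apply s' m smult_l_minus smult_r_minus)
    have "is_standard_involution F A s"
      unfolding is_standard_involution_def by (intro exI[of _ i] exI[of _ j] conjI gens ballI st)
    thus False using ns by blast
  qed
  then obtain v where v: "v \<in> pure" "s v \<noteq> \<ominus>\<^bsub>A\<^esub> v" using generators_pure by blast
  have vA: "v \<in> carrier A" using v pure_closed by blast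
  define w where "w = v \<oplus>\<^bsub>A\<^esub> s v"
  have w: "w \<in> pure" "s w = w" "w \<noteq> \<zero>\<^bsub>A\<^esub>"
  proof -
    show "w \<in> pure" unfolding w_def by (intro pure_add sp v)
    show "s w = w" using s'(1,2,5) vA by (simp add: w_def M.a_comm)
    have "s v \<oplus>\<^bsub>A\<^esub> v = \<zero>\<^bsub>A\<^esub> \<Longrightarrow> \<ominus>\<^bsub>A\<^esub> v = s v" using vA s'(1)[OF vA] by (intro M.minus_equality)
    thus "w \<noteq> \<zero>\<^bsub>A\<^esub>" using v(2) vA s'(1)[OF vA] by (auto simp: w_def M.a_comm)
  qed
  have wA: "w \<in> carrier A" using w pure_closed by blast
  \<comment> \<open>The polar form of the fixed \<open>w\<close> and \<open>y + s y\<close> is twice that of \<open>w\<close> and \<open>y\<close>, hence nonzero.\<close>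
  have "\<exists>x\<in>pure. s x = x \<and> x \<otimes>\<^bsub>A\<^esub> x \<noteq> \<zero>\<^bsub>A\<^esub>"
  proof -
    obtain y where y: "y \<in> pure" "polar w y \<noteq> \<zero>\<^bsub>A\<^esub>" using pure_nondegenerate[OF w(1,3)] by blast
    have yA: "y \<in> carrier A" using y pure_closed by blast
    obtain m where m: "m \<in> carrier F" "polar w y = m \<odot>\<^bsub>A\<^esub> \<one>\<^bsub>A\<^esub>" using pure_polar w y by blast
    let ?y = "y \<oplus>\<^bsub>A\<^esub> s y"
    have "polar w (s y) = polar w y"
      using polar_involution[OF s wA yA] w(2) m s'(3,6) by simp
    hence "polar w ?y = polar w y \<oplus>\<^bsub>A\<^esub> polar w y" using polar_add wA yA s'(1) by simp
    hence "polar w ?y \<noteq> \<zero>\<^bsub>A\<^esub>" using double_zero[of "polar w y"] y(2) wA yA by auto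
    then obtain x where x: "x \<in> {w, ?y, w \<oplus>\<^bsub>A\<^esub> ?y}" "x \<otimes>\<^bsub>A\<^esub> x \<noteq> \<zero>\<^bsub>A\<^esub>"
      using anisotropic_sum[of w ?y] wA yA s'(1) by auto
    have "?y \<in> pure" using pure_add sp y by blast
    moreover have "s ?y = ?y" using s' yA by (simp add: M.a_comm)
    ultimately have "x \<in> pure \<and> s x = x"
      using x(1) w pure_add s'(2) wA yA s'(1) by auto
    thus ?thesis using x(2) by blast
  qed
  then obtain x where x: "x \<in> pure" "s x = x" "x \<otimes>\<^bsub>A\<^esub> x \<noteq> \<zero>\<^bsub>A\<^esub>" by blast
  then obtain c where c: "c \<in> carrier F" "c \<noteq> \<zero>" "x \<otimes>\<^bsub>A\<^esub> x = c \<odot>\<^bsub>A\<^esub> \<one>\<^bsub>A\<^esub>" using square_nonzeroE by blast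
  have xA: "x \<in> carrier A" using x pure_closed by blast
  obtain y where y: "y \<in> pure" "polar x y = \<zero>\<^bsub>A\<^esub>" "y \<otimes>\<^bsub>A\<^esub> y \<noteq> \<zero>\<^bsub>A\<^esub>"
    using orthogonal_anisotropic_exists x(1) c by blast
  have yA: "y \<in> carrier A" using y pure_closed by blast
  obtain d where d: "d \<in> carrier F" "d \<noteq> \<zero>" "y \<otimes>\<^bsub>A\<^esub> y = d \<odot>\<^bsub>A\<^esub> \<one>\<^bsub>A\<^esub>" using y square_nonzeroE by blast
  have sy: "s y \<in> carrier A" "s y \<otimes>\<^bsub>A\<^esub> s y = y \<otimes>\<^bsub>A\<^esub> y"
    using s'(1)[OF yA] s'(4)[OF yA yA] s'(3,6) d by simp_all
  have xsy: "polar x (s y) = \<zero>\<^bsub>A\<^esub>"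
    using polar_involution[OF s xA yA] x(2) y(2) s'(7) by simp
  let ?p = "y \<oplus>\<^bsub>A\<^esub> s y" and ?q = "y \<oplus>\<^bsub>A\<^esub> \<ominus>\<^bsub>A\<^esub> s y"
  have pq: "?p \<in> pure" "?q \<in> pure" using pure_add pure_minus sp y by auto
  have pA: "?p \<in> carrier A" "?q \<in> carrier A" using pq pure_closed by auto
  have xp: "polar x ?p = \<zero>\<^bsub>A\<^esub>" "polar x ?q = \<zero>\<^bsub>A\<^esub>"
    using xA yA sy(1) y(2) xsy by (simp_all add: polar_add polar_minus)
  have sum: "?p \<otimes>\<^bsub>A\<^esub> ?p \<oplus>\<^bsub>A\<^esub> ?q \<otimes>\<^bsub>A\<^esub> ?q = (y \<otimes>\<^bsub>A\<^esub> y \<oplus>\<^bsub>A\<^esub> y \<otimes>\<^bsub>A\<^esub> y) \<oplus>\<^bsub>A\<^esub> (y \<otimes>\<^bsub>A\<^esub> y \<oplus>\<^bsub>A\<^esub> y \<otimes>\<^bsub>A\<^esub> y)"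
  proof -
    define k where "k = y \<otimes>\<^bsub>A\<^esub> y"
    define l where "l = polar y (s y)"
    have kl: "k \<in> carrier A" "l \<in> carrier A" using yA sy by (simp_all add: k_def l_def)
    have "?p \<otimes>\<^bsub>A\<^esub> ?p = k \<oplus>\<^bsub>A\<^esub> l \<oplus>\<^bsub>A\<^esub> k" using square_add[OF yA sy(1)] sy(2) by (simp add: k_def l_def)
    moreover have "?q \<otimes>\<^bsub>A\<^esub> ?q = k \<oplus>\<^bsub>A\<^esub> \<ominus>\<^bsub>A\<^esub> l \<oplus>\<^bsub>A\<^esub> k"
      using square_add[of y "\<ominus>\<^bsub>A\<^esub> s y"] polar_minus[OF yA sy(1)] yA sy
      by (simp add: k_def l_def A.l_minus A.r_minus)
    moreover have "(k \<oplus>\<^bsub>A\<^esub> l \<oplus>\<^bsub>A\<^esub> k) \<oplus>\<^bsub>A\<^esub> (k \<oplus>\<^bsub>A\<^esub> \<ominus>\<^bsub>A\<^esub> l \<oplus>\<^bsub>A\<^esub> k) = (k \<oplus>\<^bsub>A\<^esub> k) \<oplus>\<^bsub>A\<^esub> (k \<oplus>\<^bsub>A\<^esub> k)"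
      using kl by (simp add: M.a_ac M.r_neg M.r_neg1 M.r_neg2)
    ultimately show ?thesis by (simp add: k_def)
  qed
  have "?p \<otimes>\<^bsub>A\<^esub> ?p \<noteq> \<zero>\<^bsub>A\<^esub> \<or> ?q \<otimes>\<^bsub>A\<^esub> ?q \<noteq> \<zero>\<^bsub>A\<^esub>"
  proof (rule ccontr)
    assume "\<not> (?p \<otimes>\<^bsub>A\<^esub> ?p \<noteq> \<zero>\<^bsub>A\<^esub> \<or> ?q \<otimes>\<^bsub>A\<^esub> ?q \<noteq> \<zero>\<^bsub>A\<^esub>)"
    hence "(y \<otimes>\<^bsub>A\<^esub> y \<oplus>\<^bsub>A\<^esub> y \<otimes>\<^bsub>A\<^esub> y) \<oplus>\<^bsub>A\<^esub> (y \<otimes>\<^bsub>A\<^esub> y \<oplus>\<^bsub>A\<^esub> y \<otimes>\<^bsub>A\<^esub> y) = \<zero>\<^bsub>A\<^esub>" using sum by simp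
    thus False using double_zero[of "y \<otimes>\<^bsub>A\<^esub> y"] double_zero[of "y \<otimes>\<^bsub>A\<^esub> y \<oplus>\<^bsub>A\<^esub> y \<otimes>\<^bsub>A\<^esub> y"] y(3) yA by simp
  qed
  then obtain z e where z: "z \<in> carrier A" "polar x z = \<zero>\<^bsub>A\<^esub>" "s z = z" "e \<in> carrier F" "e \<noteq> \<zero>"
    "z \<otimes>\<^bsub>A\<^esub> z = e \<odot>\<^bsub>A\<^esub> \<one>\<^bsub>A\<^esub>"
  proof
    assume "?p \<otimes>\<^bsub>A\<^esub> ?p \<noteq> \<zero>\<^bsub>A\<^esub>"
    then obtain e where "e \<in> carrier F" "e \<noteq> \<zero>" "?p \<otimes>\<^bsub>A\<^esub> ?p = e \<odot>\<^bsub>A\<^esub> \<one>\<^bsub>A\<^esub>" using pq square_nonzeroE by blast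
    moreover have "s ?p = ?p" using s' yA sy by (simp add: M.a_comm)
    ultimately show ?thesis using that pA xp by blast
  next
    assume "?q \<otimes>\<^bsub>A\<^esub> ?q \<noteq> \<zero>\<^bsub>A\<^esub>"
    then obtain e where e: "e \<in> carrier F" "e \<noteq> \<zero>" "?q \<otimes>\<^bsub>A\<^esub> ?q = e \<odot>\<^bsub>A\<^esub> \<one>\<^bsub>A\<^esub>" using pq square_nonzeroE by blast
    define q where "q = ?q"
    have qA: "q \<in> carrier A" using pA by (simp add: q_def)
    have qx: "q \<otimes>\<^bsub>A\<^esub> x = \<ominus>\<^bsub>A\<^esub> (x \<otimes>\<^bsub>A\<^esub> q)" using xp(2) polar_eq_zero_iff[OF xA qA] by (simp add: q_def)
    have "s q = \<ominus>\<^bsub>A\<^esub> q" using s' yA sy by (simp add: q_def M.a_comm M.minus_add)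
    hence "s (x \<otimes>\<^bsub>A\<^esub> q) = x \<otimes>\<^bsub>A\<^esub> q" using s' xA qA x(2) by (simp add: A.l_minus qx)
    moreover have sq: "(x \<otimes>\<^bsub>A\<^esub> q) \<otimes>\<^bsub>A\<^esub> (x \<otimes>\<^bsub>A\<^esub> q) = (\<ominus> (c \<otimes> e)) \<odot>\<^bsub>A\<^esub> \<one>\<^bsub>A\<^esub>"
    proof -
      have "(x \<otimes>\<^bsub>A\<^esub> q) \<otimes>\<^bsub>A\<^esub> (x \<otimes>\<^bsub>A\<^esub> q) = x \<otimes>\<^bsub>A\<^esub> ((q \<otimes>\<^bsub>A\<^esub> x) \<otimes>\<^bsub>A\<^esub> q)" using xA qA by (simp add: A.m_assoc)
      also have "... = \<ominus>\<^bsub>A\<^esub> ((x \<otimes>\<^bsub>A\<^esub> x) \<otimes>\<^bsub>A\<^esub> (q \<otimes>\<^bsub>A\<^esub> q))"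
        using xA qA by (simp add: qx A.m_assoc A.l_minus A.r_minus)
      also have "... = (\<ominus> (c \<otimes> e)) \<odot>\<^bsub>A\<^esub> \<one>\<^bsub>A\<^esub>"
        using c e by (simp add: q_def smult_mult_left smult_assoc1 smult_l_minus)
      finally show ?thesis .
    qed
    moreover have "\<ominus> (c \<otimes> e) \<noteq> \<zero>"
      using c e F.integral F.minus_minus[of "c \<otimes> e"] by (metis F.m_closed F.minus_zero)
    moreover have "polar x (x \<otimes>\<^bsub>A\<^esub> q) = \<zero>\<^bsub>A\<^esub>"
      using xA qA by (simp add: polar_def A.m_assoc qx A.r_minus M.r_neg)
    ultimately show ?thesis using that[of "x \<otimes>\<^bsub>A\<^esub> q" "\<ominus> (c \<otimes> e)"] xA qA c e by simp
  qed
  have "quat_units F A x z c e"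
    using c z xA polar_eq_zero_iff[OF xA z(1)] two_nonzero nontrivial by unfold_locales auto
  hence "quaternion F A x z c e"
    using other_generators(1)[OF basis] by (intro quaternion.intro quaternion_axioms.intro)
  thus ?thesis using x(2) z(3) by blast
qed

text \<open>A quaternion fixed by the standard involution is a scalar, which a generator is not.\<close>

lemma not_standard_involution:
  assumes "alg_involution F A s" "s i = i" "s j = j"
  shows "\<not> is_standard_involution F A s"
proof
  assume "is_standard_involution F A s"
  then obtain x y where g: "quat_gens F A x y"
    and st: "\<And>t u v w. \<lbrakk>t \<in> carrier F; u \<in> carrier F; v \<in> carrier F; w \<in> carrier F\<rbrakk> \<Longrightarrow>
      s (quat_comb A x y (t, u, v, w)) = quat_comb A x y (t, \<ominus> u, \<ominus> v, \<ominus> w)"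
    unfolding is_standard_involution_def by blast
  obtain c d where "quat_units F A x y c d" using quat_gensE[OF g two_nonzero] by blast
  then interpret O: quat_units F A x y c d .
  have "i \<in> quat_comb A x y ` coords"
    using g i_closed unfolding quat_gens_def by (metis bij_betw_imp_surj_on)
  then obtain t u v w where c: "t \<in> carrier F" "u \<in> carrier F" "v \<in> carrier F" "w \<in> carrier F"
    and i: "i = quat_comb A x y (t, u, v, w)" by auto
  have "quat_comb A x y (t, \<ominus> u, \<ominus> v, \<ominus> w) = quat_comb A x y (t, u, v, w)"
    using st[OF c] assms(2) i by simp
  hence "(t, \<ominus> u, \<ominus> v, \<ominus> w) = (t, u, v, w)"
    using c by (intro inj_onD[OF O.quat_comb_inj]) auto
  hence "u \<oplus> u = \<zero>" "v \<oplus> v = \<zero>" "w \<oplus> w = \<zero>" using c by (metis F.l_neg prod.inject)+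
  hence "u = \<zero>" "v = \<zero>" "w = \<zero>" using double_zero_scalar[OF c(2)] double_zero_scalar[OF c(3)] double_zero_scalar[OF c(4)] by blast+
  hence "i = t \<odot>\<^bsub>A\<^esub> \<one>\<^bsub>A\<^esub>" using i c by (simp add: O.quat_comb_apply)
  hence "t = \<zero>" using pure_scalar[OF c(1)] generators_pure by simp
  hence "i = \<zero>\<^bsub>A\<^esub>" using \<open>i = t \<odot>\<^bsub>A\<^esub> \<one>\<^bsub>A\<^esub>\<close> by simp
  thus False using i_cancel[of "\<one>\<^bsub>A\<^esub>"] nontrivial by simp
qed

end

lemma quaternion_normal_form:
  assumes "\<one>\<^bsub>F\<^esub> \<oplus>\<^bsub>F\<^esub> \<one>\<^bsub>F\<^esub> \<noteq> \<zero>\<^bsub>F\<^esub>" "quaternion_algebra F H" "orthogonal_involution F H s"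
  shows "\<exists>i j a b. quaternion F H i j a b \<and> alg_involution F H s \<and> s i = i \<and> s j = j"
proof -
  interpret assoc_algebra F H using assms(2) by (simp add: quaternion_algebra_def)
  obtain i j where ij: "quat_gens F H i j" using assms(2) by (auto simp: quaternion_algebra_def)
  then obtain a b where "quat_units F H i j a b" using quat_gensE assms(1) by blast
  hence "quaternion F H i j a b"
    using ij by (intro quaternion.intro quaternion_axioms.intro) (simp_all add: quat_gens_def)
  then interpret quaternion F H i j a b .
  have "alg_involution F H s" "\<not> is_standard_involution F H s"
    using assms(3) by (simp_all add: orthogonal_involution_def)
  thus ?thesis using symmetric_generators by blast
qed

lemma quaternion_algebraI:
  assumes "quaternion F H i j a b"
  shows "quaternion_algebra F H"
proof -
  interpret quaternion F H i j a b by fact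
  show ?thesis
    using assoc_algebra_axioms other_generators(2)[OF basis quat_units_axioms]
    by (auto simp: quaternion_algebra_def)
qed

section \<open>Inverses in the matrix groups\<close>

lemma SL_inv_carrier:
  "Mat2 p q r t \<in> carrier (SL_inv H s) \<longleftrightarrow>
     p \<in> carrier H \<and> q \<in> carrier H \<and> r \<in> carrier H \<and> t \<in> carrier H \<and>
     p \<otimes>\<^bsub>H\<^esub> s q \<in> fixed_set H s \<and> r \<otimes>\<^bsub>H\<^esub> s t \<in> fixed_set H s \<and>
     p \<otimes>\<^bsub>H\<^esub> s t \<ominus>\<^bsub>H\<^esub> q \<otimes>\<^bsub>H\<^esub> s r = \<one>\<^bsub>H\<^esub>"
  by (auto simp: SL_inv_def)

lemma SL_inv_simps [simp]:
  "g \<otimes>\<^bsub>SL_inv H s\<^esub> h = mat2_mult H g h"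
  "\<one>\<^bsub>SL_inv H s\<^esub> = Mat2 \<one>\<^bsub>H\<^esub> \<zero>\<^bsub>H\<^esub> \<zero>\<^bsub>H\<^esub> \<one>\<^bsub>H\<^esub>"
  by (simp_all add: SL_inv_def)

lemma SL_inv_subset: "carrier (SL_inv H s) \<subseteq> carrier (mat2_ring H)"
  by (auto simp: SL_inv_def mat2_ring_def)

lemma mult_mat2_ring: "g \<otimes>\<^bsub>mat2_ring H\<^esub> h = mat2_mult H g h"
  by (simp add: mat2_ring_def)

context quaternion
begin

text \<open>The sixteen matrices with a single nonzero entry from \<open>1, i, j, i j\<close> span \<open>Mat(2, A)\<close> over
  the central field of scalar matrices.\<close>

lemma mat2_left_inverse:
  assumes "g \<in> carrier (mat2_ring A)" "h \<in> carrier (mat2_ring A)" "g \<otimes>\<^bsub>mat2_ring A\<^esub> h = \<one>\<^bsub>mat2_ring A\<^esub>"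
  shows "h \<otimes>\<^bsub>mat2_ring A\<^esub> g = \<one>\<^bsub>mat2_ring A\<^esub>"
proof -
  interpret MR: ring "mat2_ring A" by (rule A.ring_mat2_ring)
  define sc where "sc = (\<lambda>c. Mat2 (c \<odot>\<^bsub>A\<^esub> \<one>\<^bsub>A\<^esub>) \<zero>\<^bsub>A\<^esub> \<zero>\<^bsub>A\<^esub> (c \<odot>\<^bsub>A\<^esub> \<one>\<^bsub>A\<^esub>))"
  define K where "K = sc ` carrier F"
  have sc: "sc \<in> ring_hom F (mat2_ring A)"
    by (rule ring_hom_memI) (auto simp: sc_def smult_l_distr smult_mult_left smult_assoc1)
  have K: "subfield K (mat2_ring A)"
    unfolding K_def
    using ring_hom_ring.img_is_subfield(2)[OF ring_hom_ringI2[OF F.ring_axioms MR.ring_axioms sc]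
        F.carrier_is_subfield] nontrivial by simp
  have central: "k \<otimes>\<^bsub>mat2_ring A\<^esub> x = x \<otimes>\<^bsub>mat2_ring A\<^esub> k" if "k \<in> K" "x \<in> carrier (mat2_ring A)" for k x
    using that by (auto simp: K_def sc_def mat2_ring_def smult_mult_left smult_mult_right)
  define Es where "Es = [\<lambda>x. Mat2 x \<zero>\<^bsub>A\<^esub> \<zero>\<^bsub>A\<^esub> \<zero>\<^bsub>A\<^esub>, \<lambda>x. Mat2 \<zero>\<^bsub>A\<^esub> x \<zero>\<^bsub>A\<^esub> \<zero>\<^bsub>A\<^esub>, \<lambda>x. Mat2 \<zero>\<^bsub>A\<^esub> \<zero>\<^bsub>A\<^esub> x \<zero>\<^bsub>A\<^esub>, \<lambda>x. Mat2 \<zero>\<^bsub>A\<^esub> \<zero>\<^bsub>A\<^esub> \<zero>\<^bsub>A\<^esub> x]"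
  define Us where "Us = concat (map (\<lambda>E. map E [\<one>\<^bsub>A\<^esub>, i, j, i \<otimes>\<^bsub>A\<^esub> j]) Es)"
  have Us: "set Us \<subseteq> carrier (mat2_ring A)"
    by (auto simp: Us_def Es_def)
  define S where "S = MR.Span K Us"
  have S_add: "x \<oplus>\<^bsub>mat2_ring A\<^esub> y \<in> S" if "x \<in> S" "y \<in> S" for x y
    using MR.Span_subgroup_props(3)[OF K Us] that unfolding S_def by blast
  have S_smult: "sc c \<otimes>\<^bsub>mat2_ring A\<^esub> x \<in> S" if "c \<in> carrier F" "x \<in> S" for c x
    using MR.Span_smult_closed[OF K Us, of "sc c" x] that unfolding S_def by (auto simp: K_def simp del: MR.Span.simps)
  have E: "E h \<in> S" if EE: "E \<in> set Es" and h: "h \<in> carrier A" for E h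
  proof -
    have gen: "E u \<in> S" if "u \<in> {\<one>\<^bsub>A\<^esub>, i, j, i \<otimes>\<^bsub>A\<^esub> j}" for u
      using MR.Span_base_incl[OF K Us] EE that unfolding S_def Us_def by (auto simp del: MR.Span.simps)
    have "E (x \<oplus>\<^bsub>A\<^esub> y) = E x \<oplus>\<^bsub>mat2_ring A\<^esub> E y" if "x \<in> carrier A" "y \<in> carrier A" for x y
      using EE that by (auto simp: Es_def)
    hence add: "E (x \<oplus>\<^bsub>A\<^esub> y) \<in> S" if "x \<in> carrier A" "y \<in> carrier A" "E x \<in> S" "E y \<in> S" for x y
      using S_add[of "E x" "E y"] that by simp
    have "E (c \<odot>\<^bsub>A\<^esub> x) = sc c \<otimes>\<^bsub>mat2_ring A\<^esub> E x" if "c \<in> carrier F" "x \<in> carrier A" for c x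
      using EE that by (auto simp: Es_def sc_def smult_mult_left)
    hence smult: "E (c \<odot>\<^bsub>A\<^esub> u) \<in> S" if "c \<in> carrier F" "u \<in> {\<one>\<^bsub>A\<^esub>, i, j, i \<otimes>\<^bsub>A\<^esub> j}" for c u
      using S_smult[OF that(1) gen[OF that(2)]] that by (metis A.m_closed A.one_closed i_closed insertE j_closed singletonD)
    obtain t x y z where "t \<in> carrier F" "x \<in> carrier F" "y \<in> carrier F" "z \<in> carrier F"
      "h = quat_comb A i j (t, x, y, z)" using h by (rule quat_comb_cases)
    thus ?thesis unfolding quat_comb_apply by (simp add: add smult)
  qed
  have "carrier (mat2_ring A) \<subseteq> S"
  proof
    fix x assume "x \<in> carrier (mat2_ring A)"
    then obtain p q r t where x: "x = Mat2 p q r t" "p \<in> carrier A" "q \<in> carrier A" "r \<in> carrier A" "t \<in> carrier A"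
      by (auto simp: mat2_ring_def)
    have "x = (Mat2 p \<zero>\<^bsub>A\<^esub> \<zero>\<^bsub>A\<^esub> \<zero>\<^bsub>A\<^esub> \<oplus>\<^bsub>mat2_ring A\<^esub> Mat2 \<zero>\<^bsub>A\<^esub> q \<zero>\<^bsub>A\<^esub> \<zero>\<^bsub>A\<^esub>) \<oplus>\<^bsub>mat2_ring A\<^esub>
        (Mat2 \<zero>\<^bsub>A\<^esub> \<zero>\<^bsub>A\<^esub> r \<zero>\<^bsub>A\<^esub> \<oplus>\<^bsub>mat2_ring A\<^esub> Mat2 \<zero>\<^bsub>A\<^esub> \<zero>\<^bsub>A\<^esub> \<zero>\<^bsub>A\<^esub> t)"
      using x by simp
    also have "... \<in> S"
      by (intro S_add) (use E[of "\<lambda>x. Mat2 x \<zero>\<^bsub>A\<^esub> \<zero>\<^bsub>A\<^esub> \<zero>\<^bsub>A\<^esub>" p] E[of "\<lambda>x. Mat2 \<zero>\<^bsub>A\<^esub> x \<zero>\<^bsub>A\<^esub> \<zero>\<^bsub>A\<^esub>" q]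
        E[of "\<lambda>x. Mat2 \<zero>\<^bsub>A\<^esub> \<zero>\<^bsub>A\<^esub> x \<zero>\<^bsub>A\<^esub>" r] E[of "\<lambda>x. Mat2 \<zero>\<^bsub>A\<^esub> \<zero>\<^bsub>A\<^esub> \<zero>\<^bsub>A\<^esub> x" t] x in \<open>simp_all add: Es_def\<close>)
    finally show "x \<in> S" .
  qed
  hence S: "S = carrier (mat2_ring A)" using MR.Span_subgroup_props(1)[OF K Us] unfolding S_def by blast
  obtain Vs where Vs: "MR.independent K Vs" "MR.Span K Vs = S"
    unfolding S_def using MR.filter_base[OF K Us] .
  have "MR.dimension (length Vs) K (carrier (mat2_ring A))"
    by (rule MR.dimensionI[OF K Vs(1)]) (simp only: Vs(2) S)
  thus ?thesis using MR.finite_dimension_left_inverse[OF K central _ assms] by blast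
qed

text \<open>The equations that define the group say that the displayed matrix is a right inverse. Finite
  dimension makes it a left inverse, and the entries of that second product are the equations which put it into
  the group. Only then does the inverse formed in the group coincide with it.\<close>

lemma SL_inv_inverse:
  assumes s: "alg_involution F A s" and g: "Mat2 p q r t \<in> carrier (SL_inv A s)"
  shows "m_inv (SL_inv A s) (Mat2 p q r t) = Mat2 (s t) (\<ominus>\<^bsub>A\<^esub> s q) (\<ominus>\<^bsub>A\<^esub> s r) (s p)"
    "mat2_mult A (Mat2 p q r t) (Mat2 (s t) (\<ominus>\<^bsub>A\<^esub> s q) (\<ominus>\<^bsub>A\<^esub> s r) (s p)) = Mat2 \<one>\<^bsub>A\<^esub> \<zero>\<^bsub>A\<^esub> \<zero>\<^bsub>A\<^esub> \<one>\<^bsub>A\<^esub>"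
    "mat2_mult A (Mat2 (s t) (\<ominus>\<^bsub>A\<^esub> s q) (\<ominus>\<^bsub>A\<^esub> s r) (s p)) (Mat2 p q r t) = Mat2 \<one>\<^bsub>A\<^esub> \<zero>\<^bsub>A\<^esub> \<zero>\<^bsub>A\<^esub> \<one>\<^bsub>A\<^esub>"
proof -
  note s' = involution_facts[OF s]
  interpret MR: ring "mat2_ring A" by (rule A.ring_mat2_ring)
  let ?g = "Mat2 p q r t" and ?h = "Mat2 (s t) (\<ominus>\<^bsub>A\<^esub> s q) (\<ominus>\<^bsub>A\<^esub> s r) (s p)"
  have c: "p \<in> carrier A" "q \<in> carrier A" "r \<in> carrier A" "t \<in> carrier A"
    and pq: "s (p \<otimes>\<^bsub>A\<^esub> s q) = p \<otimes>\<^bsub>A\<^esub> s q" and rt: "s (r \<otimes>\<^bsub>A\<^esub> s t) = r \<otimes>\<^bsub>A\<^esub> s t"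
    and det: "p \<otimes>\<^bsub>A\<^esub> s t \<ominus>\<^bsub>A\<^esub> q \<otimes>\<^bsub>A\<^esub> s r = \<one>\<^bsub>A\<^esub>"
    using g by (auto simp: SL_inv_carrier fixed_set_def)
  have sc: "s p \<in> carrier A" "s q \<in> carrier A" "s r \<in> carrier A" "s t \<in> carrier A" using c s'(1) by auto
  have pq': "q \<otimes>\<^bsub>A\<^esub> s p = p \<otimes>\<^bsub>A\<^esub> s q" and rt': "t \<otimes>\<^bsub>A\<^esub> s r = r \<otimes>\<^bsub>A\<^esub> s t"
    using pq rt s'(4,5) c sc by auto
  have "s (p \<otimes>\<^bsub>A\<^esub> s t \<ominus>\<^bsub>A\<^esub> q \<otimes>\<^bsub>A\<^esub> s r) = \<one>\<^bsub>A\<^esub>" using det s'(6) by simp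
  hence det': "t \<otimes>\<^bsub>A\<^esub> s p \<ominus>\<^bsub>A\<^esub> r \<otimes>\<^bsub>A\<^esub> s q = \<one>\<^bsub>A\<^esub>"
    using c sc s'(2,4,5,8) by (simp add: M.minus_eq)
  show 1: "mat2_mult A ?g ?h = Mat2 \<one>\<^bsub>A\<^esub> \<zero>\<^bsub>A\<^esub> \<zero>\<^bsub>A\<^esub> \<one>\<^bsub>A\<^esub>"
    using c sc det det' pq' rt' by (simp add: M.minus_eq A.r_minus M.l_neg M.r_neg M.a_comm)
  have mem: "?g \<in> carrier (mat2_ring A)" "?h \<in> carrier (mat2_ring A)" using c sc by auto
  show 2: "mat2_mult A ?h ?g = Mat2 \<one>\<^bsub>A\<^esub> \<zero>\<^bsub>A\<^esub> \<zero>\<^bsub>A\<^esub> \<one>\<^bsub>A\<^esub>"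
    using mat2_left_inverse[OF mem] 1 by (simp add: mult_mat2_ring del: mat2_ring_simps(2) mat2_mult.simps)
  have "s t \<otimes>\<^bsub>A\<^esub> p \<ominus>\<^bsub>A\<^esub> s q \<otimes>\<^bsub>A\<^esub> r = \<one>\<^bsub>A\<^esub>" "s t \<otimes>\<^bsub>A\<^esub> q \<ominus>\<^bsub>A\<^esub> s q \<otimes>\<^bsub>A\<^esub> t = \<zero>\<^bsub>A\<^esub>" "s p \<otimes>\<^bsub>A\<^esub> r \<ominus>\<^bsub>A\<^esub> s r \<otimes>\<^bsub>A\<^esub> p = \<zero>\<^bsub>A\<^esub>"
    using 2 c sc by (simp_all add: M.minus_eq A.l_minus M.a_comm)
  hence e: "s t \<otimes>\<^bsub>A\<^esub> p \<ominus>\<^bsub>A\<^esub> s q \<otimes>\<^bsub>A\<^esub> r = \<one>\<^bsub>A\<^esub>" "s t \<otimes>\<^bsub>A\<^esub> q = s q \<otimes>\<^bsub>A\<^esub> t" "s p \<otimes>\<^bsub>A\<^esub> r = s r \<otimes>\<^bsub>A\<^esub> p"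
    using c sc by simp_all
  have "?h \<in> carrier (SL_inv A s)"
    using e c sc s' by (simp add: SL_inv_carrier fixed_set_def A.r_minus A.l_minus M.minus_eq)
  moreover have "h = ?h" if "h \<in> carrier (SL_inv A s)" "mat2_mult A ?g h = Mat2 \<one>\<^bsub>A\<^esub> \<zero>\<^bsub>A\<^esub> \<zero>\<^bsub>A\<^esub> \<one>\<^bsub>A\<^esub>" for h
  proof -
    have h: "h \<in> carrier (mat2_ring A)" using that SL_inv_subset by blast
    have "h = \<one>\<^bsub>mat2_ring A\<^esub> \<otimes>\<^bsub>mat2_ring A\<^esub> h" using h by (simp only: MR.l_one)
    also have "... = (?h \<otimes>\<^bsub>mat2_ring A\<^esub> ?g) \<otimes>\<^bsub>mat2_ring A\<^esub> h" using 2 by (simp only: mult_mat2_ring mat2_ring_simps(4))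
    also have "... = ?h \<otimes>\<^bsub>mat2_ring A\<^esub> (?g \<otimes>\<^bsub>mat2_ring A\<^esub> h)" using mem h by (simp only: MR.m_assoc)
    also have "... = ?h \<otimes>\<^bsub>mat2_ring A\<^esub> \<one>\<^bsub>mat2_ring A\<^esub>" using that(2) by (simp only: mult_mat2_ring mat2_ring_simps(4))
    also have "... = ?h" using mem(2) by (simp only: MR.r_one)
    finally show ?thesis .
  qed
  ultimately show "m_inv (SL_inv A s) ?g = ?h"
    unfolding m_inv_def SL_inv_simps using 1 2 by (intro the_equality) blast+
qed

end

section \<open>Conjugate groups come from isomorphic algebras\<close>

lemma inv_alg_embedding_restrict_scalarsD:
  assumes "inv_alg_embedding K B s1 (restrict_scalars \<phi> A) s e"
  shows "\<And>x. x \<in> carrier B \<Longrightarrow> e x \<in> carrier A"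
    "\<And>x y. \<lbrakk>x \<in> carrier B; y \<in> carrier B\<rbrakk> \<Longrightarrow> e (x \<otimes>\<^bsub>B\<^esub> y) = e x \<otimes>\<^bsub>A\<^esub> e y"
    "\<And>x y. \<lbrakk>x \<in> carrier B; y \<in> carrier B\<rbrakk> \<Longrightarrow> e (x \<oplus>\<^bsub>B\<^esub> y) = e x \<oplus>\<^bsub>A\<^esub> e y"
    "e \<one>\<^bsub>B\<^esub> = \<one>\<^bsub>A\<^esub>"
    "\<And>c x. \<lbrakk>c \<in> carrier K; x \<in> carrier B\<rbrakk> \<Longrightarrow> e (c \<odot>\<^bsub>B\<^esub> x) = \<phi> c \<odot>\<^bsub>A\<^esub> e x"
    "\<And>x. x \<in> carrier B \<Longrightarrow> e (s1 x) = s (e x)"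
    "inj_on e (carrier B)"
  using assms ring_hom_closed[of e B "restrict_scalars \<phi> A"] ring_hom_mult[of e B "restrict_scalars \<phi> A"]
    ring_hom_add[of e B "restrict_scalars \<phi> A"] ring_hom_one[of e B "restrict_scalars \<phi> A"]
  by (auto simp: inv_alg_embedding_def inv_alg_hom_def alg_hom_def restrict_scalars_def)

lemma (in abelian_group) add_minus_cancel_left:
  "\<lbrakk>x \<in> carrier G; y \<in> carrier G\<rbrakk> \<Longrightarrow> x \<oplus> y \<oplus> \<ominus> x = y"
  by (simp add: a_comm[of x y] a_assoc r_neg)

context assoc_algebra
begin

text \<open>The hypotheses compare entries in \<open>\<gamma> x = x' \<gamma>\<close>, where \<open>\<gamma>\<close> has rows \<open>g1, g2\<close> and
  \<open>g3, g4\<close>. The matrix \<open>x\<close> is upper unipotent in \<open>u1, u2\<close> and lower unipotent in \<open>l1, l2\<close>, and \<open>x'\<close> has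
  entries in \<open>L\<close>. If \<open>q\<close> is nonzero then \<open>u1\<close> expresses \<open>g3\<close> by \<open>g1\<close>. If \<open>q\<close> is zero then \<open>g1 = 0\<close>: by
  \<open>u1\<close> when \<open>p \<noteq> 1\<close>, and by \<open>u2\<close> when \<open>p = 1\<close>. So the first column is proportional over \<open>L\<close> to a single element, and
  \<open>l1, l2\<close> express the second column by the first.\<close>

lemma proportional_entries:
  assumes L: "subfield L F"
    and g: "g1 \<in> carrier A" "g2 \<in> carrier A" "g3 \<in> carrier A" "g4 \<in> carrier A"
    and P: "p \<in> L" "q \<in> L" and P': "p' \<in> L" "q' \<in> L" "r' \<in> L" "t' \<in> L"
    and u1: "g1 = p \<odot>\<^bsub>A\<^esub> g1 \<oplus>\<^bsub>A\<^esub> q \<odot>\<^bsub>A\<^esub> g3" and u2: "g1 \<oplus>\<^bsub>A\<^esub> g2 = p \<odot>\<^bsub>A\<^esub> g2 \<oplus>\<^bsub>A\<^esub> q \<odot>\<^bsub>A\<^esub> g4"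
    and l1: "g1 \<oplus>\<^bsub>A\<^esub> g2 = p' \<odot>\<^bsub>A\<^esub> g1 \<oplus>\<^bsub>A\<^esub> q' \<odot>\<^bsub>A\<^esub> g3" and l2: "g3 \<oplus>\<^bsub>A\<^esub> g4 = r' \<odot>\<^bsub>A\<^esub> g1 \<oplus>\<^bsub>A\<^esub> t' \<odot>\<^bsub>A\<^esub> g3"
  shows "\<exists>z c1 c2 c3 c4. z \<in> carrier A \<and> c1 \<in> L \<and> c2 \<in> L \<and> c3 \<in> L \<and> c4 \<in> L \<and>
    g1 = c1 \<odot>\<^bsub>A\<^esub> z \<and> g2 = c2 \<odot>\<^bsub>A\<^esub> z \<and> g3 = c3 \<odot>\<^bsub>A\<^esub> z \<and> g4 = c4 \<odot>\<^bsub>A\<^esub> z"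
proof -
  note Ls = subringE[OF subfieldE(1)[OF L]]
  have LF: "x \<in> carrier F" if "x \<in> L" for x using Ls(1) that by blast
  have "\<exists>z c1 c3. z \<in> carrier A \<and> c1 \<in> L \<and> c3 \<in> L \<and> g1 = c1 \<odot>\<^bsub>A\<^esub> z \<and> g3 = c3 \<odot>\<^bsub>A\<^esub> z"
  proof (cases "q = \<zero>")
    case True
    have "g1 = \<zero>\<^bsub>A\<^esub>"
    proof (cases "p = \<one>")
      case True
      thus ?thesis using u2 \<open>q = \<zero>\<close> g M.add.l_cancel_one[of g2 g1] by (simp add: M.a_comm)
    next
      case False
      have "(\<one> \<ominus> p) \<odot>\<^bsub>A\<^esub> g1 = g1 \<oplus>\<^bsub>A\<^esub> \<ominus>\<^bsub>A\<^esub> (p \<odot>\<^bsub>A\<^esub> g1)"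
        using g LF[OF P(1)] by (simp add: F.minus_eq smult_l_distr smult_l_minus)
      also have "... = \<zero>\<^bsub>A\<^esub>" using u1 True g LF[OF P(1)] by (simp add: M.r_neg)
      finally show ?thesis using smult_eq_zero[of "\<one> \<ominus> p" g1] False g LF[OF P(1)] by auto
    qed
    thus ?thesis using g Ls by (intro exI[of _ g3] exI[of _ \<zero>] exI[of _ \<one>]) auto
  next
    case False
    have q: "inv q \<in> L" "inv q \<otimes> q = \<one>" using F.subfield_m_inv[OF L, of q] False P by auto
    have "q \<odot>\<^bsub>A\<^esub> g3 = (\<one> \<ominus> p) \<odot>\<^bsub>A\<^esub> g1"
    proof -
      have "(\<one> \<ominus> p) \<odot>\<^bsub>A\<^esub> g1 = g1 \<oplus>\<^bsub>A\<^esub> \<ominus>\<^bsub>A\<^esub> (p \<odot>\<^bsub>A\<^esub> g1)"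
        using g LF[OF P(1)] by (simp add: F.minus_eq smult_l_distr smult_l_minus)
      also have "... = (p \<odot>\<^bsub>A\<^esub> g1 \<oplus>\<^bsub>A\<^esub> q \<odot>\<^bsub>A\<^esub> g3) \<oplus>\<^bsub>A\<^esub> \<ominus>\<^bsub>A\<^esub> (p \<odot>\<^bsub>A\<^esub> g1)" using u1 by simp
      also have "... = q \<odot>\<^bsub>A\<^esub> g3"
        using g LF[OF P(1)] LF[OF P(2)] by (simp only: M.add_minus_cancel_left smult_closed)
      finally show ?thesis by simp
    qed
    hence "(inv q \<otimes> q) \<odot>\<^bsub>A\<^esub> g3 = inv q \<odot>\<^bsub>A\<^esub> ((\<one> \<ominus> p) \<odot>\<^bsub>A\<^esub> g1)"
      using smult_assoc1[of "inv q" q g3] LF[OF q(1)] LF[OF P(2)] g by simp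
    hence "g3 = (inv q \<otimes> (\<one> \<ominus> p)) \<odot>\<^bsub>A\<^esub> g1"
      using g LF[OF q(1)] LF[OF P(1)] by (simp add: q(2) smult_assoc1)
    moreover have "inv q \<otimes> (\<one> \<ominus> p) \<in> L" using q P Ls by (simp add: F.minus_eq)
    ultimately show ?thesis using g Ls by (intro exI[of _ g1] exI[of _ \<one>] exI[of _ "inv q \<otimes> (\<one> \<ominus> p)"]) auto
  qed
  then obtain z c1 c3 where z: "z \<in> carrier A" and c: "c1 \<in> L" "c3 \<in> L" "g1 = c1 \<odot>\<^bsub>A\<^esub> z" "g3 = c3 \<odot>\<^bsub>A\<^esub> z"
    by blast
  have cancel: "y = (u \<otimes> c1 \<oplus> v \<otimes> c3 \<ominus> w) \<odot>\<^bsub>A\<^esub> z"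
    if "w \<odot>\<^bsub>A\<^esub> z \<oplus>\<^bsub>A\<^esub> y = u \<odot>\<^bsub>A\<^esub> g1 \<oplus>\<^bsub>A\<^esub> v \<odot>\<^bsub>A\<^esub> g3" "u \<in> L" "v \<in> L" "w \<in> L" "y \<in> carrier A" for u v w y
  proof -
    have F: "u \<in> carrier F" "v \<in> carrier F" "w \<in> carrier F" "c1 \<in> carrier F" "c3 \<in> carrier F"
      using that c LF by auto
    have "(u \<otimes> c1 \<oplus> v \<otimes> c3 \<ominus> w) \<odot>\<^bsub>A\<^esub> z = (u \<odot>\<^bsub>A\<^esub> g1 \<oplus>\<^bsub>A\<^esub> v \<odot>\<^bsub>A\<^esub> g3) \<oplus>\<^bsub>A\<^esub> \<ominus>\<^bsub>A\<^esub> (w \<odot>\<^bsub>A\<^esub> z)"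
      using F z c(3,4) by (simp add: F.minus_eq smult_l_distr smult_l_minus smult_assoc1)
    also have "... = (w \<odot>\<^bsub>A\<^esub> z \<oplus>\<^bsub>A\<^esub> y) \<oplus>\<^bsub>A\<^esub> \<ominus>\<^bsub>A\<^esub> (w \<odot>\<^bsub>A\<^esub> z)" using that(1) by simp
    also have "... = y" using F z that(5) by (simp only: M.add_minus_cancel_left smult_closed)
    finally show ?thesis by simp
  qed
  have "g2 = (p' \<otimes> c1 \<oplus> q' \<otimes> c3 \<ominus> c1) \<odot>\<^bsub>A\<^esub> z" using cancel[of c1 g2 p' q'] l1 P' c g by simp
  moreover have "g4 = (r' \<otimes> c1 \<oplus> t' \<otimes> c3 \<ominus> c3) \<odot>\<^bsub>A\<^esub> z" using cancel[of c3 g4 r' t'] l2 P' c g by simp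
  moreover have "p' \<otimes> c1 \<oplus> q' \<otimes> c3 \<ominus> c1 \<in> L" "r' \<otimes> c1 \<oplus> t' \<otimes> c3 \<ominus> c3 \<in> L"
    using P' c Ls(5-7) by (simp_all add: F.minus_eq)
  ultimately show ?thesis using z c by blast
qed

text \<open>An entry in the second column of \<open>\<gamma> x = y \<gamma>\<close> for \<open>\<gamma> = z g\<close> and the unipotent matrix \<open>x\<close> with upper right
  entry \<open>h\<close>, multiplied by \<open>z\<^sup>-\<^sup>1\<close> from the right.\<close>

lemma conjugate_from_column:
  assumes "z \<in> carrier A" "zi \<in> carrier A" "z \<otimes>\<^bsub>A\<^esub> zi = \<one>\<^bsub>A\<^esub>" "h \<in> carrier A" "p \<in> carrier A" "q \<in> carrier A"
    and "c \<in> carrier F" "d \<in> carrier F" "c2 \<in> carrier F" "c4 \<in> carrier F"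
    and e: "(c \<odot>\<^bsub>A\<^esub> z) \<otimes>\<^bsub>A\<^esub> h \<oplus>\<^bsub>A\<^esub> d \<odot>\<^bsub>A\<^esub> z = p \<otimes>\<^bsub>A\<^esub> (c2 \<odot>\<^bsub>A\<^esub> z) \<oplus>\<^bsub>A\<^esub> q \<otimes>\<^bsub>A\<^esub> (c4 \<odot>\<^bsub>A\<^esub> z)"
  shows "c \<odot>\<^bsub>A\<^esub> (z \<otimes>\<^bsub>A\<^esub> h \<otimes>\<^bsub>A\<^esub> zi) = c2 \<odot>\<^bsub>A\<^esub> p \<oplus>\<^bsub>A\<^esub> c4 \<odot>\<^bsub>A\<^esub> q \<oplus>\<^bsub>A\<^esub> (\<ominus> d) \<odot>\<^bsub>A\<^esub> \<one>\<^bsub>A\<^esub>"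
proof -
  have "c \<odot>\<^bsub>A\<^esub> (z \<otimes>\<^bsub>A\<^esub> h \<otimes>\<^bsub>A\<^esub> zi) \<oplus>\<^bsub>A\<^esub> d \<odot>\<^bsub>A\<^esub> \<one>\<^bsub>A\<^esub> = ((c \<odot>\<^bsub>A\<^esub> z) \<otimes>\<^bsub>A\<^esub> h \<oplus>\<^bsub>A\<^esub> d \<odot>\<^bsub>A\<^esub> z) \<otimes>\<^bsub>A\<^esub> zi"
    using assms(1-10) by (simp add: A.l_distr smult_mult_left)
  also have "... = c2 \<odot>\<^bsub>A\<^esub> p \<oplus>\<^bsub>A\<^esub> c4 \<odot>\<^bsub>A\<^esub> q"
    unfolding e using assms(1-10) by (simp add: A.l_distr smult_mult_left smult_mult_right A.m_assoc)
  finally have "c \<odot>\<^bsub>A\<^esub> (z \<otimes>\<^bsub>A\<^esub> h \<otimes>\<^bsub>A\<^esub> zi) \<oplus>\<^bsub>A\<^esub> d \<odot>\<^bsub>A\<^esub> \<one>\<^bsub>A\<^esub> \<oplus>\<^bsub>A\<^esub> (\<ominus> d) \<odot>\<^bsub>A\<^esub> \<one>\<^bsub>A\<^esub> =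
      c2 \<odot>\<^bsub>A\<^esub> p \<oplus>\<^bsub>A\<^esub> c4 \<odot>\<^bsub>A\<^esub> q \<oplus>\<^bsub>A\<^esub> (\<ominus> d) \<odot>\<^bsub>A\<^esub> \<one>\<^bsub>A\<^esub>" by simp
  thus ?thesis using assms(1-10) by (simp add: M.a_assoc smult_l_minus M.r_neg)
qed

end

context quaternion
begin

lemma conj_set_commutes:
  assumes s: "alg_involution F A s" and g: "g \<in> carrier (SL_inv A s)"
    and x: "x \<in> S" "x \<in> carrier (mat2_ring A)" and eq: "conj_set (SL_inv A s) g S = T"
  shows "\<exists>y\<in>T. mat2_mult A g x = mat2_mult A y g"
proof -
  interpret MR: ring "mat2_ring A" by (rule A.ring_mat2_ring)
  obtain p q r t where g': "g = Mat2 p q r t" by (cases g)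
  let ?h = "m_inv (SL_inv A s) g"
  have inv: "?h \<otimes>\<^bsub>mat2_ring A\<^esub> g = \<one>\<^bsub>mat2_ring A\<^esub>" "?h \<in> carrier (mat2_ring A)"
    using SL_inv_inverse[OF s g[unfolded g']] involution_facts(1)[OF s] g[unfolded g' SL_inv_carrier]
    by (simp_all add: g' mult_mat2_ring del: mat2_ring_simps(2) mat2_mult.simps)
  have gc: "g \<in> carrier (mat2_ring A)" using g SL_inv_subset by blast
  let ?y = "(g \<otimes>\<^bsub>mat2_ring A\<^esub> x) \<otimes>\<^bsub>mat2_ring A\<^esub> ?h"
  have "?y \<in> T" using eq x(1) by (auto simp: conj_set_def mult_mat2_ring)
  moreover have "?y \<otimes>\<^bsub>mat2_ring A\<^esub> g = g \<otimes>\<^bsub>mat2_ring A\<^esub> x"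
    using inv gc x(2) by (simp only: MR.m_assoc MR.m_closed MR.r_one)
  ultimately show ?thesis by (intro bexI[of _ ?y]) (simp_all add: mult_mat2_ring)
qed

text \<open>Conjugating the unipotent matrix with upper right entry \<open>e1 h\<close> by \<open>\<gamma>\<close> gives a matrix over the
  image \<open>B\<close> of \<open>H2\<close>, and \<open>z e1(h) z\<^sup>-\<^sup>1\<close> is a linear combination of its entries and \<open>1\<close>. The coefficients are in the image
  \<open>L\<close> of the base field, and not merely in \<open>F\<close>, because \<open>\<gamma>\<close> normalises \<open>SL(2, K)\<close>; so the combination
  stays in \<open>B\<close>.\<close>

lemma conjugate_imp_iso:
  assumes K: "field K" and \<phi>: "\<phi> \<in> ring_hom K F"
    and Q1: "quaternion K H1 i1 j1 a1 b1"
    and s1: "alg_involution K H1 s1" "s1 i1 = i1" "s1 j1 = j1"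
    and Q2: "quaternion K H2 i2 j2 a2 b2" and s2: "alg_involution K H2 s2"
    and s: "alg_involution F A s"
    and conj: "conjugate_in K H1 s1 H2 s2 \<phi> A s"
  shows "\<exists>f. inv_alg_iso K H1 s1 H2 s2 f"
proof -
  interpret K: field K by (rule K)
  interpret H1: quaternion K H1 i1 j1 a1 b1 by (rule Q1)
  interpret H2: quaternion K H2 i2 j2 a2 b2 by (rule Q2)
  interpret \<phi>: ring_hom_ring K F \<phi>
    using ring_hom_ringI2[OF K.ring_axioms F.ring_axioms \<phi>] .
  note s' = involution_facts[OF s]
  define L where "L = \<phi> ` carrier K"
  have L: "subfield L F"
    unfolding L_def using \<phi>.img_is_subfield(2)[OF K.carrier_is_subfield] by simp
  note Ls = subringE[OF subfieldE(1)[OF L]]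
  have LF: "c \<in> carrier F" if "c \<in> L" for c using Ls(1) that by blast
  obtain e1 e2 g where emb: "inv_alg_embedding K H1 s1 (restrict_scalars \<phi> A) s e1"
      "inv_alg_embedding K H2 s2 (restrict_scalars \<phi> A) s e2"
    and g: "g \<in> carrier (SL_inv A s)"
    and c1: "conj_set (SL_inv A s) g (map_mat2 e1 ` carrier (SL_inv H1 s1)) =
       map_mat2 e2 ` carrier (SL_inv H2 s2)"
    and c2: "conj_set (SL_inv A s) g (map_mat2 (\<lambda>c. \<phi> c \<odot>\<^bsub>A\<^esub> \<one>\<^bsub>A\<^esub>) ` SL2 K) =
       map_mat2 (\<lambda>c. \<phi> c \<odot>\<^bsub>A\<^esub> \<one>\<^bsub>A\<^esub>) ` SL2 K"
    using conj unfolding conjugate_in_def by (elim exE conjE) (rule that)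
  note e1 = inv_alg_embedding_restrict_scalarsD[OF emb(1)] and e2 = inv_alg_embedding_restrict_scalarsD[OF emb(2)]
  obtain g1 g2 g3 g4 where g': "g = Mat2 g1 g2 g3 g4" by (cases g)
  have gc: "g1 \<in> carrier A" "g2 \<in> carrier A" "g3 \<in> carrier A" "g4 \<in> carrier A"
    and det: "g1 \<otimes>\<^bsub>A\<^esub> s g4 \<ominus>\<^bsub>A\<^esub> g2 \<otimes>\<^bsub>A\<^esub> s g3 = \<one>\<^bsub>A\<^esub>"
    using g[unfolded g' SL_inv_carrier] by auto
  have det': "s g4 \<otimes>\<^bsub>A\<^esub> g1 \<oplus>\<^bsub>A\<^esub> \<ominus>\<^bsub>A\<^esub> (s g2) \<otimes>\<^bsub>A\<^esub> g3 = \<one>\<^bsub>A\<^esub>"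
    using SL_inv_inverse(3)[OF s g[unfolded g']] by simp
  have one: "\<phi> \<one>\<^bsub>K\<^esub> \<odot>\<^bsub>A\<^esub> \<one>\<^bsub>A\<^esub> = \<one>\<^bsub>A\<^esub>" and zero: "\<phi> \<zero>\<^bsub>K\<^esub> \<odot>\<^bsub>A\<^esub> \<one>\<^bsub>A\<^esub> = \<zero>\<^bsub>A\<^esub>" by simp_all
  have SL2: "\<exists>p q r t. p \<in> L \<and> q \<in> L \<and> r \<in> L \<and> t \<in> L \<and>
      mat2_mult A g (map_mat2 (\<lambda>c. \<phi> c \<odot>\<^bsub>A\<^esub> \<one>\<^bsub>A\<^esub>) x) =
      mat2_mult A (Mat2 (p \<odot>\<^bsub>A\<^esub> \<one>\<^bsub>A\<^esub>) (q \<odot>\<^bsub>A\<^esub> \<one>\<^bsub>A\<^esub>) (r \<odot>\<^bsub>A\<^esub> \<one>\<^bsub>A\<^esub>) (t \<odot>\<^bsub>A\<^esub> \<one>\<^bsub>A\<^esub>)) g"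
    if x: "x \<in> SL2 K" for x
  proof -
    have "map_mat2 (\<lambda>c. \<phi> c \<odot>\<^bsub>A\<^esub> \<one>\<^bsub>A\<^esub>) x \<in> carrier (mat2_ring A)"
      using x by (auto simp: SL2_def)
    then obtain y where y: "y \<in> SL2 K"
      "mat2_mult A g (map_mat2 (\<lambda>c. \<phi> c \<odot>\<^bsub>A\<^esub> \<one>\<^bsub>A\<^esub>) x) = mat2_mult A (map_mat2 (\<lambda>c. \<phi> c \<odot>\<^bsub>A\<^esub> \<one>\<^bsub>A\<^esub>) y) g"
      using conj_set_commutes[OF s g _ _ c2] x by blast
    obtain p q r t where "y = Mat2 p q r t" "p \<in> carrier K" "q \<in> carrier K" "r \<in> carrier K" "t \<in> carrier K"
      using y(1) by (auto simp: SL2_def)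
    thus ?thesis using y(2)
      by (intro exI[of _ "\<phi> p"] exI[of _ "\<phi> q"] exI[of _ "\<phi> r"] exI[of _ "\<phi> t"]) (simp add: L_def)
  qed
  have U: "Mat2 \<one>\<^bsub>K\<^esub> \<one>\<^bsub>K\<^esub> \<zero>\<^bsub>K\<^esub> \<one>\<^bsub>K\<^esub> \<in> SL2 K" and V: "Mat2 \<one>\<^bsub>K\<^esub> \<zero>\<^bsub>K\<^esub> \<one>\<^bsub>K\<^esub> \<one>\<^bsub>K\<^esub> \<in> SL2 K"
    by (simp_all add: SL2_def K.minus_eq)
  obtain p q r t where P: "p \<in> L" "q \<in> L" "r \<in> L" "t \<in> L"
    and u: "mat2_mult A g (map_mat2 (\<lambda>c. \<phi> c \<odot>\<^bsub>A\<^esub> \<one>\<^bsub>A\<^esub>) (Mat2 \<one>\<^bsub>K\<^esub> \<one>\<^bsub>K\<^esub> \<zero>\<^bsub>K\<^esub> \<one>\<^bsub>K\<^esub>)) =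
      mat2_mult A (Mat2 (p \<odot>\<^bsub>A\<^esub> \<one>\<^bsub>A\<^esub>) (q \<odot>\<^bsub>A\<^esub> \<one>\<^bsub>A\<^esub>) (r \<odot>\<^bsub>A\<^esub> \<one>\<^bsub>A\<^esub>) (t \<odot>\<^bsub>A\<^esub> \<one>\<^bsub>A\<^esub>)) g"
    using SL2[OF U] by (elim exE conjE) (rule that)
  obtain p' q' r' t' where P': "p' \<in> L" "q' \<in> L" "r' \<in> L" "t' \<in> L"
    and l: "mat2_mult A g (map_mat2 (\<lambda>c. \<phi> c \<odot>\<^bsub>A\<^esub> \<one>\<^bsub>A\<^esub>) (Mat2 \<one>\<^bsub>K\<^esub> \<zero>\<^bsub>K\<^esub> \<one>\<^bsub>K\<^esub> \<one>\<^bsub>K\<^esub>)) =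
      mat2_mult A (Mat2 (p' \<odot>\<^bsub>A\<^esub> \<one>\<^bsub>A\<^esub>) (q' \<odot>\<^bsub>A\<^esub> \<one>\<^bsub>A\<^esub>) (r' \<odot>\<^bsub>A\<^esub> \<one>\<^bsub>A\<^esub>) (t' \<odot>\<^bsub>A\<^esub> \<one>\<^bsub>A\<^esub>)) g"
    using SL2[OF V] by (elim exE conjE) (rule that)
  have u': "g1 = p \<odot>\<^bsub>A\<^esub> g1 \<oplus>\<^bsub>A\<^esub> q \<odot>\<^bsub>A\<^esub> g3" "g1 \<oplus>\<^bsub>A\<^esub> g2 = p \<odot>\<^bsub>A\<^esub> g2 \<oplus>\<^bsub>A\<^esub> q \<odot>\<^bsub>A\<^esub> g4"
    using u gc LF[OF P(1)] LF[OF P(2)] LF[OF P(3)] LF[OF P(4)]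
    by (simp_all add: g' smult_mult_left)
  have l': "g1 \<oplus>\<^bsub>A\<^esub> g2 = p' \<odot>\<^bsub>A\<^esub> g1 \<oplus>\<^bsub>A\<^esub> q' \<odot>\<^bsub>A\<^esub> g3" "g3 \<oplus>\<^bsub>A\<^esub> g4 = r' \<odot>\<^bsub>A\<^esub> g1 \<oplus>\<^bsub>A\<^esub> t' \<odot>\<^bsub>A\<^esub> g3"
    using l gc LF[OF P'(1)] LF[OF P'(2)] LF[OF P'(3)] LF[OF P'(4)]
    by (simp_all add: g' smult_mult_left)
  obtain z d1 d2 d3 d4 where z: "z \<in> carrier A" and d: "d1 \<in> L" "d2 \<in> L" "d3 \<in> L" "d4 \<in> L"
    and gz: "g1 = d1 \<odot>\<^bsub>A\<^esub> z" "g2 = d2 \<odot>\<^bsub>A\<^esub> z" "g3 = d3 \<odot>\<^bsub>A\<^esub> z" "g4 = d4 \<odot>\<^bsub>A\<^esub> z"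
    using proportional_entries[OF L gc P(1,2) P' u' l'] by blast
  have dF: "d1 \<in> carrier F" "d2 \<in> carrier F" "d3 \<in> carrier F" "d4 \<in> carrier F" using d LF by auto
  have szA: "s z \<in> carrier A" using s'(1) z .
  \<comment> \<open>\<open>D\<close> is the determinant of the matrix \<open>g\<close> of coefficients in \<open>\<gamma> = z g\<close>.\<close>
  define D where "D = d1 \<otimes> d4 \<ominus> d2 \<otimes> d3"
  have DF: "D \<in> carrier F" using dF by (simp add: D_def)
  define zi where "zi = D \<odot>\<^bsub>A\<^esub> s z"
  have zi: "zi \<in> carrier A" using DF szA by (simp add: zi_def)
  have zzi: "z \<otimes>\<^bsub>A\<^esub> zi = \<one>\<^bsub>A\<^esub>"
  proof -
    have "z \<otimes>\<^bsub>A\<^esub> zi = D \<odot>\<^bsub>A\<^esub> (z \<otimes>\<^bsub>A\<^esub> s z)" using DF szA z by (simp add: zi_def smult_mult_right)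
    also have "... = g1 \<otimes>\<^bsub>A\<^esub> s g4 \<ominus>\<^bsub>A\<^esub> g2 \<otimes>\<^bsub>A\<^esub> s g3"
      using dF z szA by (simp add: gz s'(3) smult_mult_left smult_mult_right D_def F.minus_eq
        M.minus_eq smult_l_distr smult_l_minus smult_assoc1 smult_lcomm[of d1 d4] smult_lcomm[of d2 d3])
    finally show ?thesis using det by simp
  qed
  have ziz: "zi \<otimes>\<^bsub>A\<^esub> z = \<one>\<^bsub>A\<^esub>"
  proof -
    have "zi \<otimes>\<^bsub>A\<^esub> z = D \<odot>\<^bsub>A\<^esub> (s z \<otimes>\<^bsub>A\<^esub> z)" using DF szA z by (simp add: zi_def smult_mult_left)
    also have "... = s g4 \<otimes>\<^bsub>A\<^esub> g1 \<oplus>\<^bsub>A\<^esub> \<ominus>\<^bsub>A\<^esub> (s g2) \<otimes>\<^bsub>A\<^esub> g3"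
      using dF z szA by (simp add: gz s'(3) smult_mult_left smult_mult_right D_def F.minus_eq
        A.l_minus smult_l_distr smult_l_minus smult_r_minus smult_assoc1 smult_lcomm[of d1 d4]
        smult_lcomm[of d2 d3])
    finally show ?thesis using det' by simp
  qed
  have d13: "d1 \<noteq> \<zero> \<or> d3 \<noteq> \<zero>"
  proof (rule ccontr)
    assume "\<not> (d1 \<noteq> \<zero> \<or> d3 \<noteq> \<zero>)"
    hence "D = \<zero>" using dF by (simp add: D_def F.minus_eq)
    hence "zi = \<zero>\<^bsub>A\<^esub>" using szA by (simp add: zi_def)
    thus False using zzi z nontrivial by simp
  qed
  define B where "B = e2 ` carrier H2"
  have BA: "x \<in> carrier A" if "x \<in> B" for x using that e2(1) by (auto simp: B_def)
  have B_add: "x \<oplus>\<^bsub>A\<^esub> y \<in> B" if "x \<in> B" "y \<in> B" for x y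
    using that e2(3) unfolding B_def by (metis (no_types, opaque_lifting) H2.M.add.m_closed image_iff)
  have B_smult: "c \<odot>\<^bsub>A\<^esub> x \<in> B" if "c \<in> L" "x \<in> B" for c x
    using that e2(5) unfolding B_def L_def by (metis (no_types, opaque_lifting) H2.smult_closed image_iff)
  have B_one: "\<one>\<^bsub>A\<^esub> \<in> B" unfolding B_def using e2(4) by (metis H2.A.one_closed image_iff)
  have B_div: "x \<in> B" if "c \<in> L" "c \<noteq> \<zero>" "x \<in> carrier A" "c \<odot>\<^bsub>A\<^esub> x \<in> B" for c x
  proof -
    have c: "inv c \<in> L" "inv c \<otimes> c = \<one>" using F.subfield_m_inv[OF L, of c] that by auto
    have "inv c \<odot>\<^bsub>A\<^esub> (c \<odot>\<^bsub>A\<^esub> x) \<in> B" using B_smult c that by blast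
    thus ?thesis using c LF[OF c(1)] LF[OF that(1)] that(3) by (simp add: smult_assoc1[symmetric])
  qed
  \<comment> \<open>The first column of \<open>g\<close> is nonzero, so one of the two rows of the matrix equation can be solved.\<close>
  have conj_B: "z \<otimes>\<^bsub>A\<^esub> e1 h \<otimes>\<^bsub>A\<^esub> zi \<in> B" if h: "h \<in> carrier H1" "s1 h = h" for h
  proof -
    let ?x = "map_mat2 e1 (Mat2 \<one>\<^bsub>H1\<^esub> h \<zero>\<^bsub>H1\<^esub> \<one>\<^bsub>H1\<^esub>)"
    have e1z: "e1 \<zero>\<^bsub>H1\<^esub> = \<zero>\<^bsub>A\<^esub>" using e1(5)[of "\<zero>\<^bsub>K\<^esub>" "\<one>\<^bsub>H1\<^esub>"] e1(1) by simp
    have "Mat2 \<one>\<^bsub>H1\<^esub> h \<zero>\<^bsub>H1\<^esub> \<one>\<^bsub>H1\<^esub> \<in> carrier (SL_inv H1 s1)"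
      using h H1.involution_facts[OF s1(1)] by (simp add: SL_inv_carrier fixed_set_def H1.M.minus_eq)
    moreover have "?x \<in> carrier (mat2_ring A)" using h e1(1) by simp
    ultimately obtain y where y: "y \<in> carrier (SL_inv H2 s2)"
      "mat2_mult A g ?x = mat2_mult A (map_mat2 e2 y) g"
      using conj_set_commutes[OF s g _ _ c1] by blast
    obtain p q r t where y': "y = Mat2 p q r t" by (cases y)
    have c: "e2 p \<in> B" "e2 q \<in> B" "e2 r \<in> B" "e2 t \<in> B"
      using y(1) unfolding y' SL_inv_carrier B_def by auto
    have "g1 \<otimes>\<^bsub>A\<^esub> e1 h \<oplus>\<^bsub>A\<^esub> g2 = e2 p \<otimes>\<^bsub>A\<^esub> g2 \<oplus>\<^bsub>A\<^esub> e2 q \<otimes>\<^bsub>A\<^esub> g4"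
      "g3 \<otimes>\<^bsub>A\<^esub> e1 h \<oplus>\<^bsub>A\<^esub> g4 = e2 r \<otimes>\<^bsub>A\<^esub> g2 \<oplus>\<^bsub>A\<^esub> e2 t \<otimes>\<^bsub>A\<^esub> g4"
      using y(2) gc e1(1)[OF h(1)] by (simp_all add: g' y' e1(4))
    hence cols: "(d1 \<odot>\<^bsub>A\<^esub> z) \<otimes>\<^bsub>A\<^esub> e1 h \<oplus>\<^bsub>A\<^esub> d2 \<odot>\<^bsub>A\<^esub> z = e2 p \<otimes>\<^bsub>A\<^esub> (d2 \<odot>\<^bsub>A\<^esub> z) \<oplus>\<^bsub>A\<^esub> e2 q \<otimes>\<^bsub>A\<^esub> (d4 \<odot>\<^bsub>A\<^esub> z)"
      "(d3 \<odot>\<^bsub>A\<^esub> z) \<otimes>\<^bsub>A\<^esub> e1 h \<oplus>\<^bsub>A\<^esub> d4 \<odot>\<^bsub>A\<^esub> z = e2 r \<otimes>\<^bsub>A\<^esub> (d2 \<odot>\<^bsub>A\<^esub> z) \<oplus>\<^bsub>A\<^esub> e2 t \<otimes>\<^bsub>A\<^esub> (d4 \<odot>\<^bsub>A\<^esub> z)"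
      by (simp_all only: gz)
    have eqs: "d1 \<odot>\<^bsub>A\<^esub> (z \<otimes>\<^bsub>A\<^esub> e1 h \<otimes>\<^bsub>A\<^esub> zi) = d2 \<odot>\<^bsub>A\<^esub> e2 p \<oplus>\<^bsub>A\<^esub> d4 \<odot>\<^bsub>A\<^esub> e2 q \<oplus>\<^bsub>A\<^esub> (\<ominus> d2) \<odot>\<^bsub>A\<^esub> \<one>\<^bsub>A\<^esub>"
      "d3 \<odot>\<^bsub>A\<^esub> (z \<otimes>\<^bsub>A\<^esub> e1 h \<otimes>\<^bsub>A\<^esub> zi) = d2 \<odot>\<^bsub>A\<^esub> e2 r \<oplus>\<^bsub>A\<^esub> d4 \<odot>\<^bsub>A\<^esub> e2 t \<oplus>\<^bsub>A\<^esub> (\<ominus> d4) \<odot>\<^bsub>A\<^esub> \<one>\<^bsub>A\<^esub>"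
      by (rule conjugate_from_column[OF z zi zzi e1(1)[OF h(1)] BA[OF c(1)] BA[OF c(2)] dF(1,2,2,4) cols(1)])
        (rule conjugate_from_column[OF z zi zzi e1(1)[OF h(1)] BA[OF c(3)] BA[OF c(4)] dF(3,4,2,4) cols(2)])
    have mem: "d1 \<odot>\<^bsub>A\<^esub> (z \<otimes>\<^bsub>A\<^esub> e1 h \<otimes>\<^bsub>A\<^esub> zi) \<in> B" "d3 \<odot>\<^bsub>A\<^esub> (z \<otimes>\<^bsub>A\<^esub> e1 h \<otimes>\<^bsub>A\<^esub> zi) \<in> B"
      unfolding eqs using d c B_one Ls(5) by (auto intro!: B_add B_smult)
    have zhzi: "z \<otimes>\<^bsub>A\<^esub> e1 h \<otimes>\<^bsub>A\<^esub> zi \<in> carrier A" using z zi e1(1)[OF h(1)] by simp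
    show ?thesis using d13 B_div[OF d(1) _ zhzi mem(1)] B_div[OF d(3) _ zhzi mem(2)] by blast
  qed
  have ce: "(z \<otimes>\<^bsub>A\<^esub> x \<otimes>\<^bsub>A\<^esub> zi) \<otimes>\<^bsub>A\<^esub> (z \<otimes>\<^bsub>A\<^esub> y \<otimes>\<^bsub>A\<^esub> zi) = z \<otimes>\<^bsub>A\<^esub> (x \<otimes>\<^bsub>A\<^esub> y) \<otimes>\<^bsub>A\<^esub> zi"
    if "x \<in> carrier A" "y \<in> carrier A" for x y
  proof -
    have "(z \<otimes>\<^bsub>A\<^esub> x \<otimes>\<^bsub>A\<^esub> zi) \<otimes>\<^bsub>A\<^esub> (z \<otimes>\<^bsub>A\<^esub> y \<otimes>\<^bsub>A\<^esub> zi) = z \<otimes>\<^bsub>A\<^esub> x \<otimes>\<^bsub>A\<^esub> (zi \<otimes>\<^bsub>A\<^esub> z) \<otimes>\<^bsub>A\<^esub> y \<otimes>\<^bsub>A\<^esub> zi"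
      using that z zi by (simp only: A.m_assoc A.m_closed)
    also have "... = z \<otimes>\<^bsub>A\<^esub> (x \<otimes>\<^bsub>A\<^esub> y) \<otimes>\<^bsub>A\<^esub> zi" using that z zi by (simp only: ziz A.r_one A.m_assoc A.m_closed)
    finally show ?thesis .
  qed
  have ct: "z \<otimes>\<^bsub>A\<^esub> (c \<odot>\<^bsub>A\<^esub> \<one>\<^bsub>A\<^esub>) \<otimes>\<^bsub>A\<^esub> zi = c \<odot>\<^bsub>A\<^esub> \<one>\<^bsub>A\<^esub>" if "c \<in> carrier F" for c
    using that z zi zzi by (simp add: smult_mult_left smult_mult_right)
  \<comment> \<open>Here it matters that \<open>zi\<close> is a scalar multiple of \<open>s z\<close>.\<close>
  have cs: "s (z \<otimes>\<^bsub>A\<^esub> x \<otimes>\<^bsub>A\<^esub> zi) = z \<otimes>\<^bsub>A\<^esub> s x \<otimes>\<^bsub>A\<^esub> zi" if "x \<in> carrier A" for x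
    using that z szA zi DF s'(1)
    by (simp add: zi_def s'(3,4,5) smult_mult_left smult_mult_right A.m_assoc)
  have i1: "i1 \<in> carrier H1" "e1 i1 \<in> carrier A" and j1: "j1 \<in> carrier H1" "e1 j1 \<in> carrier A" using e1(1) by auto
  obtain k where k: "k \<in> carrier H2" "e2 k = z \<otimes>\<^bsub>A\<^esub> e1 i1 \<otimes>\<^bsub>A\<^esub> zi"
    using conj_B[OF i1(1) s1(2)] unfolding B_def by (elim imageE) (rule that, simp_all)
  obtain l where l: "l \<in> carrier H2" "e2 l = z \<otimes>\<^bsub>A\<^esub> e1 j1 \<otimes>\<^bsub>A\<^esub> zi"
    using conj_B[OF j1(1) s1(3)] unfolding B_def by (elim imageE) (rule that, simp_all)
  have e2I: "x = y" if "x \<in> carrier H2" "y \<in> carrier H2" "e2 x = e2 y" for x y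
    using inj_onD[OF e2(7)] that by blast
  have kk: "k \<otimes>\<^bsub>H2\<^esub> k = a1 \<odot>\<^bsub>H2\<^esub> \<one>\<^bsub>H2\<^esub>"
  proof (rule e2I)
    have "e1 i1 \<otimes>\<^bsub>A\<^esub> e1 i1 = \<phi> a1 \<odot>\<^bsub>A\<^esub> \<one>\<^bsub>A\<^esub>" using e1(2)[OF i1(1) i1(1)] by (simp add: H1.ii e1(4,5))
    thus "e2 (k \<otimes>\<^bsub>H2\<^esub> k) = e2 (a1 \<odot>\<^bsub>H2\<^esub> \<one>\<^bsub>H2\<^esub>)" using k i1 ct[of "\<phi> a1"] by (simp add: e2(2,4,5) ce)
  qed (use k in auto)
  have ll: "l \<otimes>\<^bsub>H2\<^esub> l = b1 \<odot>\<^bsub>H2\<^esub> \<one>\<^bsub>H2\<^esub>"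
  proof (rule e2I)
    have "e1 j1 \<otimes>\<^bsub>A\<^esub> e1 j1 = \<phi> b1 \<odot>\<^bsub>A\<^esub> \<one>\<^bsub>A\<^esub>" using e1(2)[OF j1(1) j1(1)] by (simp add: H1.jj e1(4,5))
    thus "e2 (l \<otimes>\<^bsub>H2\<^esub> l) = e2 (b1 \<odot>\<^bsub>H2\<^esub> \<one>\<^bsub>H2\<^esub>)" using l j1 ct[of "\<phi> b1"] by (simp add: e2(2,4,5) ce)
  qed (use l in auto)
  have lk: "l \<otimes>\<^bsub>H2\<^esub> k = \<ominus>\<^bsub>H2\<^esub> (k \<otimes>\<^bsub>H2\<^esub> l)"
  proof (rule e2I)
    have m1: "e1 (\<ominus>\<^bsub>H1\<^esub> x) = \<ominus>\<^bsub>A\<^esub> (e1 x)" if "x \<in> carrier H1" for x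
      using e1(5)[of "\<ominus>\<^bsub>K\<^esub> \<one>\<^bsub>K\<^esub>" x] e1(1)[OF that] that by (simp add: H1.smult_l_minus smult_l_minus)
    have m2: "e2 (\<ominus>\<^bsub>H2\<^esub> x) = \<ominus>\<^bsub>A\<^esub> (e2 x)" if "x \<in> carrier H2" for x
      using e2(5)[of "\<ominus>\<^bsub>K\<^esub> \<one>\<^bsub>K\<^esub>" x] e2(1)[OF that] that by (simp add: H2.smult_l_minus smult_l_minus)
    have "e2 (l \<otimes>\<^bsub>H2\<^esub> k) = z \<otimes>\<^bsub>A\<^esub> e1 (j1 \<otimes>\<^bsub>H1\<^esub> i1) \<otimes>\<^bsub>A\<^esub> zi"
      using k l i1 j1 by (simp add: e2(2) ce e1(2))
    also have "... = \<ominus>\<^bsub>A\<^esub> (z \<otimes>\<^bsub>A\<^esub> e1 (i1 \<otimes>\<^bsub>H1\<^esub> j1) \<otimes>\<^bsub>A\<^esub> zi)"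
      using z zi i1 j1 e1(1) by (simp add: H1.ji m1 A.r_minus A.l_minus)
    also have "... = e2 (\<ominus>\<^bsub>H2\<^esub> (k \<otimes>\<^bsub>H2\<^esub> l))"
      using k l i1 j1 by (simp add: m2 e2(2) ce e1(2))
    finally show "e2 (l \<otimes>\<^bsub>H2\<^esub> k) = e2 (\<ominus>\<^bsub>H2\<^esub> (k \<otimes>\<^bsub>H2\<^esub> l))" .
  qed (use k l in auto)
  have sk: "s2 k = k"
  proof (rule e2I)
    show "e2 (s2 k) = e2 k" using k e1(6)[OF i1(1)] s1(2) i1 by (simp add: e2(6) cs)
  qed (use k H2.involution_facts(1)[OF s2] in auto)
  have sl: "s2 l = l"
  proof (rule e2I)
    show "e2 (s2 l) = e2 l" using l e1(6)[OF j1(1)] s1(3) j1 by (simp add: e2(6) cs)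
  qed (use l H2.involution_facts(1)[OF s2] in auto)
  have "quat_units K H2 k l a1 b1"
    using k l kk ll lk H1.a_nonzero H1.b_nonzero H1.two_nonzero H2.nontrivial by unfold_locales auto
  hence "quaternion K H2 k l a1 b1"
    using H2.other_generators(1)[OF H2.basis] by (intro quaternion.intro quaternion_axioms.intro)
  thus ?thesis using H1.presentation_iso[OF s1 _ s2 sk sl] by blast
qed

end

section \<open>Adjoining square roots without enlarging the field\<close>

text \<open>Adjunction of a square root of \<open>c\<close>: the pair \<open>(x, y)\<close> stands for \<open>x + y \<surd>c\<close>.\<close>

definition quadratic_extension :: "('a, 'm) ring_scheme \<Rightarrow> 'a \<Rightarrow> ('a \<times> 'a) ring" where
  "quadratic_extension R c =
     \<lparr> carrier = carrier R \<times> carrier R,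
       monoid.mult = (\<lambda>(x, y) (x', y'). (x \<otimes>\<^bsub>R\<^esub> x' \<oplus>\<^bsub>R\<^esub> c \<otimes>\<^bsub>R\<^esub> (y \<otimes>\<^bsub>R\<^esub> y'), x \<otimes>\<^bsub>R\<^esub> y' \<oplus>\<^bsub>R\<^esub> y \<otimes>\<^bsub>R\<^esub> x')),
       one = (\<one>\<^bsub>R\<^esub>, \<zero>\<^bsub>R\<^esub>),
       ring.zero = (\<zero>\<^bsub>R\<^esub>, \<zero>\<^bsub>R\<^esub>),
       ring.add = (\<lambda>(x, y) (x', y'). (x \<oplus>\<^bsub>R\<^esub> x', y \<oplus>\<^bsub>R\<^esub> y')) \<rparr>"

text \<open>The norm \<open>x\<^sup>2 - c y\<^sup>2\<close> of a nonzero element is nonzero because \<open>c\<close> is not a square.\<close>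

lemma (in field) field_quadratic_extension:
  assumes c: "c \<in> carrier R" and nonsquare: "\<And>r. r \<in> carrier R \<Longrightarrow> r \<otimes> r \<noteq> c"
  shows "field (quadratic_extension R c)" (is "field ?E")
proof -
  have "abelian_group ?E"
  proof (rule abelian_groupI)
    fix x assume "x \<in> carrier ?E"
    thus "\<exists>y\<in>carrier ?E. y \<oplus>\<^bsub>?E\<^esub> x = \<zero>\<^bsub>?E\<^esub>"
      by (intro bexI[of _ "(\<ominus> fst x, \<ominus> snd x)"]) (auto simp: quadratic_extension_def l_neg)
  qed (auto simp: quadratic_extension_def a_ac)
  moreover have "comm_monoid ?E"
    by (rule comm_monoidI)
      (use c in \<open>auto simp: quadratic_extension_def l_distr r_distr m_assoc a_ac m_comm m_lcomm\<close>)
  moreover have "(x \<oplus>\<^bsub>?E\<^esub> y) \<otimes>\<^bsub>?E\<^esub> z = x \<otimes>\<^bsub>?E\<^esub> z \<oplus>\<^bsub>?E\<^esub> y \<otimes>\<^bsub>?E\<^esub> z"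
    if "x \<in> carrier ?E" "y \<in> carrier ?E" "z \<in> carrier ?E" for x y z
    using that c by (auto simp: quadratic_extension_def l_distr r_distr a_ac)
  ultimately have "cring ?E" by (rule cringI)
  then interpret E: cring ?E .
  show ?thesis
  proof (rule E.cring_fieldI2)
    show "\<zero>\<^bsub>?E\<^esub> \<noteq> \<one>\<^bsub>?E\<^esub>" by (simp add: quadratic_extension_def)
    fix u assume u: "u \<in> carrier ?E" "u \<noteq> \<zero>\<^bsub>?E\<^esub>"
    obtain x y where xy: "u = (x, y)" "x \<in> carrier R" "y \<in> carrier R" "x \<noteq> \<zero> \<or> y \<noteq> \<zero>"
      using u by (auto simp: quadratic_extension_def)
    define n where "n = x \<otimes> x \<ominus> c \<otimes> (y \<otimes> y)"
    have nR: "n \<in> carrier R" using xy c by (simp add: n_def)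
    have "n \<noteq> \<zero>"
    proof
      assume "n = \<zero>"
      hence e: "x \<otimes> x = c \<otimes> (y \<otimes> y)" using xy c by (simp add: n_def)
      show False
      proof (cases "y = \<zero>")
        case True
        thus False using e xy c integral by auto
      next
        case False
        hence y: "inv y \<in> carrier R" "y \<otimes> inv y = \<one>" using xy field_Units by auto
        have "(x \<otimes> inv y) \<otimes> (x \<otimes> inv y) = (x \<otimes> x) \<otimes> (inv y \<otimes> inv y)"
          using xy y by (simp add: m_ac)
        also have "... = c \<otimes> ((y \<otimes> inv y) \<otimes> (y \<otimes> inv y))"
          unfolding e using xy y(1) c by (simp add: m_ac)
        also have "... = c" using y c by simp
        finally show False using nonsquare[of "x \<otimes> inv y"] xy y by simp
      qed
    qed
    hence n: "inv n \<in> carrier R" "n \<otimes> inv n = \<one>" using nR field_Units by auto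
    show "\<exists>v\<in>carrier ?E. u \<otimes>\<^bsub>?E\<^esub> v = \<one>\<^bsub>?E\<^esub>"
    proof (rule bexI[of _ "(x \<otimes> inv n, \<ominus> (y \<otimes> inv n))"])
      have "x \<otimes> (x \<otimes> inv n) \<oplus> c \<otimes> (y \<otimes> (\<ominus> (y \<otimes> inv n))) = n \<otimes> inv n"
        using xy c n(1) by (simp add: n_def minus_eq l_distr r_minus l_minus m_assoc)
      moreover have "x \<otimes> (\<ominus> (y \<otimes> inv n)) \<oplus> y \<otimes> (x \<otimes> inv n) = \<zero>"
        using xy n(1) by (simp add: r_minus m_lcomm l_neg)
      ultimately show "u \<otimes>\<^bsub>?E\<^esub> (x \<otimes> inv n, \<ominus> (y \<otimes> inv n)) = \<one>\<^bsub>?E\<^esub>"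
        using xy n by (simp add: quadratic_extension_def)
    qed (use xy n in \<open>auto simp: quadratic_extension_def\<close>)
  qed
qed

lemma infinite_square_bij:
  assumes "infinite S"
  shows "\<exists>f. bij_betw f (S \<times> S) S"
  using card_of_Times_same_infinite[OF assms] card_of_ordIso by blast

text \<open>An infinite set is in bijection with its square, so the quadratic extension can be carried back to
  the set underlying the given field. Keeping that set fixed makes the construction repeatable in one type.\<close>

lemma adjoin_square_root:
  fixes R :: "'k ring"
  assumes R: "field R" and inf: "infinite (carrier R)" and c: "c \<in> carrier R"
  shows "\<exists>(E :: 'k ring) \<psi>. field E \<and> \<psi> \<in> ring_hom R E \<and> carrier E = carrier R \<and>
    (\<exists>r\<in>carrier E. r \<otimes>\<^bsub>E\<^esub> r = \<psi> c)"
proof (cases "\<exists>r\<in>carrier R. r \<otimes>\<^bsub>R\<^esub> r = c")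
  case True
  thus ?thesis using R by (intro exI[of _ R] exI[of _ id]) (auto simp: ring_hom_def)
next
  case False
  interpret R: field R by (rule R)
  let ?Q = "quadratic_extension R c"
  obtain f where f: "bij_betw f (carrier R \<times> carrier R) (carrier R)"
    using infinite_square_bij[OF inf] by blast
  have cQ: "carrier ?Q = carrier R \<times> carrier R" by (simp add: quadratic_extension_def)
  interpret Q: field ?Q using R.field_quadratic_extension c False by blast
  have inj: "inj_on f (carrier ?Q)" using f by (simp add: cQ bij_betw_def)
  let ?E = "image_ring f ?Q"
  have fE: "f \<in> ring_hom ?Q ?E" using inj_imp_image_ring_iso[OF inj] by (simp add: ring_iso_def)
  have i: "(\<lambda>x. (x, \<zero>\<^bsub>R\<^esub>)) \<in> ring_hom R ?Q"
    by (rule ring_hom_memI) (use c in \<open>auto simp: quadratic_extension_def\<close>)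
  have "f \<circ> (\<lambda>x. (x, \<zero>\<^bsub>R\<^esub>)) \<in> ring_hom R ?E" by (rule ring_hom_trans[OF i fE])
  moreover have "carrier ?E = carrier R" using f by (simp add: image_ring_carrier cQ bij_betw_def)
  moreover have "f (\<zero>\<^bsub>R\<^esub>, \<one>\<^bsub>R\<^esub>) \<otimes>\<^bsub>?E\<^esub> f (\<zero>\<^bsub>R\<^esub>, \<one>\<^bsub>R\<^esub>) = (f \<circ> (\<lambda>x. (x, \<zero>\<^bsub>R\<^esub>))) c"
    using ring_hom_mult[OF fE, of "(\<zero>\<^bsub>R\<^esub>, \<one>\<^bsub>R\<^esub>)" "(\<zero>\<^bsub>R\<^esub>, \<one>\<^bsub>R\<^esub>)"] c by (simp add: quadratic_extension_def)
  moreover have "f (\<zero>\<^bsub>R\<^esub>, \<one>\<^bsub>R\<^esub>) \<in> carrier ?E" using ring_hom_closed[OF fE, of "(\<zero>\<^bsub>R\<^esub>, \<one>\<^bsub>R\<^esub>)"] by (simp add: cQ)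
  ultimately show ?thesis using Q.inj_imp_image_ring_is_field[OF inj] by blast
qed

lemma adjoin_square_roots:
  fixes F :: "('a, 'm) ring_scheme" and g :: "'a \<Rightarrow> 'k"
  assumes F: "field F" and inf: "infinite (carrier F)" and g: "inj_on g (carrier F)"
  shows "set cs \<subseteq> carrier F \<Longrightarrow> \<exists>(E :: 'k ring) \<phi>. field E \<and> \<phi> \<in> ring_hom F E \<and>
    carrier E = g ` carrier F \<and> (\<forall>c\<in>set cs. \<exists>r\<in>carrier E. r \<otimes>\<^bsub>E\<^esub> r = \<phi> c)"
proof (induction cs)
  case Nil
  interpret F: field F by (rule F)
  show ?case
    using F.inj_imp_image_ring_is_field[OF g] inj_imp_image_ring_iso[OF g]
    by (intro exI[of _ "image_ring g F"] exI[of _ g]) (simp add: ring_iso_def image_ring_carrier)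
next
  case (Cons c cs)
  then obtain E :: "'k ring" and \<phi> where E: "field E" "\<phi> \<in> ring_hom F E" "carrier E = g ` carrier F"
    and roots: "\<forall>c\<in>set cs. \<exists>r\<in>carrier E. r \<otimes>\<^bsub>E\<^esub> r = \<phi> c"
    by auto
  have "infinite (carrier E)" using E(3) inf g finite_imageD by metis
  moreover have "\<phi> c \<in> carrier E" using Cons.prems ring_hom_closed[OF E(2)] by simp
  ultimately obtain E' :: "'k ring" and \<psi> where E': "field E'" "\<psi> \<in> ring_hom E E'"
      "carrier E' = carrier E" "\<exists>r\<in>carrier E'. r \<otimes>\<^bsub>E'\<^esub> r = \<psi> (\<phi> c)"
    using adjoin_square_root[OF E(1)] by blast
  have "\<exists>r\<in>carrier E'. r \<otimes>\<^bsub>E'\<^esub> r = (\<psi> \<circ> \<phi>) d" if d: "d \<in> set cs" for d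
  proof -
    obtain r where r: "r \<in> carrier E" "r \<otimes>\<^bsub>E\<^esub> r = \<phi> d" using roots d by blast
    thus ?thesis using ring_hom_mult[OF E'(2) r(1) r(1)] ring_hom_closed[OF E'(2) r(1)]
      by (intro bexI[of _ "\<psi> r"]) simp_all
  qed
  thus ?case using E'(3,4) E(3)
    by (intro exI[of _ E'] exI[of _ "\<psi> \<circ> \<phi>"] conjI E'(1) ring_hom_trans[OF E(2) E'(2)]) auto
qed

lemma field_of_char_0_facts:
  assumes "field_of_char_0 F"
  shows "field F" "\<one>\<^bsub>F\<^esub> \<oplus>\<^bsub>F\<^esub> \<one>\<^bsub>F\<^esub> \<noteq> \<zero>\<^bsub>F\<^esub>" "infinite (carrier F)"
proof -
  show F: "field F" using assms by (simp add: field_of_char_0_def)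
  interpret F: field F by (rule F)
  have char: "[n] \<cdot>\<^bsub>F\<^esub> \<one>\<^bsub>F\<^esub> \<noteq> \<zero>\<^bsub>F\<^esub>" if "n > 0" for n :: nat
    using assms that by (simp add: field_of_char_0_def)
  show "\<one>\<^bsub>F\<^esub> \<oplus>\<^bsub>F\<^esub> \<one>\<^bsub>F\<^esub> \<noteq> \<zero>\<^bsub>F\<^esub>" using char[of 2] by (simp add: numeral_2_eq_2)
  have "inj (\<lambda>n::nat. [n] \<cdot>\<^bsub>F\<^esub> \<one>\<^bsub>F\<^esub>)"
  proof (rule linorder_injI)
    fix m n :: nat assume "m < n"
    have "[n] \<cdot>\<^bsub>F\<^esub> \<one>\<^bsub>F\<^esub> = [m] \<cdot>\<^bsub>F\<^esub> \<one>\<^bsub>F\<^esub> \<oplus>\<^bsub>F\<^esub> [(n - m)] \<cdot>\<^bsub>F\<^esub> \<one>\<^bsub>F\<^esub>"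
      using F.add.nat_pow_mult[of "\<one>\<^bsub>F\<^esub>" m "n - m"] \<open>m < n\<close> by simp
    thus "[m] \<cdot>\<^bsub>F\<^esub> \<one>\<^bsub>F\<^esub> \<noteq> [n] \<cdot>\<^bsub>F\<^esub> \<one>\<^bsub>F\<^esub>"
      using char[of "n - m"] \<open>m < n\<close> by auto
  qed
  moreover have "range (\<lambda>n::nat. [n] \<cdot>\<^bsub>F\<^esub> \<one>\<^bsub>F\<^esub>) \<subseteq> carrier F" by auto
  ultimately show "infinite (carrier F)" using infinite_iff_countable_subset by blast
qed

section \<open>A split algebra that receives both algebras\<close>

lemma ring_hom_two_nonzero:
  assumes "field F" "field E" "\<phi> \<in> ring_hom F E" "\<one>\<^bsub>F\<^esub> \<oplus>\<^bsub>F\<^esub> \<one>\<^bsub>F\<^esub> \<noteq> \<zero>\<^bsub>F\<^esub>"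
  shows "\<one>\<^bsub>E\<^esub> \<oplus>\<^bsub>E\<^esub> \<one>\<^bsub>E\<^esub> \<noteq> \<zero>\<^bsub>E\<^esub>"
proof
  interpret F: field F by fact
  interpret E: field E by fact
  interpret \<phi>: ring_hom_ring F E \<phi> using ring_hom_ringI2[OF F.ring_axioms E.ring_axioms assms(3)] .
  assume 0: "\<one>\<^bsub>E\<^esub> \<oplus>\<^bsub>E\<^esub> \<one>\<^bsub>E\<^esub> = \<zero>\<^bsub>E\<^esub>"
  let ?t = "\<one>\<^bsub>F\<^esub> \<oplus>\<^bsub>F\<^esub> \<one>\<^bsub>F\<^esub>"
  have t: "m_inv F ?t \<in> carrier F" "?t \<otimes>\<^bsub>F\<^esub> m_inv F ?t = \<one>\<^bsub>F\<^esub>" using assms(4) F.field_Units by auto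
  have "\<one>\<^bsub>E\<^esub> = \<phi> ?t \<otimes>\<^bsub>E\<^esub> \<phi> (m_inv F ?t)"
    using t \<phi>.hom_mult[of ?t "m_inv F ?t", symmetric] \<phi>.hom_one by (simp del: \<phi>.hom_mult \<phi>.hom_add)
  also have "... = \<zero>\<^bsub>E\<^esub>" using 0 t by simp
  finally show False by simp
qed

text \<open>Over a field of characteristic other than two this is the split quaternion algebra, and transposition is an
  orthogonal involution of it.\<close>

definition mat2_algebra :: "('a, 'm) ring_scheme \<Rightarrow> ('a, 'a mat2) module" where
  "mat2_algebra R =
     \<lparr> carrier = carrier (mat2_ring R), monoid.mult = monoid.mult (mat2_ring R),
       one = one (mat2_ring R), ring.zero = ring.zero (mat2_ring R), ring.add = ring.add (mat2_ring R),
       smult = (\<lambda>k x. case x of Mat2 a b c d \<Rightarrow> Mat2 (k \<otimes>\<^bsub>R\<^esub> a) (k \<otimes>\<^bsub>R\<^esub> b) (k \<otimes>\<^bsub>R\<^esub> c) (k \<otimes>\<^bsub>R\<^esub> d)) \<rparr>"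

fun mat2_transpose :: "'a mat2 \<Rightarrow> 'a mat2" where
  "mat2_transpose (Mat2 a b c d) = Mat2 a c b d"

lemma mat2_algebra_simps [simp]:
  "carrier (mat2_algebra R) = carrier (mat2_ring R)"
  "monoid.mult (mat2_algebra R) = monoid.mult (mat2_ring R)"
  "one (mat2_algebra R) = one (mat2_ring R)"
  "ring.zero (mat2_algebra R) = ring.zero (mat2_ring R)"
  "ring.add (mat2_algebra R) = ring.add (mat2_ring R)"
  "k \<odot>\<^bsub>mat2_algebra R\<^esub> Mat2 a b c d = Mat2 (k \<otimes>\<^bsub>R\<^esub> a) (k \<otimes>\<^bsub>R\<^esub> b) (k \<otimes>\<^bsub>R\<^esub> c) (k \<otimes>\<^bsub>R\<^esub> d)"
  by (simp_all add: mat2_algebra_def)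

lemma (in field) assoc_algebra_mat2: "assoc_algebra R (mat2_algebra R)"
proof -
  have ring: "ring (mat2_algebra R)" by (rule ring_cong[OF ring_mat2_ring]) simp_all
  show ?thesis
  proof (intro assoc_algebra.intro module.intro)
    show "assoc_algebra_axioms R (mat2_algebra R)"
      by unfold_locales (auto elim!: mat2_ring_induct[rotated] simp: r_distr m_ac)
    show "module_axioms R (mat2_algebra R)"
      by unfold_locales (auto elim!: mat2_ring_induct[rotated] simp: r_distr l_distr m_assoc)
  qed (use ring in \<open>auto simp: ring_def field_axioms is_cring\<close>)
qed

text \<open>The generators are symmetric matrices, so that transposition fixes both.\<close>

lemma (in field) quaternion_mat2:
  assumes two: "\<one> \<oplus> \<one> \<noteq> \<zero>"
  shows "quaternion R (mat2_algebra R) (Mat2 \<one> \<zero> \<zero> (\<ominus> \<one>)) (Mat2 \<zero> \<one> \<one> \<zero>) \<one> \<one>"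
    (is "quaternion R ?M ?i ?j \<one> \<one>")
proof -
  interpret M2: assoc_algebra R ?M by (rule assoc_algebra_mat2)
  have m: "\<ominus>\<^bsub>?M\<^esub> (Mat2 \<zero> \<one> (\<ominus> \<one>) \<zero>) = Mat2 \<zero> (\<ominus> \<one>) \<one> \<zero>"
    by (rule M2.M.minus_equality) (simp_all add: l_neg r_neg)
  interpret M2: quat_units R ?M ?i ?j \<one> \<one>
    by unfold_locales (use two m in \<open>simp_all add: l_minus r_minus\<close>)
  let ?h = "inv (\<one> \<oplus> \<one>)"
  have h: "?h \<in> carrier R" "(\<one> \<oplus> \<one>) \<otimes> ?h = \<one>" using two field_Units by auto
  have half: "x \<otimes> ?h \<oplus> x \<otimes> ?h = x" if "x \<in> carrier R" for x
  proof -
    have "x \<otimes> ?h \<oplus> x \<otimes> ?h = x \<otimes> ((\<one> \<oplus> \<one>) \<otimes> ?h)" using that h(1) by (simp add: l_distr r_distr)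
    thus ?thesis using that h by simp
  qed
  have "carrier ?M \<subseteq> quat_comb ?M ?i ?j ` M2.coords"
  proof
    fix x assume "x \<in> carrier ?M"
    then obtain a b c d where x: "x = Mat2 a b c d" "a \<in> carrier R" "b \<in> carrier R" "c \<in> carrier R" "d \<in> carrier R"
      by (auto simp: mat2_ring_def)
    let ?v = "(a \<otimes> ?h \<oplus> d \<otimes> ?h, a \<otimes> ?h \<ominus> d \<otimes> ?h, b \<otimes> ?h \<oplus> c \<otimes> ?h, b \<otimes> ?h \<ominus> c \<otimes> ?h)"
    have aux: "(p \<oplus> q) \<oplus> (p \<ominus> q) = p \<oplus> p" "(p \<oplus> q) \<ominus> (p \<ominus> q) = q \<oplus> q"
      if "p \<in> carrier R" "q \<in> carrier R" for p q
      using that by (simp add: minus_eq a_ac r_neg, simp add: minus_eq minus_add a_assoc a_lcomm[of p q] r_neg2)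
    have "quat_comb ?M ?i ?j ?v = x"
      using x h(1) aux[of "a \<otimes> ?h" "d \<otimes> ?h"] aux[of "b \<otimes> ?h" "c \<otimes> ?h"] half
      by (simp add: quat_comb_def r_minus minus_eq)
    thus "x \<in> quat_comb ?M ?i ?j ` M2.coords" using x h(1) by (intro image_eqI[of _ _ ?v]) auto
  qed
  moreover have "quat_comb ?M ?i ?j ` M2.coords \<subseteq> carrier ?M"
    by (rule image_subsetI) (rule M2.quat_comb_closed)
  ultimately have "bij_betw (quat_comb ?M ?i ?j) M2.coords (carrier ?M)"
    by (intro bij_betw_imageI M2.quat_comb_inj subset_antisym)
  thus ?thesis by unfold_locales
qed

lemma (in field) mat2_transpose_involution:
  "alg_involution R (mat2_algebra R) mat2_transpose"
  unfolding alg_involution_def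
  by (auto elim!: mat2_ring_induct[rotated] simp: m_comm)

text \<open>Transport of structure along an injection \<open>h\<close>.\<close>

definition image_algebra :: "('a \<Rightarrow> 'b) \<Rightarrow> ('f, 'a, 'n) module_scheme \<Rightarrow> ('f, 'b) module" where
  "image_algebra h A =
     \<lparr> carrier = carrier (image_ring h A), monoid.mult = monoid.mult (image_ring h A),
       one = one (image_ring h A), ring.zero = ring.zero (image_ring h A),
       ring.add = ring.add (image_ring h A),
       smult = (\<lambda>c x. h (c \<odot>\<^bsub>A\<^esub> inv_into (carrier A) h x)) \<rparr>"

lemma (in quaternion) quaternion_image:
  assumes h: "inj_on h (carrier A)"
  shows "quaternion F (image_algebra h A) (h i) (h j) a b"
    and "alg_involution F A s \<Longrightarrow>
      alg_involution F (image_algebra h A) (h \<circ> s \<circ> inv_into (carrier A) h)"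
proof -
  let ?H = "image_algebra h A"
  have ops: "carrier ?H = h ` carrier A" "\<one>\<^bsub>?H\<^esub> = h \<one>\<^bsub>A\<^esub>" "\<zero>\<^bsub>?H\<^esub> = h \<zero>\<^bsub>A\<^esub>"
    "\<And>x y. \<lbrakk>x \<in> carrier A; y \<in> carrier A\<rbrakk> \<Longrightarrow> h x \<otimes>\<^bsub>?H\<^esub> h y = h (x \<otimes>\<^bsub>A\<^esub> y)"
    "\<And>x y. \<lbrakk>x \<in> carrier A; y \<in> carrier A\<rbrakk> \<Longrightarrow> h x \<oplus>\<^bsub>?H\<^esub> h y = h (x \<oplus>\<^bsub>A\<^esub> y)"
    "\<And>c x. x \<in> carrier A \<Longrightarrow> c \<odot>\<^bsub>?H\<^esub> h x = h (c \<odot>\<^bsub>A\<^esub> x)"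
    using ring_hom_mult[of h A "image_ring h A"] ring_hom_add[of h A "image_ring h A"]
      inj_imp_image_ring_iso[OF h] h
    by (simp_all add: image_algebra_def image_ring_carrier image_ring_one image_ring_zero ring_iso_def)
  have ring: "ring ?H"
    by (rule ring_cong[OF A.inj_imp_image_ring_is_ring[OF h]]) (simp_all add: image_algebra_def)
  have alg: "assoc_algebra F ?H"
  proof (intro assoc_algebra.intro module.intro)
    show "assoc_algebra_axioms F ?H"
      by unfold_locales (auto simp: ops smult_mult_left smult_mult_right)
    show "module_axioms F ?H"
      by unfold_locales (auto simp: ops smult_l_distr smult_r_distr smult_assoc1)
  qed (use ring in \<open>auto simp: ring_def F.field_axioms F.is_cring\<close>)
  interpret H: assoc_algebra F ?H by (rule alg)
  have minus: "\<ominus>\<^bsub>?H\<^esub> (h x) = h (\<ominus>\<^bsub>A\<^esub> x)" if "x \<in> carrier A" for x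
    by (rule H.M.minus_equality) (use that in \<open>simp_all add: ops M.l_neg\<close>)
  interpret H: quat_units F ?H "h i" "h j" a b
    by unfold_locales
      (use a_nonzero b_nonzero two_nonzero nontrivial inj_onD[OF h, of "\<one>\<^bsub>A\<^esub>" "\<zero>\<^bsub>A\<^esub>"] in
        \<open>auto simp: ops ii jj ji minus\<close>)
  have comb: "quat_comb ?H (h i) (h j) v = h (quat_comb A i j v)" if "v \<in> coords" for v
    using that by (cases v) (simp add: quat_comb_apply quat_comb_def ops)
  have "bij_betw (h \<circ> quat_comb A i j) coords (h ` carrier A)"
    using basis h by (intro bij_betw_trans) (auto simp: bij_betw_def)
  hence "bij_betw (quat_comb ?H (h i) (h j)) coords (carrier ?H)"
    using comb by (subst bij_betw_cong[of _ _ "h \<circ> quat_comb A i j"]) (simp_all only: comp_apply ops)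
  thus "quaternion F ?H (h i) (h j) a b" by unfold_locales
  assume s: "alg_involution F A s"
  note s' = involution_facts[OF s]
  show "alg_involution F ?H (h \<circ> s \<circ> inv_into (carrier A) h)"
    unfolding alg_involution_def using h s' by (auto simp: ops)
qed

lemma split_quaternions:
  fixes E :: "'k ring"
  assumes E: "field E" "\<one>\<^bsub>E\<^esub> \<oplus>\<^bsub>E\<^esub> \<one>\<^bsub>E\<^esub> \<noteq> \<zero>\<^bsub>E\<^esub>" and h: "inj_on (h :: 'k mat2 \<Rightarrow> 'h) (carrier (mat2_ring E))"
  shows "\<exists>(H :: ('k, 'h) module) s i j. quaternion E H i j \<one>\<^bsub>E\<^esub> \<one>\<^bsub>E\<^esub> \<and> alg_involution E H s \<and> s i = i \<and> s j = j"
proof -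
  interpret E: field E by (rule E)
  let ?M = "mat2_algebra E" and ?i = "Mat2 \<one>\<^bsub>E\<^esub> \<zero>\<^bsub>E\<^esub> \<zero>\<^bsub>E\<^esub> (\<ominus>\<^bsub>E\<^esub> \<one>\<^bsub>E\<^esub>)" and ?j = "Mat2 \<zero>\<^bsub>E\<^esub> \<one>\<^bsub>E\<^esub> \<one>\<^bsub>E\<^esub> \<zero>\<^bsub>E\<^esub>"
  let ?s = "h \<circ> mat2_transpose \<circ> inv_into (carrier ?M) h"
  interpret M: quaternion E ?M ?i ?j "\<one>\<^bsub>E\<^esub>" "\<one>\<^bsub>E\<^esub>" by (rule E.quaternion_mat2[OF E(2)])
  have h': "inj_on h (carrier ?M)" using h by simp
  have "?s (h ?i) = h ?i" "?s (h ?j) = h ?j" using h by simp_all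
  thus ?thesis
    using M.quaternion_image(1)[OF h'] M.quaternion_image(2)[OF h' E.mat2_transpose_involution] by blast
qed

text \<open>The elements \<open>p u\<close> and \<open>q v\<close> have the squares \<open>\<phi> a\<close> and \<open>\<phi> b\<close>, they anticommute, and \<open>t\<close> fixes them.\<close>

lemma embedding_into_split:
  assumes F: "field F" and \<phi>: "\<phi> \<in> ring_hom F E"
    and Q: "quaternion F B i j a b" and s: "alg_involution F B s" "s i = i" "s j = j"
    and H: "quaternion E H u v \<one>\<^bsub>E\<^esub> \<one>\<^bsub>E\<^esub>" and t: "alg_involution E H t" "t u = u" "t v = v"
    and p: "p \<in> carrier E" "p \<otimes>\<^bsub>E\<^esub> p = \<phi> a" and q: "q \<in> carrier E" "q \<otimes>\<^bsub>E\<^esub> q = \<phi> b"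
  shows "\<exists>e. inv_alg_embedding F B s (restrict_scalars \<phi> H) t e"
proof -
  interpret B: quaternion F B i j a b by (rule Q)
  interpret H: quaternion E H u v "\<one>\<^bsub>E\<^esub>" "\<one>\<^bsub>E\<^esub>" by (rule H)
  let ?R = "restrict_scalars \<phi> H" and ?x = "p \<odot>\<^bsub>H\<^esub> u" and ?y = "q \<odot>\<^bsub>H\<^esub> v"
  interpret R: assoc_algebra F ?R
    using assoc_algebra_restrict_scalars[OF H.assoc_algebra_axioms F \<phi>] .
  have sim: "carrier ?R = carrier H" "\<one>\<^bsub>?R\<^esub> = \<one>\<^bsub>H\<^esub>" "\<zero>\<^bsub>?R\<^esub> = \<zero>\<^bsub>H\<^esub>" "monoid.mult ?R = monoid.mult H"
    "ring.add ?R = ring.add H" "\<And>c x. c \<odot>\<^bsub>?R\<^esub> x = \<phi> c \<odot>\<^bsub>H\<^esub> x"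
    by (simp_all add: restrict_scalars_def)
  have minus: "\<ominus>\<^bsub>?R\<^esub> x = \<ominus>\<^bsub>H\<^esub> x" if "x \<in> carrier H" for x
    by (rule R.M.minus_equality) (use that in \<open>simp_all add: sim H.M.l_neg\<close>)
  have "?x \<otimes>\<^bsub>H\<^esub> ?x = \<phi> a \<odot>\<^bsub>H\<^esub> \<one>\<^bsub>H\<^esub>" "?y \<otimes>\<^bsub>H\<^esub> ?y = \<phi> b \<odot>\<^bsub>H\<^esub> \<one>\<^bsub>H\<^esub>"
    using p q by (simp_all add: H.smult_mult_left H.smult_mult_right H.ii H.jj H.smult_assoc1[symmetric])
  moreover have "?y \<otimes>\<^bsub>H\<^esub> ?x = \<ominus>\<^bsub>H\<^esub> (?x \<otimes>\<^bsub>H\<^esub> ?y)"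
    using p q by (simp add: H.smult_mult_left H.smult_mult_right H.ji H.smult_r_minus H.smult_lcomm[of p q])
  ultimately have units: "quat_units F ?R ?x ?y a b"
    using p q B.a_nonzero B.b_nonzero B.two_nonzero H.nontrivial
    by unfold_locales (simp_all add: sim minus)
  have "t ?x = ?x" "t ?y = ?y" using H.involution_facts(3)[OF t(1)] p q t by simp_all
  thus ?thesis
    by (rule B.presentation_embedding[OF s units alg_involution_restrict_scalars[OF t(1) \<phi>]])
qed

lemma large_split_embedding:
  assumes inf: "infinite (carrier F)" and U: "large_type TYPE('h) (carrier F)"
    and E: "carrier E = (g :: 'a \<Rightarrow> 'k) ` carrier F" "inj_on g (carrier F)"
  shows "\<exists>h :: 'k mat2 \<Rightarrow> 'h. inj_on h (carrier (mat2_ring E))"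
proof -
  obtain f where f: "bij_betw f (carrier F \<times> carrier F) (carrier F)"
    using infinite_square_bij[OF inf] by blast
  obtain k :: "'a \<Rightarrow> 'h" where k: "inj_on k (carrier F)" using U by (auto simp: large_type_def)
  define g' where "g' = inv_into (carrier F) g"
  have g': "g' x \<in> carrier F" "g (g' x) = x" if "x \<in> carrier E" for x
    using that unfolding E(1) g'_def by (simp_all add: inv_into_into f_inv_into_f)
  define pair where "pair x y = f (x, y)" for x y
  have pair_closed: "pair x y \<in> carrier F" if "x \<in> carrier F" "y \<in> carrier F" for x y
    using that bij_betw_apply[OF f, of "(x, y)"] by (simp add: pair_def)
  have pair_eq: "pair x y = pair x' y' \<longleftrightarrow> x = x' \<and> y = y'"
    if "x \<in> carrier F" "y \<in> carrier F" "x' \<in> carrier F" "y' \<in> carrier F" for x y x' y'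
    using that inj_on_eq_iff[OF bij_betw_imp_inj_on[OF f], of "(x, y)" "(x', y')"]
    by (auto simp: pair_def)
  define h where "h M = (case M of Mat2 a b c d \<Rightarrow> k (pair (pair (g' a) (g' b)) (pair (g' c) (g' d))))" for M
  have "inj_on h (carrier (mat2_ring E))"
  proof (rule inj_onI)
    fix M M' assume M: "M \<in> carrier (mat2_ring E)" and M': "M' \<in> carrier (mat2_ring E)" and "h M = h M'"
    obtain p q r t where m: "M = Mat2 p q r t" "p \<in> carrier E" "q \<in> carrier E" "r \<in> carrier E" "t \<in> carrier E"
      using M by (auto simp: mat2_ring_def)
    obtain p' q' r' t' where m': "M' = Mat2 p' q' r' t'" "p' \<in> carrier E" "q' \<in> carrier E" "r' \<in> carrier E" "t' \<in> carrier E"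
      using M' by (auto simp: mat2_ring_def)
    have "pair (pair (g' p) (g' q)) (pair (g' r) (g' t)) = pair (pair (g' p') (g' q')) (pair (g' r') (g' t'))"
      using \<open>h M = h M'\<close> m m' g'(1) pair_closed unfolding h_def by (intro inj_onD[OF k]) auto
    hence "g' p = g' p' \<and> g' q = g' q' \<and> g' r = g' r' \<and> g' t = g' t'"
      using m m' g'(1) by (simp add: pair_closed pair_eq)
    thus "M = M'" using m m' g'(2) by metis
  qed
  thus ?thesis by blast
qed

section \<open>Isomorphic algebras have conjugate groups\<close>

lemma inv_alg_iso_inverse:
  assumes A: "assoc_algebra F A" and s: "s \<in> carrier A \<rightarrow> carrier A"
    and f: "inv_alg_iso F A s B t f"
  shows "inv_alg_iso F B t A s (inv_into (carrier A) f)"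
proof -
  interpret assoc_algebra F A by (rule A)
  have hom: "f \<in> ring_hom A B" "\<And>c x. \<lbrakk>c \<in> carrier F; x \<in> carrier A\<rbrakk> \<Longrightarrow> f (c \<odot>\<^bsub>A\<^esub> x) = c \<odot>\<^bsub>B\<^esub> f x"
    "\<And>x. x \<in> carrier A \<Longrightarrow> f (s x) = t (f x)" and bij: "bij_betw f (carrier A) (carrier B)"
    using f by (auto simp: inv_alg_iso_def inv_alg_hom_def alg_hom_def)
  let ?g = "inv_into (carrier A) f"
  have g: "?g y \<in> carrier A" "f (?g y) = y" if "y \<in> carrier B" for y
    using that bij_betw_imp_surj_on[OF bij] by (auto intro: inv_into_into f_inv_into_f)
  have gI: "?g y = x" if "x \<in> carrier A" "f x = y" for x y
    using that inv_into_f_f[OF bij_betw_imp_inj_on[OF bij]] by blast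
  have "?g \<in> ring_hom B A"
    using g by (intro ring_hom_memI gI)
      (simp_all add: ring_hom_mult[OF hom(1)] ring_hom_add[OF hom(1)] ring_hom_one[OF hom(1)])
  moreover have "?g (c \<odot>\<^bsub>B\<^esub> y) = c \<odot>\<^bsub>A\<^esub> ?g y" if "c \<in> carrier F" "y \<in> carrier B" for c y
    using g[OF that(2)] that(1) by (intro gI) (simp_all add: hom(2))
  moreover have "?g (t y) = s (?g y)" if "y \<in> carrier B" for y
    using g[OF that] s by (intro gI) (auto simp: hom(3))
  ultimately show ?thesis
    using bij_betw_inv_into[OF bij] by (simp add: inv_alg_iso_def inv_alg_hom_def alg_hom_def)
qed

lemma map_SL_inv:
  assumes A: "assoc_algebra F A" and B: "assoc_algebra F B" and s: "s \<in> carrier A \<rightarrow> carrier A"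
    and f: "inv_alg_hom F A s B t f" and x: "x \<in> carrier (SL_inv A s)"
  shows "map_mat2 f x \<in> carrier (SL_inv B t)"
proof -
  interpret A: assoc_algebra F A by (rule A)
  interpret B: assoc_algebra F B by (rule B)
  have hom: "f \<in> ring_hom A B" "\<And>c x. \<lbrakk>c \<in> carrier F; x \<in> carrier A\<rbrakk> \<Longrightarrow> f (c \<odot>\<^bsub>A\<^esub> x) = c \<odot>\<^bsub>B\<^esub> f x"
    "\<And>x. x \<in> carrier A \<Longrightarrow> t (f x) = f (s x)"
    using f by (auto simp: inv_alg_hom_def alg_hom_def)
  note fc = ring_hom_closed[OF hom(1)]
  have sA: "s x \<in> carrier A" if "x \<in> carrier A" for x using s that by blast
  have minus: "f (x \<ominus>\<^bsub>A\<^esub> y) = f x \<ominus>\<^bsub>B\<^esub> f y" if "x \<in> carrier A" "y \<in> carrier A" for x y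
  proof -
    have "f (\<ominus>\<^bsub>A\<^esub> y) = \<ominus>\<^bsub>B\<^esub> f y"
      using hom(2)[of "\<ominus>\<^bsub>F\<^esub> \<one>\<^bsub>F\<^esub>" y] that fc by (simp add: A.smult_l_minus B.smult_l_minus)
    thus ?thesis using that by (simp add: A.M.minus_eq B.M.minus_eq ring_hom_add[OF hom(1)])
  qed
  obtain p q r u where x': "x = Mat2 p q r u" by (cases x)
  have c: "p \<in> carrier A" "q \<in> carrier A" "r \<in> carrier A" "u \<in> carrier A"
    and sym: "s (p \<otimes>\<^bsub>A\<^esub> s q) = p \<otimes>\<^bsub>A\<^esub> s q" "s (r \<otimes>\<^bsub>A\<^esub> s u) = r \<otimes>\<^bsub>A\<^esub> s u"
    and det: "p \<otimes>\<^bsub>A\<^esub> s u \<ominus>\<^bsub>A\<^esub> q \<otimes>\<^bsub>A\<^esub> s r = \<one>\<^bsub>A\<^esub>"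
    using x by (auto simp: x' SL_inv_carrier fixed_set_def)
  have "f p \<otimes>\<^bsub>B\<^esub> f (s u) \<ominus>\<^bsub>B\<^esub> f q \<otimes>\<^bsub>B\<^esub> f (s r) = f (p \<otimes>\<^bsub>A\<^esub> s u \<ominus>\<^bsub>A\<^esub> q \<otimes>\<^bsub>A\<^esub> s r)"
    using c sA by (simp add: minus ring_hom_mult[OF hom(1)])
  also have "... = \<one>\<^bsub>B\<^esub>" by (simp add: det ring_hom_one[OF hom(1)])
  finally have det': "f p \<otimes>\<^bsub>B\<^esub> f (s u) \<ominus>\<^bsub>B\<^esub> f q \<otimes>\<^bsub>B\<^esub> f (s r) = \<one>\<^bsub>B\<^esub>" .
  have sym': "t (f p \<otimes>\<^bsub>B\<^esub> f (s q)) = f p \<otimes>\<^bsub>B\<^esub> f (s q)" "t (f r \<otimes>\<^bsub>B\<^esub> f (s u)) = f r \<otimes>\<^bsub>B\<^esub> f (s u)"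
    using c sA sym hom(3)[of "p \<otimes>\<^bsub>A\<^esub> s q"] hom(3)[of "r \<otimes>\<^bsub>A\<^esub> s u"] by (simp_all add: ring_hom_mult[OF hom(1)])
  show ?thesis
    using c sA fc sym' det' by (simp add: x' SL_inv_carrier fixed_set_def hom(3))
qed

lemma (in quaternion) conj_set_one:
  assumes s: "alg_involution F A s" and S: "S \<subseteq> carrier (mat2_ring A)"
  shows "Mat2 \<one>\<^bsub>A\<^esub> \<zero>\<^bsub>A\<^esub> \<zero>\<^bsub>A\<^esub> \<one>\<^bsub>A\<^esub> \<in> carrier (SL_inv A s)" (is "?one \<in> _")
    and "conj_set (SL_inv A s) (Mat2 \<one>\<^bsub>A\<^esub> \<zero>\<^bsub>A\<^esub> \<zero>\<^bsub>A\<^esub> \<one>\<^bsub>A\<^esub>) S = S"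
proof -
  note s' = involution_facts[OF s]
  interpret MR: ring "mat2_ring A" by (rule A.ring_mat2_ring)
  show one: "?one \<in> carrier (SL_inv A s)"
    by (simp add: SL_inv_carrier fixed_set_def s' M.minus_eq)
  have inv: "m_inv (SL_inv A s) ?one = ?one"
    using SL_inv_inverse(1)[OF s one] s' by simp
  have "mat2_mult A (mat2_mult A ?one x) ?one = x" if "x \<in> S" for x
  proof -
    have "x \<in> carrier (mat2_ring A)" using that S by blast
    thus ?thesis using MR.l_one[of x] MR.r_one[of x] by (simp add: mult_mat2_ring)
  qed
  thus "conj_set (SL_inv A s) ?one S = S" by (simp add: conj_set_def inv)
qed

text \<open>The embeddings \<open>e1\<close> and \<open>e1 \<circ> f\<^sup>-\<^sup>1\<close> have the same image, so the identity matrix conjugates.\<close>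

lemma iso_imp_conjugate:
  assumes H1: "assoc_algebra F H1" and H2: "assoc_algebra F H2"
    and s1: "s1 \<in> carrier H1 \<rightarrow> carrier H1" and s2: "s2 \<in> carrier H2 \<rightarrow> carrier H2"
    and f: "inv_alg_iso F H1 s1 H2 s2 f"
    and \<phi>: "\<phi> \<in> ring_hom F F'" and H: "quaternion F' H i j a b" and s: "alg_involution F' H s"
    and e1: "inv_alg_embedding F H1 s1 (restrict_scalars \<phi> H) s e1"
  shows "conjugate_in F H1 s1 H2 s2 \<phi> H s"
proof -
  interpret H: quaternion F' H i j a b by (rule H)
  let ?g = "inv_into (carrier H1) f"
  let ?one = "Mat2 \<one>\<^bsub>H\<^esub> \<zero>\<^bsub>H\<^esub> \<zero>\<^bsub>H\<^esub> \<one>\<^bsub>H\<^esub>"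
  note d1 = inv_alg_embedding_restrict_scalarsD[OF e1]
  have g: "inv_alg_iso F H2 s2 H1 s1 ?g" by (rule inv_alg_iso_inverse[OF H1 s1 f])
  hence ghom: "?g \<in> ring_hom H2 H1" "\<And>c x. \<lbrakk>c \<in> carrier F; x \<in> carrier H2\<rbrakk> \<Longrightarrow> ?g (c \<odot>\<^bsub>H2\<^esub> x) = c \<odot>\<^bsub>H1\<^esub> ?g x"
    "\<And>x. x \<in> carrier H2 \<Longrightarrow> ?g (s2 x) = s1 (?g x)" "inj_on ?g (carrier H2)" "?g ` carrier H2 = carrier H1"
    by (auto simp: inv_alg_iso_def inv_alg_hom_def alg_hom_def bij_betw_def)
  have gf: "?g (f x) = x" if "x \<in> carrier H1" for x
    using f that by (auto simp: inv_alg_iso_def bij_betw_def)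
  have e1hom: "e1 \<in> ring_hom H1 (restrict_scalars \<phi> H)"
    using e1 by (simp add: inv_alg_embedding_def inv_alg_hom_def alg_hom_def)
  have e2: "inv_alg_embedding F H2 s2 (restrict_scalars \<phi> H) s (e1 \<circ> ?g)"
    unfolding inv_alg_embedding_def inv_alg_hom_def alg_hom_def
    using ring_hom_trans[OF ghom(1) e1hom] ghom(2,3) ring_hom_closed[OF ghom(1)] d1(5,6)
      comp_inj_on[OF ghom(4)] d1(7) ghom(5)
    by (simp add: restrict_scalars_def)
  have "map_mat2 e1 ` carrier (SL_inv H1 s1) = map_mat2 (e1 \<circ> ?g) ` carrier (SL_inv H2 s2)"
  proof (intro equalityI image_subsetI)
    fix x assume x: "x \<in> carrier (SL_inv H1 s1)"
    hence "map_mat2 f x \<in> carrier (SL_inv H2 s2)"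
      using map_SL_inv[OF H1 H2 s1 _ x] f by (simp add: inv_alg_iso_def)
    moreover have "map_mat2 e1 x = map_mat2 (e1 \<circ> ?g) (map_mat2 f x)"
      using x gf by (cases x) (simp add: SL_inv_carrier)
    ultimately show "map_mat2 e1 x \<in> map_mat2 (e1 \<circ> ?g) ` carrier (SL_inv H2 s2)" by blast
  next
    fix y assume y: "y \<in> carrier (SL_inv H2 s2)"
    hence "map_mat2 ?g y \<in> carrier (SL_inv H1 s1)"
      using map_SL_inv[OF H2 H1 s2 _ y] g by (simp add: inv_alg_iso_def)
    moreover have "map_mat2 (e1 \<circ> ?g) y = map_mat2 e1 (map_mat2 ?g y)"
      by (simp add: mat2.map_comp)
    ultimately show "map_mat2 (e1 \<circ> ?g) y \<in> map_mat2 e1 ` carrier (SL_inv H1 s1)" by blast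
  qed
  moreover have "map_mat2 e1 ` carrier (SL_inv H1 s1) \<subseteq> carrier (mat2_ring H)"
  proof (rule image_subsetI)
    fix x assume "x \<in> carrier (SL_inv H1 s1)"
    thus "map_mat2 e1 x \<in> carrier (mat2_ring H)" using d1(1) by (cases x) (simp add: SL_inv_carrier)
  qed
  moreover have "map_mat2 (\<lambda>c. \<phi> c \<odot>\<^bsub>H\<^esub> \<one>\<^bsub>H\<^esub>) ` SL2 F \<subseteq> carrier (mat2_ring H)"
    using ring_hom_closed[OF \<phi>] by (auto simp: SL2_def)
  ultimately show ?thesis
    unfolding conjugate_in_def using e1 e2 H.conj_set_one[OF s]
    by (intro exI[of _ e1] exI[of _ "e1 \<circ> ?g"] exI[of _ ?one]) simp
qed

theorem theorem5p3:
  fixes F :: "('a, 'm) ring_scheme"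
    and H1 :: "('a, 'h1, 'n1) module_scheme" and s1 :: "'h1 \<Rightarrow> 'h1"
    and H2 :: "('a, 'h2, 'n2) module_scheme" and s2 :: "'h2 \<Rightarrow> 'h2"
  assumes "field_of_char_0 F"
    and "quaternion_algebra F H1" and "quaternion_algebra F H2"
    and "\<exists>f. alg_iso F H1 H2 f"
    and "orthogonal_involution F H1 s1" and "orthogonal_involution F H2 s2"
    and "large_type TYPE('k) (carrier F)" and "large_type TYPE('h) (carrier F)"
  shows "(\<forall>(F' :: 'k ring) (\<phi> :: 'a \<Rightarrow> 'k) (H :: ('k, 'h) module) (s :: 'h \<Rightarrow> 'h).
            field F' \<and> \<phi> \<in> ring_hom F F' \<and>
            quaternion_algebra F' H \<and> orthogonal_involution F' H s \<and>
            (\<exists>e1. inv_alg_embedding F H1 s1 (restrict_scalars \<phi> H) s e1) \<and>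
            (\<exists>e2. inv_alg_embedding F H2 s2 (restrict_scalars \<phi> H) s e2)
            \<longrightarrow> conjugate_in F H1 s1 H2 s2 \<phi> H s)
         \<longleftrightarrow> (\<exists>f. inv_alg_iso F H1 s1 H2 s2 f)"
  (is "?conjugate \<longleftrightarrow> ?isomorphic")
proof
  note F = field_of_char_0_facts[OF assms(1)]
  obtain i1 j1 a1 b1 where H1: "quaternion F H1 i1 j1 a1 b1"
    and s1: "alg_involution F H1 s1" "s1 i1 = i1" "s1 j1 = j1"
    using quaternion_normal_form[OF F(2) assms(2,5)] by blast
  obtain i2 j2 a2 b2 where H2: "quaternion F H2 i2 j2 a2 b2"
    and s2: "alg_involution F H2 s2" "s2 i2 = i2" "s2 j2 = j2"
    using quaternion_normal_form[OF F(2) assms(3,6)] by blast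
  interpret H1: quaternion F H1 i1 j1 a1 b1 by (rule H1)
  interpret H2: quaternion F H2 i2 j2 a2 b2 by (rule H2)
  show ?isomorphic if ?conjugate
  proof -
    obtain g :: "'a \<Rightarrow> 'k" where g: "inj_on g (carrier F)" using assms(7) by (auto simp: large_type_def)
    have sub: "set [a1, b1, a2, b2] \<subseteq> carrier F" by simp
    obtain E :: "'k ring" and \<phi> where E: "field E" "\<phi> \<in> ring_hom F E" "carrier E = g ` carrier F"
      and roots: "\<forall>c\<in>set [a1, b1, a2, b2]. \<exists>r\<in>carrier E. r \<otimes>\<^bsub>E\<^esub> r = \<phi> c"
      using adjoin_square_roots[OF F(1,3) g sub] by (elim exE conjE) (rule that)
    have two: "\<one>\<^bsub>E\<^esub> \<oplus>\<^bsub>E\<^esub> \<one>\<^bsub>E\<^esub> \<noteq> \<zero>\<^bsub>E\<^esub>" by (rule ring_hom_two_nonzero[OF F(1) E(1,2) F(2)])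
    obtain h :: "'k mat2 \<Rightarrow> 'h" where h: "inj_on h (carrier (mat2_ring E))"
      using large_split_embedding[OF F(3) assms(8) E(3) g] by blast
    obtain H :: "('k, 'h) module" and s u v where H: "quaternion E H u v \<one>\<^bsub>E\<^esub> \<one>\<^bsub>E\<^esub>"
      and s: "alg_involution E H s" "s u = u" "s v = v"
      using split_quaternions[OF E(1) two h] by blast
    interpret H: quaternion E H u v "\<one>\<^bsub>E\<^esub>" "\<one>\<^bsub>E\<^esub>" by (rule H)
    have "\<exists>e1. inv_alg_embedding F H1 s1 (restrict_scalars \<phi> H) s e1"
    proof -
      obtain p q where "p \<in> carrier E" "p \<otimes>\<^bsub>E\<^esub> p = \<phi> a1" "q \<in> carrier E" "q \<otimes>\<^bsub>E\<^esub> q = \<phi> b1" using roots by auto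
      thus ?thesis by (rule embedding_into_split[OF F(1) E(2) H1 s1 H s])
    qed
    moreover have "\<exists>e2. inv_alg_embedding F H2 s2 (restrict_scalars \<phi> H) s e2"
    proof -
      obtain p q where "p \<in> carrier E" "p \<otimes>\<^bsub>E\<^esub> p = \<phi> a2" "q \<in> carrier E" "q \<otimes>\<^bsub>E\<^esub> q = \<phi> b2" using roots by auto
      thus ?thesis by (rule embedding_into_split[OF F(1) E(2) H2 s2 H s])
    qed
    moreover have "orthogonal_involution E H s"
      unfolding orthogonal_involution_def using s(1) H.not_standard_involution[OF s] by blast
    ultimately have "conjugate_in F H1 s1 H2 s2 \<phi> H s"
      using that E(1,2) quaternion_algebraI[OF H] by blast
    thus ?thesis by (rule H.conjugate_imp_iso[OF F(1) E(2) H1 s1 H2 s2(1) s(1)])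
  qed
  show ?conjugate if iso: ?isomorphic
  proof (intro allI impI, elim conjE exE)
    fix F' :: "'k ring" and \<phi> :: "'a \<Rightarrow> 'k" and H :: "('k, 'h) module" and s :: "'h \<Rightarrow> 'h" and e1 e2
    assume F': "field F'" "\<phi> \<in> ring_hom F F'" and H: "quaternion_algebra F' H"
      and s: "orthogonal_involution F' H s"
      and e1: "inv_alg_embedding F H1 s1 (restrict_scalars \<phi> H) s e1"
    have two: "\<one>\<^bsub>F'\<^esub> \<oplus>\<^bsub>F'\<^esub> \<one>\<^bsub>F'\<^esub> \<noteq> \<zero>\<^bsub>F'\<^esub>" by (rule ring_hom_two_nonzero[OF F(1) F' F(2)])
    obtain i j a b where Q: "quaternion F' H i j a b" and s': "alg_involution F' H s"
      using quaternion_normal_form[OF two H s] by blast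
    obtain f where f: "inv_alg_iso F H1 s1 H2 s2 f" using iso by blast
    show "conjugate_in F H1 s1 H2 s2 \<phi> H s"
      using iso_imp_conjugate[OF H1.assoc_algebra_axioms H2.assoc_algebra_axioms _ _ f F'(2) Q s' e1]
        H1.involution_facts(1)[OF s1(1)] H2.involution_facts(1)[OF s2(1)] by blast
  qed
qed

end
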